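(* Let $0\le r_0<r_1\le+\infty$, let $I,J$ be finite index sets, let $\sigma_i,\tau_j\in\mathbb{R}\setminus\{0\}$, $\lambda_i,\mu_j\in\mathbb{R}$, $\alpha_i,\beta_j\in\mathbb{C}$ ($i\in I$, $j\in J$), and let $z>0$. With $g(n)$, $l_i$, $m_j$, $\rho$, $\nu$, $\gamma$, $\delta_0$, $\delta_1$, $\Phi$, $u$, $\phi$, $\Phi_{\max}$, $\mathrm{Max}$ as defined in the context, assume: (1) (balancedness) $\sum_{i\in I}\sigma_i=\sum_{j\in J}\tau_j$; (2) (positivity) $l_i(x)>0$ and $m_j(x)>0$ for all $x\in(r_0,r_1)$, $i\in I$, $j\in J$; (3) (genericness) $\delta_0(n;\boldsymbol{\alpha})>0$ and $\delta_1(n;\boldsymbol{\alpha})>0$ for every $n$; (4) (convergence) if $r_1=+\infty$, then the infinite series $g(n)$ is absolutely convergent for every sufficiently large $n$, which is the case if and only if one of the following holds: (i) $0<\rho<1$; (ii) $\rho=1$ and $\nu<0$; (iii) $\rho=1$, $\nu=0$ and $\mathrm{Re}\,\gamma<-1$. Suppose moreover that $\Phi(r_0)<\Phi_{\max}$ and $\Phi(r_1)<\Phi_{\max}$, and that each maximum point $x_0\in\mathrm{Max}$ is non-degenerate in the sense that $\phi''(x_0)>0$. Then $g(n)$ can be expressed as $$g(n)=n^{\gamma+\frac12}\left(\frac{n}{\mathrm{e}}\right)^{\nu n}\Phi_{\max}^{\,n}\,\{C+\Omega(n)\},\qquad C:=\sqrt{2\pi}\sum_{x_0\in\mathrm{Max}}\frac{u(x_0)}{\sqrt{\phi''(x_0)}},$$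 and there exist constants $K>0$, $\lambda>1$ and $N\in\mathbb{N}$ such that the error term $\Omega(n)$ satisfies $$|\Omega(n)|\le K\left\{n^{-\frac12}+\lambda^{-n}\left(\delta_0(n;\boldsymbol{\alpha})^{-1}+\delta_1(n;\boldsymbol{\alpha})^{-1}\right)\right\}\qquad\text{for all } n\ge N.$$
   Context: Here $n$ is a positive integer. The sum considered is $$g(n)=\sum_{k=\lceil r_0n\rceil}^{\lceil r_1n\rceil-1}G(k;n)\,z^k,\qquad G(k;n):=\frac{\prod_{i\in I}\Gamma(\sigma_ik+\lambda_in+\alpha_i)}{\prod_{j\in J}\Gamma(\tau_jk+\mu_jn+\beta_j)},$$ an infinite series over $k\ge\lceil r_0n\rceil$ when $r_1=+\infty$. Put $$\rho:=z\,\frac{\prod_{i\in I}|\sigma_i|^{\sigma_i}}{\prod_{j\in J}|\tau_j|^{\tau_j}},\quad \nu:=\sum_{i\in I}\lambda_i-\sum_{j\in J}\mu_j,\quad \gamma:=\sum_{i\in I}\alpha_i-\sum_{j\in J}\beta_j+\frac{|J|-|I|}{2},$$ $l_i(x):=\sigma_ix+\lambda_i$, $m_j(x):=\tau_jx+\mu_j$, and $\boldsymbol{\alpha}:=(\alpha_i)\times(\beta_j)$. For $*\in\{0,1\}$ (with $r_*$ finite) let $I_*:=\{i\in I: l_i(r_* )=0\}$, $\alpha_i^{( * )}(n):=\alpha_i+\sigma_i(\lceil r_*n\rceil-r_*n)$, and $$\delta_*(n;\boldsymbol{\alpha}):=\min\Big\{1,\ \prod_{i\in I_*}\mathrm{dist}\big(\alpha_i^{(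 * )}(n),\ \mathbb{Z}_{\le 0}+|\sigma_i|\,\mathbb{Z}_{\le -*}\big)\Big\},$$ where $\mathrm{dist}(w,Z)$ is the distance of $w\in\mathbb{C}$ from $Z\subset\mathbb{C}$, $\mathbb{Z}_{\le -*}$ is $\mathbb{Z}_{\le 0}$ for $*=0$ and $\mathbb{Z}_{\le -1}$ for $*=1$, and an empty product is $1$. If $r_1=+\infty$, then $I_1=\emptyset$ and $\delta_1(n;\boldsymbol{\alpha})=1$. For $r_0<x<r_1$ define $$\Phi(x):=z^x\,\frac{\prod_{i\in I}l_i(x)^{l_i(x)}}{\prod_{j\in J}m_j(x)^{m_j(x)}},\qquad u(x):=(2\pi)^{\frac{|I|-|J|}{2}}\,\frac{\prod_{i\in I}l_i(x)^{\alpha_i-\frac12}}{\prod_{j\in J}m_j(x)^{\beta_j-\frac12}},$$ and $\phi(x)$ by $\Phi(x)=\mathrm{e}^{-\phi(x)}$ (with $\phi$ real). Under assumptions (1)–(4) of the claim $\Phi$ extends continuously to $[r_0,r_1]$ (using $0^0=1$ at finite endpoints; if $r_1=+\infty$, $\Phi(+\infty):=\lim_{x\to+\infty}\Phi(x)$), and it attains a maximum there. Put $\Phi_{\max}:=\max_{r_0\le x\le r_1}\Phi(x)>0$ and $\mathrm{Max}:=\{x\in[r_0,r_1]:\Phi(x)=\Phi_{\max}\}$. *)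

theory Defs
  imports "HOL-Analysis.Analysis"
begin

record ('i, 'j) gamma_sum_data =
  Iset :: "'i set"
  Jset :: "'j set"
  sig :: "'i \<Rightarrow> real"
  lam :: "'i \<Rightarrow> real"
  alp :: "'i \<Rightarrow> complex"
  tau :: "'j \<Rightarrow> real"
  mu :: "'j \<Rightarrow> real"
  bet :: "'j \<Rightarrow> complex"
  zval :: real
  r0 :: real
  r1 :: ereal

definition lform :: "('i, 'j) gamma_sum_data \<Rightarrow> 'i \<Rightarrow> real \<Rightarrow> real" where
  "lform D i x = sig D i * x + lam D i"

definition mform :: "('i, 'j) gamma_sum_data \<Rightarrow> 'j \<Rightarrow> real \<Rightarrow> real" where
  "mform D j x = tau D j * x + mu D j"

text \<open>The library has \<open>Gamma w = 0\<close> at the poles \<open>w\<close> and \<open>x / 0 = 0\<close>, so a pole of a Gamma factor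
  in the denominator makes the quotient vanish, in accordance with \<open>1 / Gamma\<close> being entire.\<close>

definition Gterm :: "('i, 'j) gamma_sum_data \<Rightarrow> nat \<Rightarrow> nat \<Rightarrow> complex" where
  "Gterm D k n =
     (\<Prod>i\<in>Iset D. Gamma (of_real (sig D i * real k + lam D i * real n) + alp D i)) /
     (\<Prod>j\<in>Jset D. Gamma (of_real (tau D j * real k + mu D j * real n) + bet D j))"

text \<open>The summation range; natural numbers \<open>k\<close> suffice as \<open>r0 D\<close> is nonnegative.\<close>

definition krange :: "('i, 'j) gamma_sum_data \<Rightarrow> nat \<Rightarrow> nat set" where
  "krange D n = {k. \<lceil>r0 D * real n\<rceil> \<le> int k \<and>
     (r1 D \<noteq> \<infinity> \<longrightarrow> int k \<le> \<lceil>real_of_ereal (r1 D) * real n\<rceil> - 1)}"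

definition gsum :: "('i, 'j) gamma_sum_data \<Rightarrow> nat \<Rightarrow> complex" where
  "gsum D n = (\<Sum>\<^sub>\<infinity>k\<in>krange D n. Gterm D k n * of_real (zval D ^ k))"

definition gsum_abs_convergent :: "('i, 'j) gamma_sum_data \<Rightarrow> nat \<Rightarrow> bool" where
  "gsum_abs_convergent D n \<longleftrightarrow>
     (\<lambda>k. norm (Gterm D k n * of_real (zval D ^ k))) summable_on krange D n"

definition rho :: "('i, 'j) gamma_sum_data \<Rightarrow> real" where
  "rho D = zval D * ((\<Prod>i\<in>Iset D. \<bar>sig D i\<bar> powr sig D i) / (\<Prod>j\<in>Jset D. \<bar>tau D j\<bar> powr tau D j))"

definition nu :: "('i, 'j) gamma_sum_data \<Rightarrow> real" where
  "nu D = (\<Sum>i\<in>Iset D. lam D i) - (\<Sum>j\<in>Jset D. mu D j)"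

definition gam :: "('i, 'j) gamma_sum_data \<Rightarrow> complex" where
  "gam D = (\<Sum>i\<in>Iset D. alp D i) - (\<Sum>j\<in>Jset D. bet D j)
     + of_real ((real (card (Jset D)) - real (card (Iset D))) / 2)"

text \<open>The index set of those \<open>i\<close> with \<open>l\<^sub>i(r) = 0\<close>; it is empty if \<open>r = \<infinity>\<close>, so that
  \<open>delta\<close> below is then 1.\<close>

definition I_at :: "('i, 'j) gamma_sum_data \<Rightarrow> ereal \<Rightarrow> 'i set" where
  "I_at D r = {i \<in> Iset D. r \<noteq> \<infinity> \<and> lform D i (real_of_ereal r) = 0}"

definition alp_at :: "('i, 'j) gamma_sum_data \<Rightarrow> real \<Rightarrow> 'i \<Rightarrow> nat \<Rightarrow> complex" where
  "alp_at D r i n = alp D i + of_real (sig D i * (of_int \<lceil>r * real n\<rceil> - r * real n))"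

text \<open>The parameter \<open>s\<close> is the index (0 or 1) of the endpoint \<open>r\<close>.\<close>

definition delta :: "('i, 'j) gamma_sum_data \<Rightarrow> nat \<Rightarrow> ereal \<Rightarrow> nat \<Rightarrow> real" where
  "delta D s r n = min 1 (\<Prod>i\<in>I_at D r. infdist (alp_at D (real_of_ereal r) i n)
     {of_int a + of_real \<bar>sig D i\<bar> * of_int b | a b :: int. a \<le> 0 \<and> b \<le> - int s})"

definition delta0 :: "('i, 'j) gamma_sum_data \<Rightarrow> nat \<Rightarrow> real" where
  "delta0 D n = delta D 0 (ereal (r0 D)) n"

definition delta1 :: "('i, 'j) gamma_sum_data \<Rightarrow> nat \<Rightarrow> real" where
  "delta1 D n = delta D 1 (r1 D) n"

text \<open>\<open>t\<^sup>t\<close> with \<open>0\<^sup>0 = 1\<close>; the library has \<open>0 powr 0 = 0\<close>.\<close>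

definition self_pow :: "real \<Rightarrow> real" where
  "self_pow t = (if t = 0 then 1 else t powr t)"

definition Phi_real :: "('i, 'j) gamma_sum_data \<Rightarrow> real \<Rightarrow> real" where
  "Phi_real D x = zval D powr x *
     ((\<Prod>i\<in>Iset D. self_pow (lform D i x)) / (\<Prod>j\<in>Jset D. self_pow (mform D j x)))"

definition Phi :: "('i, 'j) gamma_sum_data \<Rightarrow> ereal \<Rightarrow> real" where
  "Phi D x = (if x = \<infinity> then Lim at_top (Phi_real D) else Phi_real D (real_of_ereal x))"

definition phi :: "('i, 'j) gamma_sum_data \<Rightarrow> real \<Rightarrow> real" where
  "phi D x = - ln (Phi_real D x)"

definition ufun :: "('i, 'j) gamma_sum_data \<Rightarrow> real \<Rightarrow> complex" where
  "ufun D x = of_real ((2 * pi) powr ((real (card (Iset D)) - real (card (Jset D))) / 2)) *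
     ((\<Prod>i\<in>Iset D. of_real (lform D i x) powr (alp D i - 1 / 2)) /
      (\<Prod>j\<in>Jset D. of_real (mform D j x) powr (bet D j - 1 / 2)))"

text \<open>Under the convergence conditions \<open>Phi D\<close> is continuous on the compact interval
  \<open>{ereal (r0 D)..r1 D}\<close>, so this supremum is a maximum.\<close>

definition Phi_max :: "('i, 'j) gamma_sum_data \<Rightarrow> real" where
  "Phi_max D = (SUP x\<in>{ereal (r0 D)..r1 D}. Phi D x)"

definition Maxset :: "('i, 'j) gamma_sum_data \<Rightarrow> ereal set" where
  "Maxset D = {x \<in> {ereal (r0 D)..r1 D}. Phi D x = Phi_max D}"

definition phi'' :: "('i, 'j) gamma_sum_data \<Rightarrow> real \<Rightarrow> real" where
  "phi'' D = deriv (deriv (phi D))"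

definition Cconst :: "('i, 'j) gamma_sum_data \<Rightarrow> complex" where
  "Cconst D = of_real (sqrt (2 * pi)) *
     (\<Sum>x\<in>Maxset D. ufun D (real_of_ereal x) / of_real (sqrt (phi'' D (real_of_ereal x))))"

end

(* Stirling's formula, with an error term that is uniform along horizontal lines, turns every summand with
k/n in a compact part of the open interval into n^gamma (n/e)^(nu n) u(k/n) Phi(k/n)^n (1 + O(1/n)).
Around a non-degenerate peak of Phi the sum is compared with a Gaussian sum, which differs from the Gaussian
integral by O(1), that is, by a relative error of order n^(-1/2).  Away from the peaks Phi is at most
q Phi_max with q < 1, and a bound on Gamma that is uniform up to t = 0, with the distance to the poles as
weight, shows that these summands are exponentially smaller than the main term, up to the factor
1/delta_0 + 1/delta_1.  For r_1 = infinity the same bounds at the scale of k decide the convergence. *)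
theory Submission
  imports Defs "HOL-Probability.Distributions" "HOL-Real_Asymp.Real_Asymp"
begin

section \<open>Stirling's formula with error term\<close>

text \<open>The functional equation makes consecutive values of the ratio of Gamma (t + \<alpha>) to
  its main term differ by a factor 1 + O(1/t^2), hence it converges with rate 1/t; the duplication
  formula, which the main terms satisfy exactly, forces the limit to be 1. Balancedness makes the
  sum of the l_i minus the sum of the m_j the constant \<open>nu D\<close>, so that (n/e)^(nu n)
  leaves the sum as a factor free of k; for r_1 = \<infinity> it also cancels the k ln k growth in
  the logarithm of a summand. Two obstacles shape the bounds away from the peaks. A form l_i may
  vanish at an endpoint, where Stirling's formula fails and poles may come close; the lattice in
  \<open>delta\<close> consists of the poles translated back by the steps |\<sigma>_i| that the
  argument takes as k leaves the endpoint, so one number controls all k at once. On an infinite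
  range a factor q^n does not by itself sum over k; a fixed number n_0 of the n factors Phi is given
  up for a summable power of k. The cost is a power of n, which half of q^n absorbs; this leaves the
  rate 1 / sqrt q.\<close>

text \<open>The main term sqrt (2 pi) t^(t + \<alpha> - 1/2) e^(-t) of Gamma (t + \<alpha>) for real t > 0.\<close>

definition stirling :: "complex \<Rightarrow> real \<Rightarrow> complex" where
  "stirling \<alpha> t = exp (of_real (ln t) * (of_real t + \<alpha> - 1 / 2) - of_real t + of_real (ln (2 * pi) / 2))"

lemma stirling_nonzero [simp]: "stirling \<alpha> t \<noteq> 0"
  by (simp add: stirling_def)

lemma bigo_at_topE:
  fixes f g :: "real \<Rightarrow> real"
  assumes "f \<in> O(g)"
  obtains B T where "B > 0" "T \<ge> 1" "\<And>t. t \<ge> T \<Longrightarrow> \<bar>f t\<bar> \<le> B * \<bar>g t\<bar>"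
proof -
  from assms obtain B where B: "B > 0" "eventually (\<lambda>t. \<bar>f t\<bar> \<le> B * \<bar>g t\<bar>) at_top"
    by (auto elim!: landau_o.bigE)
  then obtain T where "\<And>t. t \<ge> T \<Longrightarrow> \<bar>f t\<bar> \<le> B * \<bar>g t\<bar>"
    by (auto simp: eventually_at_top_linorder)
  with B that[of B "max T 1"] show ?thesis by auto
qed

text \<open>With exp (w - v) = 1 + (w - v) + r the terms linear in v cancel, so v enters only
  through its square. In \<open>stirling_step\<close> this removes the contribution of \<alpha> of
  order 1/t.\<close>

lemma norm_one_plus_times_exp_minus_one_le:
  fixes v w :: complex
  assumes v: "norm v \<le> 1" and w: "norm w \<le> 1"
  shows "norm ((1 + v) * exp (w - v) - 1) \<le> 38 * (norm w + (norm v)\<^sup>2)"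
proof -
  define y where "y = w - v"
  define r where "r = exp y - (1 + y)"
  have ny: "norm y \<le> norm w + norm v" unfolding y_def by (rule norm_triangle_ineq4)
  \<comment> \<open>First-order Taylor remainder. Since |y| \<le> 2, the exponential is at most exp
    2 \<le> 9.\<close>
  have "norm r \<le> exp \<bar>Re y\<bar> * (norm y)\<^sup>2"
    using Taylor_exp[of y 1] by (simp add: r_def power2_eq_square numeral_2_eq_2)
  also have "exp \<bar>Re y\<bar> \<le> exp 2"
    using abs_Re_le_cmod[of y] ny v w by simp
  also have "exp 2 \<le> (9::real)"
    using exp_le power_mono[of "exp (1::real)" 3 2] by (simp flip: exp_of_nat_mult)
  finally have r: "norm r \<le> 9 * (norm y)\<^sup>2" by (simp add: mult_right_mono)
  have "(norm y)\<^sup>2 \<le> (norm w + norm v)\<^sup>2" using ny by (rule power_mono) simp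
  also have "\<dots> \<le> 2 * (norm w)\<^sup>2 + 2 * (norm v)\<^sup>2"
    using sum_squares_bound[of "norm w" "norm v"] by (simp add: power2_sum)
  also have "(norm w)\<^sup>2 \<le> norm w" using w by (simp add: power2_eq_square mult_left_le)
  finally have y2: "(norm y)\<^sup>2 \<le> 2 * norm w + 2 * (norm v)\<^sup>2" by simp
  have "(1 + v) * exp (w - v) - 1 = w + v * w - v * v + (1 + v) * r"
    by (simp add: r_def y_def algebra_simps)
  also have "norm \<dots> \<le> norm w + norm v * norm w + norm v * norm v + (1 + norm v) * norm r"
    by (intro order.trans[OF norm_triangle_ineq] order.trans[OF norm_triangle_ineq4] add_mono)
       (auto simp: norm_mult intro!: mult_right_mono order.trans[OF norm_triangle_ineq])
  also have "\<dots> \<le> norm w + 1 * norm w + norm v * norm v + 2 * norm r"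
    using v by (intro add_mono mult_right_mono) auto
  also have "\<dots> \<le> 2 * norm w + (norm v)\<^sup>2 + 2 * (9 * (2 * norm w + 2 * (norm v)\<^sup>2))"
    using r y2 by (simp add: power2_eq_square)
  \<comment> \<open>The coefficients are 2 + 36 for |w| and 1 + 36 for |v|^2.\<close>
  also have "\<dots> \<le> 38 * (norm w + (norm v)\<^sup>2)" by (simp add: algebra_simps)
  finally show ?thesis .
qed

text \<open>The main term nearly satisfies the functional equation of Gamma: the exponent t +
  \<alpha> - 1/2 is such that the defect has no term of order 1/t.\<close>

lemma stirling_step:
  fixes \<alpha> :: complex
  obtains C T where "C > 0" "T \<ge> 1"
    "\<And>t. t \<ge> T \<Longrightarrow> norm ((of_real t + \<alpha>) * stirling \<alpha> t / stirling \<alpha> (t + 1) - 1) \<le> C / t\<^sup>2"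
proof -
  have "(\<lambda>t::real. 1 - (t + 1 / 2) * (ln (t + 1) - ln t)) \<in> O(\<lambda>t. 1 / t\<^sup>2)" by real_asymp
  then obtain B1 T1 where B1: "B1 > 0" "T1 \<ge> 1"
    "\<And>t::real. t \<ge> T1 \<Longrightarrow> \<bar>1 - (t + 1 / 2) * (ln (t + 1) - ln t)\<bar> \<le> B1 * \<bar>1 / t\<^sup>2\<bar>"
    by (rule bigo_at_topE) blast
  have "(\<lambda>t::real. 1 / t - (ln (t + 1) - ln t)) \<in> O(\<lambda>t. 1 / t\<^sup>2)" by real_asymp
  then obtain B2 T2 where B2: "B2 > 0" "T2 \<ge> 1"
    "\<And>t::real. t \<ge> T2 \<Longrightarrow> \<bar>1 / t - (ln (t + 1) - ln t)\<bar> \<le> B2 * \<bar>1 / t\<^sup>2\<bar>"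
    by (rule bigo_at_topE) blast
  define B where "B = B1 + norm \<alpha> * B2"
  have B: "B > 0" using B1 B2 by (simp add: B_def add_pos_nonneg)
  \<comment> \<open>Large enough for |v| \<le> 1, by the entry \<open>norm \<alpha>\<close>, and for
    |w| \<le> 1, by the entry \<open>B\<close>.\<close>
  define T where "T = max (max T1 T2) (max (norm \<alpha>) B)"
  define C where "C = 38 * (B + (norm \<alpha>)\<^sup>2)"
  have "C > 0" using B by (simp add: C_def add_pos_nonneg)
  moreover have "T \<ge> 1" using B1 by (simp add: T_def)
  moreover have "norm ((of_real t + \<alpha>) * stirling \<alpha> t / stirling \<alpha> (t + 1) - 1) \<le> C / t\<^sup>2" if t: "t \<ge> T" for t
  proof -
    have t1: "t \<ge> 1" "t \<ge> T1" "t \<ge> T2" "t \<ge> norm \<alpha>" "t \<ge> B" using t B1 by (auto simp: T_def)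
    define l where "l = ln (t + 1) - ln t"
    define v where "v = \<alpha> / of_real t"
    \<comment> \<open>The exponent of the quotient of main terms is - ln t + w - v. Both parts of w
      are O(1/t^2); v is split off because 1 + v = (t + \<alpha>) / t is the factor from the
      functional equation.\<close>
    define w where "w = of_real (1 - (t + 1 / 2) * l) + \<alpha> * of_real (1 / t - l)"
    have nv: "norm v = norm \<alpha> / t" using t1 by (simp add: v_def norm_divide)
    have "norm w \<le> \<bar>1 - (t + 1 / 2) * l\<bar> + norm \<alpha> * \<bar>1 / t - l\<bar>"
      unfolding w_def by (rule order.trans[OF norm_triangle_ineq]) (simp only: norm_of_real norm_mult order.refl)
    also have "\<dots> \<le> B1 * \<bar>1 / t\<^sup>2\<bar> + norm \<alpha> * (B2 * \<bar>1 / t\<^sup>2\<bar>)"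
      using B1(3)[of t] B2(3)[of t] t1 unfolding l_def by (intro add_mono mult_left_mono) auto
    also have "\<dots> = B / t\<^sup>2" using t1 by (simp add: B_def field_simps)
    finally have nw: "norm w \<le> B / t\<^sup>2" .
    have "B / t\<^sup>2 \<le> 1" using t1 mult_mono[of 1 t B t] B by (simp add: power2_eq_square)
    hence w1: "norm w \<le> 1" using nw by simp
    have v1: "norm v \<le> 1" using nv t1 by simp
    have "stirling \<alpha> t / stirling \<alpha> (t + 1) = exp (- of_real (ln t) + w - v)"
      unfolding stirling_def exp_diff[symmetric]
      by (rule arg_cong[where f = exp]) (use t1 in \<open>simp add: w_def v_def l_def field_simps\<close>)
    also have "\<dots> = exp (w - v) / of_real t"
      using t1 by (simp add: exp_add exp_diff exp_minus exp_of_real field_simps)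
    finally have eq: "(of_real t + \<alpha>) * stirling \<alpha> t / stirling \<alpha> (t + 1) = (1 + v) * exp (w - v)"
      using t1 by (simp add: v_def field_simps)
    have "norm ((1 + v) * exp (w - v) - 1) \<le> 38 * (norm w + (norm v)\<^sup>2)"
      using norm_one_plus_times_exp_minus_one_le[OF v1 w1] by (simp add: algebra_simps)
    also have "\<dots> \<le> 38 * (B / t\<^sup>2 + (norm \<alpha>)\<^sup>2 / t\<^sup>2)" using nw by (simp add: nv power_divide)
    also have "\<dots> = C / t\<^sup>2" by (simp only: C_def add_divide_distrib distrib_left times_divide_eq_right)
    finally show ?thesis unfolding eq .
  qed
  ultimately show ?thesis by (rule that)
qed

text \<open>The steps telescope by 1/s^2 \<le> 1/(s-1) - 1/s. A step is bounded relative to f s, so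
  the induction must also keep |f s| \<le> 2 |f t|; as t \<ge> 1 + 2 C, the telescoped bound is at
  most |f t|, which gives this.\<close>

lemma shift_iterates_bound:
  fixes f :: "real \<Rightarrow> complex"
  assumes C: "C > 0" and t: "t \<ge> 2" "t \<ge> 1 + 2 * C"
    and step: "\<And>s. s \<ge> t \<Longrightarrow> norm (f (s + 1) - f s) \<le> C / s\<^sup>2 * norm (f s)"
  shows "norm (f (t + real n) - f t) \<le> 2 * C / (t - 1) * norm (f t)"
proof -
  have "norm (f (t + real n) - f t) \<le> 2 * C * norm (f t) * (1 / (t - 1) - 1 / (t + real n - 1))"
  proof (induction n)
    case (Suc n)
    define s where "s = t + real n"
    have s: "s \<ge> t" by (simp add: s_def)
    have "2 * C * (1 / (t - 1) - 1 / (s - 1)) \<le> 2 * C * (1 / (t - 1))"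
      using C s t by (intro mult_left_mono) auto
    also have "\<dots> \<le> 1" using t C by (simp add: field_simps)
    finally have "norm (f (t + real n) - f t) \<le> 1 * norm (f t)"
      using Suc.IH mult_right_mono[of "2 * C * (1 / (t - 1) - 1 / (s - 1))" 1 "norm (f t)"]
      by (simp only: s_def mult_ac) (smt (verit) norm_ge_zero)
    hence n2: "norm (f s) \<le> 2 * norm (f t)"
      using norm_triangle_sub[of "f s" "f t"] by (simp add: s_def)
    have "norm (f (s + 1) - f s) \<le> C / s\<^sup>2 * norm (f s)" by (rule step) (use s in simp)
    also have "\<dots> \<le> C * (1 / (s - 1) - 1 / s) * (2 * norm (f t))"
    proof (intro mult_mono n2)
      have "1 / s\<^sup>2 \<le> 1 / (s - 1) - 1 / s"
        using s t by (simp add: field_simps power2_eq_square)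
      from mult_left_mono[OF this, of C] show "C / s\<^sup>2 \<le> C * (1 / (s - 1) - 1 / s)" using C by simp
      thus "0 \<le> C * (1 / (s - 1) - 1 / s)" using C by (smt (verit) divide_nonneg_nonneg zero_le_power2)
    qed auto
    finally have "norm (f (s + 1) - f s) \<le> 2 * C * norm (f t) * (1 / (s - 1) - 1 / s)"
      by (simp add: mult_ac)
    with Suc.IH norm_triangle_ineq[of "f (s + 1) - f s" "f s - f t"]
    have "norm (f (s + 1) - f t) \<le> 2 * C * norm (f t) * (1 / (t - 1) - 1 / s)"
      by (simp add: s_def algebra_simps)
    thus ?case by (simp add: s_def add_ac)
  qed simp
  also have "\<dots> \<le> 2 * C * norm (f t) * (1 / (t - 1))"
    using C t by (intro mult_left_mono) auto
  finally show ?thesis by (simp add: mult_ac)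
qed

section \<open>The normalised Gamma function and its limit\<close>

definition Gamma_ratio :: "complex \<Rightarrow> real \<Rightarrow> complex" where
  "Gamma_ratio \<alpha> t = Gamma (of_real t + \<alpha>) / stirling \<alpha> t"

lemma Re_pos_not_nonpos_Int: "Re z > 0 \<Longrightarrow> z \<notin> \<int>\<^sub>\<le>\<^sub>0"
  by (auto elim!: nonpos_Ints_cases)

lemma Gamma_ratio_step:
  fixes \<alpha> :: complex
  obtains C T where "C > 0" "T \<ge> 1"
    "\<And>t. t \<ge> T \<Longrightarrow> norm (Gamma_ratio \<alpha> (t + 1) - Gamma_ratio \<alpha> t) \<le> C / t\<^sup>2 * norm (Gamma_ratio \<alpha> t)"
proof -
  obtain C T where CT: "C > 0" "T \<ge> 1"
    "\<And>t. t \<ge> T \<Longrightarrow> norm ((of_real t + \<alpha>) * stirling \<alpha> t / stirling \<alpha> (t + 1) - 1) \<le> C / t\<^sup>2"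
    using stirling_step[of \<alpha>] by blast
  have "norm (Gamma_ratio \<alpha> (t + 1) - Gamma_ratio \<alpha> t) \<le> C / t\<^sup>2 * norm (Gamma_ratio \<alpha> t)"
    if t: "t \<ge> max T (norm \<alpha> + 1)" for t
  proof -
    have "Re (of_real t + \<alpha>) > 0" using t abs_Re_le_cmod[of \<alpha>] by auto
    hence "of_real t + \<alpha> \<notin> \<int>\<^sub>\<le>\<^sub>0" by (rule Re_pos_not_nonpos_Int)
    from Gamma_plus1[OF this]
    have "Gamma (of_real (t + 1) + \<alpha>) = (of_real t + \<alpha>) * Gamma (of_real t + \<alpha>)"
      by (simp add: add_ac)
    hence "Gamma_ratio \<alpha> (t + 1) - Gamma_ratio \<alpha> t =
        ((of_real t + \<alpha>) * stirling \<alpha> t / stirling \<alpha> (t + 1) - 1) * Gamma_ratio \<alpha> t"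
      by (simp add: Gamma_ratio_def field_simps)
    thus ?thesis using CT(3)[of t] t by (simp only: norm_mult) (rule mult_right_mono, auto)
  qed
  with that[of C "max T (norm \<alpha> + 1)"] CT show ?thesis by auto
qed

lemma Gamma_ratio_bound:
  fixes \<alpha> :: complex
  obtains C T where "C > 0" "T > 1"
    "\<And>t n. t \<ge> T \<Longrightarrow> norm (Gamma_ratio \<alpha> (t + real n) - Gamma_ratio \<alpha> t) \<le> C / (t - 1) * norm (Gamma_ratio \<alpha> t)"
proof -
  obtain C T where CT: "C > 0" "T \<ge> 1"
    "\<And>t. t \<ge> T \<Longrightarrow> norm (Gamma_ratio \<alpha> (t + 1) - Gamma_ratio \<alpha> t) \<le> C / t\<^sup>2 * norm (Gamma_ratio \<alpha> t)"
    using Gamma_ratio_step[of \<alpha>] by blast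
  show ?thesis
  proof (rule that[of "2 * C" "max T (max 2 (1 + 2 * C))"])
    fix t n assume t: "max T (max 2 (1 + 2 * C)) \<le> t"
    show "norm (Gamma_ratio \<alpha> (t + real n) - Gamma_ratio \<alpha> t) \<le> 2 * C / (t - 1) * norm (Gamma_ratio \<alpha> t)"
      by (rule shift_iterates_bound) (use t CT in auto)
  qed (use CT in auto)
qed

lemma Gamma_ratio_not_zero: "t > norm \<alpha> \<Longrightarrow> Gamma_ratio \<alpha> t \<noteq> 0"
  using abs_Re_le_cmod[of \<alpha>]
  by (auto simp: Gamma_ratio_def Gamma_eq_zero_iff dest!: arg_cong[of _ _ Re] elim!: nonpos_Ints_cases)

lemma tendsto_near_limit:
  fixes f :: "nat \<Rightarrow> complex"
  assumes "f \<longlonglongrightarrow> L" "\<And>n. norm (f n - a) \<le> b"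
  shows "norm (L - a) \<le> b"
  by (rule tendsto_upperbound[of "\<lambda>n. norm (f n - a)" _ sequentially])
     (use assms in \<open>auto intro!: tendsto_intros\<close>)

text \<open>The bound on shifts is relative to the starting value: from some M on all values stay
  within |a_M| / 2 of a_M, which is not 0, so the limit of this Cauchy sequence cannot be 0
  either.\<close>

lemma convergent_Gamma_ratio_0: "\<exists>L. L \<noteq> 0 \<and> (\<lambda>n. Gamma_ratio 0 (real n)) \<longlonglongrightarrow> L"
proof -
  let ?a = "\<lambda>n. Gamma_ratio 0 (real n)"
  obtain C T where CT: "C > 0" "T > 1"
    "\<And>t n. t \<ge> T \<Longrightarrow> norm (Gamma_ratio 0 (t + real n) - Gamma_ratio 0 t) \<le> C / (t - 1) * norm (Gamma_ratio 0 t)"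
    using Gamma_ratio_bound[of 0] by blast
  obtain M :: nat where M: "real M \<ge> max T (2 * C + 2)" using real_arch_simple by blast
  have *: "norm (?a (m + n) - ?a m) \<le> C / (real m - 1) * norm (?a m)" if "m \<ge> M" for m n
    using CT(3)[of "real m" n] that M by simp
  have two: "norm (?a (M + n) - ?a M) \<le> 1 / 2 * norm (?a M)" for n
  proof -
    have "C / (real M - 1) \<le> 1 / 2" using M CT(1) by (simp add: field_simps)
    thus ?thesis using *[of M n] by (meson mult_right_mono norm_ge_zero order.trans order.refl)
  qed
  hence bd: "norm (?a m) \<le> 2 * norm (?a M)" if "m \<ge> M" for m
    using norm_triangle_sub[of "?a m" "?a M"] two[of "m - M"] that norm_ge_zero[of "?a M"] by (simp; linarith)
  have "Cauchy ?a"
  proof (rule CauchyI')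
    fix e :: real assume e: "e > 0"
    obtain m0 :: nat where m0: "real m0 > 1 + C * (2 * norm (?a M)) / e" using reals_Archimedean2 by blast
    show "\<exists>m0. \<forall>m\<ge>m0. \<forall>n>m. dist (?a m) (?a n) < e"
    proof (intro exI[of _ "max M m0"] allI impI)
      fix m n assume mn: "m \<ge> max M m0" "n > m"
      have m1: "real m > 1" using M mn CT by linarith
      have "dist (?a m) (?a n) = norm (?a (m + (n - m)) - ?a m)" using mn by (simp add: dist_norm norm_minus_commute)
      also have "\<dots> \<le> C / (real m - 1) * norm (?a m)" by (rule *) (use mn in simp)
      also have "\<dots> \<le> C / (real m - 1) * (2 * norm (?a M))"
        by (intro mult_left_mono bd) (use mn m1 CT in auto)
      also have "real m > 1 + C * (2 * norm (?a M)) / e" using mn m0 by linarith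
      hence "C / (real m - 1) * (2 * norm (?a M)) < e"
        using e m1 by (simp add: field_simps)
      finally show "dist (?a m) (?a n) < e" .
    qed
  qed
  then obtain L where L: "?a \<longlonglongrightarrow> L" by (auto simp: convergent_eq_Cauchy[symmetric] Cauchy_convergent_iff[symmetric] convergent_def)
  have "norm (L - ?a M) \<le> 1 / 2 * norm (?a M)"
    by (rule tendsto_near_limit[of "\<lambda>n. ?a (M + n)"])
       (use two LIMSEQ_ignore_initial_segment[OF L, of M] in \<open>auto simp: add_ac\<close>)
  moreover have "?a M \<noteq> 0" by (rule Gamma_ratio_not_zero) (use M CT in auto)
  ultimately have "L \<noteq> 0" by auto
  with L show ?thesis by blast
qed

text \<open>Euler's limit formula gives Gamma (w + n) ~ n^w Gamma n, and the main terms obey the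
  same relation. Hence the limit for \<alpha> = 0 along the integers is shared by all admissible
  \<alpha> and t.\<close>

lemma Gamma_ratio_LIMSEQ:
  assumes L: "(\<lambda>n. Gamma_ratio 0 (real n)) \<longlonglongrightarrow> L" and t: "t \<ge> 0" "t + Re \<alpha> > 0"
  shows "(\<lambda>n. Gamma_ratio \<alpha> (t + real n)) \<longlonglongrightarrow> L"
proof -
  define w where "w = of_real t + \<alpha>"
  have w: "w \<notin> \<int>\<^sub>\<le>\<^sub>0" by (rule Re_pos_not_nonpos_Int) (use t in \<open>simp add: w_def\<close>)
  have Gw: "Gamma w \<noteq> 0" using w by (simp add: Gamma_eq_zero_iff)
  have "(\<lambda>n. Gamma w / Gamma_series' w n) \<longlonglongrightarrow> Gamma w / Gamma w"
    by (intro tendsto_intros Gamma_series'_LIMSEQ Gw)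
  hence A: "(\<lambda>n. Gamma w / Gamma_series' w n) \<longlonglongrightarrow> 1" using Gw by simp
  have "(\<lambda>n. (real n + t - 1 / 2) * (ln (real n) - ln (real n + t)) + t) \<longlonglongrightarrow> 0"
    using t by real_asymp
  moreover have "(\<lambda>n. ln (real n) - ln (real n + t)) \<longlonglongrightarrow> 0"
    using t by real_asymp
  ultimately have "(\<lambda>n. exp (of_real ((real n + t - 1 / 2) * (ln (real n) - ln (real n + t)) + t) +
      \<alpha> * of_real (ln (real n) - ln (real n + t)))) \<longlonglongrightarrow> exp (of_real 0 + \<alpha> * of_real 0)"
    by (intro tendsto_intros)
  hence B: "(\<lambda>n. exp (of_real ((real n + t - 1 / 2) * (ln (real n) - ln (real n + t)) + t) +
      \<alpha> * of_real (ln (real n) - ln (real n + t)))) \<longlonglongrightarrow> 1" by simp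
  have "eventually (\<lambda>n. Gamma w / Gamma_series' w n * Gamma_ratio 0 (real n) *
     exp (of_real ((real n + t - 1 / 2) * (ln (real n) - ln (real n + t)) + t) +
      \<alpha> * of_real (ln (real n) - ln (real n + t))) = Gamma_ratio \<alpha> (t + real n)) sequentially"
    using eventually_gt_at_top[of 0]
  proof eventually_elim
    case (elim n)
    have p: "pochhammer w n = Gamma (w + of_nat n) / Gamma w" by (rule pochhammer_Gamma[OF w])
    have f: "Gamma (of_nat n) = (fact (n - 1) :: complex)"
      using elim Gamma_fact[of "n - 1", where 'a = complex] by (simp add: of_nat_diff)
    have "Gamma (w + of_nat n) \<noteq> 0"
      unfolding Gamma_eq_zero_iff by (rule Re_pos_not_nonpos_Int) (use t in \<open>simp add: w_def\<close>)
    hence g: "Gamma w / Gamma_series' w n = Gamma (w + of_nat n) / (Gamma (of_nat n) * exp (w * of_real (ln (real n))))"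
      using Gw by (simp add: Gamma_series'_def p f field_simps)
    \<comment> \<open>The two main terms differ by exactly n^w, up to the exponential factor whose
      limit is 1.\<close>
    have e: "stirling \<alpha> (t + real n) * exp (of_real ((real n + t - 1 / 2) * (ln (real n) - ln (real n + t)) + t) +
      \<alpha> * of_real (ln (real n) - ln (real n + t))) = stirling 0 (real n) * exp (w * of_real (ln (real n)))"
      unfolding stirling_def exp_add[symmetric]
      by (rule arg_cong[where f = exp]) (simp add: w_def algebra_simps)
    have "Gamma (of_nat n) \<noteq> (0::complex)" by (simp add: f)
    thus ?case unfolding g using e
      by (simp add: Gamma_ratio_def w_def field_simps)
  qed
  moreover have "(\<lambda>n. Gamma w / Gamma_series' w n * Gamma_ratio 0 (real n) *
     exp (of_real ((real n + t - 1 / 2) * (ln (real n) - ln (real n + t)) + t) +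
      \<alpha> * of_real (ln (real n) - ln (real n + t)))) \<longlonglongrightarrow> 1 * L * 1"
    by (intro tendsto_mult A L B)
  ultimately show ?thesis using tendsto_cong by fastforce
qed

text \<open>The main terms for 0 and 1/2 satisfy Legendre's duplication formula exactly, so the
  ratios obey R_0(n) R_{1/2}(n) = R_0(2n). All three tend to L, thus L^2 = L with L nonzero. This is
  what confirms the constant sqrt (2 pi).\<close>

lemma Gamma_ratio_0_LIMSEQ: "(\<lambda>n. Gamma_ratio 0 (real n)) \<longlonglongrightarrow> 1"
proof -
  obtain L where L: "L \<noteq> 0" "(\<lambda>n. Gamma_ratio 0 (real n)) \<longlonglongrightarrow> L"
    using convergent_Gamma_ratio_0 by blast
  have "(\<lambda>n. Gamma_ratio (1 / 2) (0 + real n)) \<longlonglongrightarrow> L"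
    by (rule Gamma_ratio_LIMSEQ[OF L(2)]) auto
  moreover have "filterlim (\<lambda>n::nat. 2 * n) at_top sequentially"
    by (rule filterlim_subseq) (simp add: strict_mono_def)
  hence "(\<lambda>n. Gamma_ratio 0 (real (2 * n))) \<longlonglongrightarrow> L"
    using filterlim_compose[OF L(2)] by blast
  ultimately have "(\<lambda>n. Gamma_ratio 0 (real n) * Gamma_ratio (1 / 2) (0 + real n) / Gamma_ratio 0 (real (2 * n)))
      \<longlonglongrightarrow> L * L / L" by (intro tendsto_intros L)
  moreover have "eventually (\<lambda>n. Gamma_ratio 0 (real n) * Gamma_ratio (1 / 2) (0 + real n) / Gamma_ratio 0 (real (2 * n)) = 1) sequentially"
    using eventually_gt_at_top[of 0]
  proof eventually_elim
    case (elim n)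
    have n0: "of_nat n \<notin> (\<int>\<^sub>\<le>\<^sub>0 :: complex set)" "of_nat n + 1 / 2 \<notin> (\<int>\<^sub>\<le>\<^sub>0 :: complex set)"
      using elim by (auto intro!: Re_pos_not_nonpos_Int)
    have n2: "2 * of_nat n \<notin> (\<int>\<^sub>\<le>\<^sub>0 :: complex set)"
      using elim by (auto intro!: Re_pos_not_nonpos_Int)
    have G: "Gamma (2 * of_nat n :: complex) \<noteq> 0" unfolding Gamma_eq_zero_iff by (rule n2)
    have "Gamma (of_nat n :: complex) * Gamma (of_nat n + 1 / 2) =
        exp ((1 - 2 * of_nat n) * of_real (ln 2)) * of_real (sqrt pi) * Gamma (2 * of_nat n)"
      by (rule Gamma_legendre_duplication[OF n0])
    also have "of_real (sqrt pi) = exp (of_real (ln pi / 2) :: complex)"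
      by (simp add: exp_of_real ln_sqrt[symmetric])
    finally have dup: "Gamma (of_nat n :: complex) * Gamma (of_nat n + 1 / 2) =
        exp ((1 - 2 * of_nat n) * of_real (ln 2)) * exp (of_real (ln pi / 2)) * Gamma (2 * of_nat n)" .
    have st: "stirling 0 (real n) * stirling (1 / 2) (real n) =
        exp ((1 - 2 * of_nat n) * of_real (ln 2)) * exp (of_real (ln pi / 2)) * stirling 0 (real (2 * n))"
      unfolding stirling_def exp_add[symmetric]
      by (rule arg_cong[where f = exp]) (use elim in \<open>simp add: ln_mult field_simps\<close>)
    have "Gamma_ratio 0 (real n) * Gamma_ratio (1 / 2) (0 + real n) = Gamma_ratio 0 (real (2 * n))"
      unfolding Gamma_ratio_def times_divide_times_eq using dup st by simp
    moreover have "Gamma_ratio 0 (real (2 * n)) \<noteq> 0" using G by (simp add: Gamma_ratio_def)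
    ultimately show ?case by simp
  qed
  ultimately have "(\<lambda>n::nat. 1 :: complex) \<longlonglongrightarrow> L * L / L"
    by (rule Lim_transform_eventually)
  hence "L * L / L = 1" by (simp only: tendsto_const_iff[OF sequentially_bot])
  with L show ?thesis by simp
qed

text \<open>Letting n tend to infinity in the bound on integer shifts compares the value at t with
  the limit 1, with the same constant for all real t. The bound is relative to the value at t, which
  is therefore at most 2.\<close>

lemma Gamma_ratio_asymp:
  fixes \<alpha> :: complex
  obtains C T where "C > 0" "T > 0" "\<And>t. t \<ge> T \<Longrightarrow> norm (Gamma_ratio \<alpha> t - 1) \<le> C / t"
proof -
  obtain C T where CT: "C > 0" "T > 1"
    "\<And>t n. t \<ge> T \<Longrightarrow> norm (Gamma_ratio \<alpha> (t + real n) - Gamma_ratio \<alpha> t) \<le> C / (t - 1) * norm (Gamma_ratio \<alpha> t)"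
    using Gamma_ratio_bound[of \<alpha>] by blast
  have "norm (Gamma_ratio \<alpha> t - 1) \<le> 4 * C / t" if t: "t \<ge> Max {T, 2, 2 * C + 1, norm \<alpha> + 1}" for t
  proof -
    have t': "t \<ge> T" "t \<ge> 2" "t \<ge> 2 * C + 1" "t > norm \<alpha>" using t by auto
    have "(\<lambda>n. Gamma_ratio \<alpha> (t + real n)) \<longlonglongrightarrow> 1"
      by (rule Gamma_ratio_LIMSEQ[OF Gamma_ratio_0_LIMSEQ]) (use t' abs_Re_le_cmod[of \<alpha>] in auto)
    hence le: "norm (1 - Gamma_ratio \<alpha> t) \<le> C / (t - 1) * norm (Gamma_ratio \<alpha> t)"
      by (rule tendsto_near_limit) (rule CT(3)[OF t'(1)])
    have "C / (t - 1) \<le> 1 / 2" using t' CT by (simp add: field_simps)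
    hence "C / (t - 1) * norm (Gamma_ratio \<alpha> t) \<le> 1 / 2 * norm (Gamma_ratio \<alpha> t)" by (rule mult_right_mono) simp
    with le have "norm (Gamma_ratio \<alpha> t) \<le> 2"
      using norm_triangle_sub[of "Gamma_ratio \<alpha> t" 1] norm_minus_commute[of "Gamma_ratio \<alpha> t" 1] norm_one[where 'a=complex]
      by linarith
    hence "C / (t - 1) * norm (Gamma_ratio \<alpha> t) \<le> C / (t - 1) * 2" using CT t' by (intro mult_left_mono) auto
    also have "\<dots> \<le> 4 * C / t"
      using t' CT mult_left_mono[of 2 t C] by (simp add: field_simps)
    finally show ?thesis using le by (simp add: norm_minus_commute)
  qed
  with that[of "4 * C" "Max {T, 2, 2 * C + 1, norm \<alpha> + 1}"] CT show ?thesis by auto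
qed

section \<open>Global bounds for the Gamma function\<close>

lemma self_pow_pos: "t \<ge> 0 \<Longrightarrow> self_pow t > 0"
  by (simp add: self_pow_def)

lemma self_pow_eq_exp: "t > 0 \<Longrightarrow> self_pow t = exp (t * ln t)"
  by (simp add: self_pow_def powr_def)

lemma continuous_on_self_pow: "continuous_on {0..} self_pow"
proof -
  have "((\<lambda>t::real. t powr t) \<longlongrightarrow> 1) (at_right 0)" by real_asymp
  hence "(self_pow \<longlongrightarrow> 1) (at_right 0)"
    by (rule Lim_transform_eventually)
       (rule eventually_mono[OF eventually_at_right_less], simp add: self_pow_def)
  hence "(self_pow \<longlongrightarrow> self_pow 0) (at 0 within {0..})"
    by (simp add: self_pow_def at_within_Ici_at_right)
  moreover have "(self_pow \<longlongrightarrow> self_pow x) (at x within {0..})" if x: "x > 0" for x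
  proof -
    have "isCont (\<lambda>t::real. t powr t) x" using x by (intro continuous_intros) auto
    hence "((\<lambda>t::real. t powr t) \<longlongrightarrow> x powr x) (at x)" by (simp add: isCont_def)
    moreover have "eventually (\<lambda>t. t powr t = self_pow t) (at x)"
      using x by (auto simp: eventually_at self_pow_def dist_real_def intro!: exI[of _ x])
    ultimately have "(self_pow \<longlongrightarrow> x powr x) (at x)" by (rule Lim_transform_eventually)
    thus ?thesis using x tendsto_within_subset[of self_pow _ x UNIV "{0..}"] by (simp add: self_pow_def)
  qed
  ultimately show ?thesis by (auto simp: continuous_on_def order.order_iff_strict)
qed

lemma norm_stirling:
  assumes "t > 0"
  shows "norm (stirling \<alpha> t) = sqrt (2 * pi) * (t powr (Re \<alpha> - 1 / 2) * self_pow t * exp (- t))"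
proof -
  have "norm (stirling \<alpha> t) = exp (ln t * (t + Re \<alpha> - 1 / 2) - t + ln (sqrt (2 * pi)))"
    by (simp add: stirling_def ln_sqrt)
  also have "\<dots> = exp (ln t * (Re \<alpha> - 1 / 2)) * exp (t * ln t) * exp (- t) * exp (ln (sqrt (2 * pi)))"
    unfolding exp_add[symmetric] by (rule arg_cong[where f = exp]) (simp add: algebra_simps)
  finally show ?thesis using assms by (simp add: self_pow_eq_exp powr_def mult_ac)
qed

text \<open>The two inequalities between x and y serve the two signs of p: the first is used for p
  \<ge> 0, the second for p < 0.\<close>

lemma powr_compare:
  fixes x y p :: real
  assumes "x > 0" "y > 0" "x \<le> c * y" "y \<le> c * x"
  shows "x powr p \<le> c powr \<bar>p\<bar> * y powr p"
proof -
  have c: "c > 0" using assms by (smt (verit) zero_less_mult_pos2 mult_nonneg_nonneg mult_nonpos_nonneg)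
  show ?thesis
  proof (cases "p \<ge> 0")
    case True
    have "x powr p \<le> (c * y) powr p" using True assms by (intro powr_mono2) auto
    with True c assms show ?thesis by (simp add: powr_mult)
  next
    case False
    have "(c * x) powr p \<le> y powr p" using False assms c by (intro powr_mono2') auto
    hence "c powr (- p) * (c powr p * x powr p) \<le> c powr (- p) * y powr p"
      using c assms by (intro mult_left_mono) (auto simp: powr_mult)
    moreover have "c powr (- p) * (c powr p * x powr p) = x powr p"
      using c by (simp add: powr_minus mult.assoc[symmetric])
    ultimately show ?thesis using False by simp
  qed
qed

lemma powr_shift_compare:
  fixes t p :: real
  assumes "t \<ge> 1"
  shows "t powr p \<le> 2 powr \<bar>p\<bar> * (t + 1) powr p"
  by (rule powr_compare) (use assms in auto)

text \<open>Capped at 1, so that in a product of such weights only the factors close to a pole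
  count: the weight is 1 once the real part is at least 1.\<close>

definition pole_dist :: "complex \<Rightarrow> real" where
  "pole_dist w = min 1 (infdist w \<int>\<^sub>\<le>\<^sub>0)"

lemma pole_dist_nonneg [simp]: "pole_dist w \<ge> 0" and pole_dist_le_1 [simp]: "pole_dist w \<le> 1"
  by (auto simp: pole_dist_def infdist_nonneg)

lemma nonpos_Ints_nonempty: "(\<int>\<^sub>\<le>\<^sub>0 :: complex set) \<noteq> {}"
  using zero_in_nonpos_Ints by blast

text \<open>Subtracting 1 maps the poles into themselves, so every distance from w + 1 to a pole is
  also a distance from w to a pole.\<close>

lemma pole_dist_Suc: "pole_dist w \<le> pole_dist (w + 1)"
proof -
  have "infdist w \<int>\<^sub>\<le>\<^sub>0 \<le> infdist (w + 1) \<int>\<^sub>\<le>\<^sub>0"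
  proof (subst (2) infdist_notempty[OF nonpos_Ints_nonempty], rule cINF_greatest[OF nonpos_Ints_nonempty])
    fix p :: complex assume "p \<in> \<int>\<^sub>\<le>\<^sub>0"
    then obtain m where "p = of_int m" "m \<le> 0" by (auto elim: nonpos_Ints_cases)
    hence "p - 1 = of_int (m - 1)" "m - 1 \<le> 0" by auto
    hence "p - 1 \<in> \<int>\<^sub>\<le>\<^sub>0" by (metis nonpos_Ints_of_int)
    from infdist_le[OF this, of w] show "infdist w \<int>\<^sub>\<le>\<^sub>0 \<le> dist (w + 1) p"
      by (simp add: dist_norm algebra_simps)
  qed
  thus ?thesis by (auto simp: pole_dist_def)
qed

text \<open>Induction on the number N of unit shifts that bring \<alpha> into the right half plane,
  where Gamma is continuous. Undoing a shift divides by w. For |w| \<ge> 1/2 this costs a factor 2;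
  for smaller w the weight is at most |w| and turns Gamma w into Gamma (w + 1), which is bounded
  near 1.\<close>

lemma norm_Gamma_pole_dist_bounded:
  fixes \<alpha> :: complex
  shows "\<exists>K>0. \<forall>t\<in>{0..T}. norm (Gamma (of_real t + \<alpha>)) * pole_dist (of_real t + \<alpha>) \<le> K"
proof -
  obtain N :: nat where "- Re \<alpha> < real N" using reals_Archimedean2 by blast
  thus ?thesis
  proof (induction N arbitrary: \<alpha>)
    case 0
    hence "of_real ` {0..T} \<inter> (\<lambda>w. w + \<alpha>) -` \<int>\<^sub>\<le>\<^sub>0 = {}"
      by (auto elim!: nonpos_Ints_cases dest!: arg_cong[of _ _ Re])
    hence "continuous_on {0..T} (\<lambda>t. Gamma (of_real t + \<alpha>))"
      by (intro continuous_on_compose2[OF continuous_on_Gamma[of "(\<lambda>t. of_real t + \<alpha>) ` {0..T}"]] continuous_intros) auto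
    hence "bounded ((\<lambda>t. Gamma (of_real t + \<alpha>)) ` {0..T})"
      by (intro compact_imp_bounded compact_continuous_image) auto
    then obtain K where K: "K > 0" "\<forall>t\<in>{0..T}. norm (Gamma (of_real t + \<alpha>)) \<le> K"
      by (auto simp: bounded_pos)
    moreover have "norm (Gamma (of_real t + \<alpha>)) * pole_dist (of_real t + \<alpha>) \<le> norm (Gamma (of_real t + \<alpha>))" for t
      by (rule mult_left_le) auto
    ultimately show ?case by (meson order.trans)
  next
    case (Suc N)
    have "- Re (\<alpha> + 1) < real N" using Suc.prems by simp
    from Suc.IH[OF this] obtain K where K: "K > 0"
      "\<And>t. t \<in> {0..T} \<Longrightarrow> norm (Gamma (of_real t + (\<alpha> + 1))) * pole_dist (of_real t + (\<alpha> + 1)) \<le> K" by auto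
    \<comment> \<open>This disc contains w + 1 for |w| \<le> 1/2 and has no pole in it.\<close>
    have "continuous_on (cball 1 (1 / 2)) (Gamma :: complex \<Rightarrow> complex)"
    proof (intro continuous_intros equals0I)
      fix w :: complex assume "w \<in> cball 1 (1 / 2) \<inter> \<int>\<^sub>\<le>\<^sub>0"
      hence "norm (1 - w) \<le> 1 / 2" "w \<in> \<int>\<^sub>\<le>\<^sub>0" by (auto simp: dist_norm)
      thus False using abs_Re_le_cmod[of "1 - w"] by (auto elim!: nonpos_Ints_cases)
    qed
    hence "bounded (Gamma ` cball (1::complex) (1 / 2))"
      by (intro compact_imp_bounded compact_continuous_image) auto
    then obtain K2 where K2: "K2 > 0" "\<And>w. w \<in> cball (1::complex) (1 / 2) \<Longrightarrow> norm (Gamma w) \<le> K2"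
      by (auto simp: bounded_pos)
    have "norm (Gamma (of_real t + \<alpha>)) * pole_dist (of_real t + \<alpha>) \<le> max (2 * K) K2" if t: "t \<in> {0..T}" for t
    proof -
      define w where "w = of_real t + \<alpha>"
      have K': "norm (Gamma (w + 1)) * pole_dist (w + 1) \<le> K" using K(2)[OF t] by (simp add: w_def add_ac)
      show ?thesis
      proof (cases "w \<in> \<int>\<^sub>\<le>\<^sub>0")
        case True
        \<comment> \<open>\<open>Gamma\<close> has the default value 0 at its poles.\<close>
        thus ?thesis using K by (simp add: w_def[symmetric] Gamma_nonpos_Int)
      next
        case False
        hence w0: "w \<noteq> 0" by auto
        have G: "norm (Gamma (w + 1)) = norm w * norm (Gamma w)"
          using Gamma_plus1[OF False] by (simp add: norm_mult)
        show ?thesis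
        proof (cases "norm w \<ge> 1 / 2")
          case True
          have "1 / 2 * (norm (Gamma w) * pole_dist w) \<le> norm w * (norm (Gamma w) * pole_dist w)"
            by (rule mult_right_mono[OF True]) simp
          also have "\<dots> = norm (Gamma (w + 1)) * pole_dist w" by (simp add: G)
          also have "\<dots> \<le> norm (Gamma (w + 1)) * pole_dist (w + 1)" by (rule mult_left_mono[OF pole_dist_Suc]) simp
          finally show ?thesis using K' by (simp add: w_def[symmetric])
        next
          case False
          have "pole_dist w \<le> norm w"
            using infdist_le[OF zero_in_nonpos_Ints, of w] by (simp add: pole_dist_def dist_norm)
          hence "norm (Gamma w) * pole_dist w \<le> norm (Gamma w) * norm w" by (rule mult_left_mono) simp
          also have "\<dots> = norm (Gamma (w + 1))" by (simp add: G)
          also have "\<dots> \<le> K2" by (rule K2) (use False in \<open>simp add: dist_norm\<close>)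
          finally show ?thesis by (simp add: w_def[symmetric])
        qed
      qed
    qed
    thus ?case using K by (intro exI[of _ "max (2 * K) K2"]) auto
  qed
qed

text \<open>On the compact interval h has a positive minimum, so the plain bound K there becomes a
  multiple of h.\<close>

lemma extend_bound_to_compact:
  fixes f h :: "real \<Rightarrow> real"
  assumes f: "\<And>t. t \<in> {0..T} \<Longrightarrow> f t \<le> K" and fT: "\<And>t. t \<ge> T \<Longrightarrow> f t \<le> A * h t"
    and h: "continuous_on {0..T} h" "\<And>t. t \<ge> 0 \<Longrightarrow> h t > 0" and T: "T \<ge> 0"
  shows "\<exists>K>0. \<forall>t\<ge>0. f t \<le> K * h t"
proof -
  obtain s where s: "s \<in> {0..T}" "\<And>t. t \<in> {0..T} \<Longrightarrow> h s \<le> h t"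
    using continuous_attains_inf[OF _ _ h(1)] T by auto
  have hs: "h s > 0" using s h by auto
  define B where "B = max (\<bar>K\<bar> / h s) (max \<bar>A\<bar> 1)"
  have "f t \<le> B * h t" if t: "t \<ge> 0" for t
  proof (cases "t \<le> T")
    case True
    have "f t \<le> \<bar>K\<bar> / h s * h s" using f[of t] True t hs by auto
    also have "\<dots> \<le> B * h t" using s(2)[of t] True t hs h(2)[of t]
      by (intro mult_mono) (auto simp: B_def le_max_iff_disj)
    finally show ?thesis .
  next
    case False
    hence "f t \<le> A * h t" using fT by simp
    also have "\<dots> \<le> B * h t" using h(2)[OF t] by (intro mult_right_mono) (auto simp: B_def)
    finally show ?thesis .
  qed
  moreover have "B > 0" by (auto simp: B_def)
  ultimately show ?thesis by blast
qed

lemma Gamma_ratio_half: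
  fixes \<alpha> :: complex
  shows "\<exists>T\<ge>1. \<forall>t\<ge>T. 1 / 2 \<le> norm (Gamma_ratio \<alpha> t) \<and> norm (Gamma_ratio \<alpha> t) \<le> 2"
proof -
  obtain C T where CT: "C > 0" "T > 0" "\<And>t. t \<ge> T \<Longrightarrow> norm (Gamma_ratio \<alpha> t - 1) \<le> C / t"
    using Gamma_ratio_asymp[of \<alpha>] by blast
  have bd: "1 / 2 \<le> norm (Gamma_ratio \<alpha> t) \<and> norm (Gamma_ratio \<alpha> t) \<le> 2" if t: "t \<ge> max T (max 1 (2 * C))" for t
  proof -
    have "C / t \<le> 1 / 2" using t CT by (simp add: field_simps)
    moreover have "norm (Gamma_ratio \<alpha> t - 1) \<le> C / t" by (rule CT(3)) (use t in auto)
    ultimately show ?thesis using norm_triangle_ineq2[of 1 "Gamma_ratio \<alpha> t"] norm_triangle_ineq2[of "Gamma_ratio \<alpha> t" 1]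
      norm_minus_commute[of "Gamma_ratio \<alpha> t" 1] norm_one[where 'a = complex] by linarith
  qed
  show ?thesis
  proof (intro exI conjI allI impI)
    show "1 \<le> max T (max 1 (2 * C))" by simp
  qed (use bd in blast)+
qed

lemma continuous_on_stirling_shape:
  "continuous_on {0..T} (\<lambda>t. (t + 1) powr p * self_pow t * exp (- t))"
  by (intro continuous_intros continuous_on_subset[OF continuous_on_self_pow]) auto

text \<open>Stirling's formula for large t, the weighted bound on a compact interval for the rest.
  The shape has t + 1 where the main term has t: the exponent may be negative while t may be 0, and
  for t \<ge> 1 the two are comparable.\<close>

lemma norm_Gamma_le:
  fixes \<alpha> :: complex
  shows "\<exists>K>0. \<forall>t\<ge>0. norm (Gamma (of_real t + \<alpha>)) * pole_dist (of_real t + \<alpha>)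
     \<le> K * ((t + 1) powr (Re \<alpha> - 1 / 2) * self_pow t * exp (- t))"
proof -
  define p where "p = Re \<alpha> - 1 / 2"
  obtain T where T: "T \<ge> 1" "\<And>t. t \<ge> T \<Longrightarrow> norm (Gamma_ratio \<alpha> t) \<le> 2"
    using Gamma_ratio_half[of \<alpha>] by blast
  obtain K where K: "\<And>t. t \<in> {0..T} \<Longrightarrow> norm (Gamma (of_real t + \<alpha>)) * pole_dist (of_real t + \<alpha>) \<le> K"
    using norm_Gamma_pole_dist_bounded[of T \<alpha>] by blast
  have "\<exists>K>0. \<forall>t\<ge>0. norm (Gamma (of_real t + \<alpha>)) * pole_dist (of_real t + \<alpha>)
     \<le> K * ((t + 1) powr p * self_pow t * exp (- t))"
  proof (rule extend_bound_to_compact[of T _ K "2 * sqrt (2 * pi) * 2 powr \<bar>p\<bar>"])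
    fix t assume t: "t \<ge> T"
    have "norm (Gamma (of_real t + \<alpha>)) * pole_dist (of_real t + \<alpha>) \<le> norm (Gamma (of_real t + \<alpha>))"
      by (rule mult_left_le) auto
    also have "\<dots> = norm (Gamma_ratio \<alpha> t) * norm (stirling \<alpha> t)"
      by (simp add: Gamma_ratio_def norm_divide)
    also have "\<dots> \<le> 2 * norm (stirling \<alpha> t)" by (rule mult_right_mono[OF T(2)[OF t]]) simp
    also have "\<dots> = (2 * sqrt (2 * pi) * (self_pow t * exp (- t))) * t powr p"
      using t T by (subst norm_stirling) (auto simp: p_def)
    also have "\<dots> \<le> (2 * sqrt (2 * pi) * (self_pow t * exp (- t))) * (2 powr \<bar>p\<bar> * (t + 1) powr p)"
      using t T by (intro mult_left_mono powr_shift_compare) (auto simp: self_pow_pos less_imp_le)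
    finally show "norm (Gamma (of_real t + \<alpha>)) * pole_dist (of_real t + \<alpha>) \<le>
        2 * sqrt (2 * pi) * 2 powr \<bar>p\<bar> * ((t + 1) powr p * self_pow t * exp (- t))" by (simp add: mult_ac)
  qed (use T K in \<open>auto intro!: continuous_on_stirling_shape simp: self_pow_pos\<close>)
  thus ?thesis by (simp add: p_def)
qed

text \<open>1/Gamma is entire and therefore bounded on a compact interval; for large t the lower
  bound 1/2 on \<open>Gamma_ratio\<close> is inverted.\<close>

lemma norm_rGamma_le:
  fixes \<beta> :: complex
  shows "\<exists>K>0. \<forall>t\<ge>0. norm (rGamma (of_real t + \<beta>)) \<le> K / ((t + 1) powr (Re \<beta> - 1 / 2) * self_pow t * exp (- t))"
proof -
  define p where "p = Re \<beta> - 1 / 2"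
  obtain T where T: "T \<ge> 1" "\<And>t. t \<ge> T \<Longrightarrow> norm (Gamma_ratio \<beta> t) \<ge> 1 / 2"
    using Gamma_ratio_half[of \<beta>] by blast
  have "continuous_on {0..T} (\<lambda>t. rGamma (of_real t + \<beta>))"
    by (intro continuous_on_compose2[OF continuous_on_rGamma[of UNIV]] continuous_intros) auto
  hence "bounded ((\<lambda>t. rGamma (of_real t + \<beta>)) ` {0..T})"
    by (intro compact_imp_bounded compact_continuous_image) auto
  then obtain K where K: "K > 0" "\<And>t. t \<in> {0..T} \<Longrightarrow> norm (rGamma (of_real t + \<beta>)) \<le> K"
    by (auto simp: bounded_pos)
  let ?h = "\<lambda>t. (t + 1) powr p * self_pow t * exp (- t)"
  have hpos: "?h t > 0" if "t \<ge> 0" for t using that by (simp add: self_pow_pos)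
  have "\<exists>K>0. \<forall>t\<ge>0. norm (rGamma (of_real t + \<beta>)) \<le> K * inverse (?h t)"
  proof (rule extend_bound_to_compact[of T _ K "2 * 2 powr \<bar>p\<bar> / sqrt (2 * pi)"])
    fix t assume t: "t \<ge> T"
    have t0: "t > 0" using t T by simp
    have "?h t \<le> (2 powr \<bar>p\<bar> * t powr p) * self_pow t * exp (- t)"
      using t T by (intro mult_right_mono powr_compare) (auto simp: self_pow_pos less_imp_le)
    also have "\<dots> = 2 powr \<bar>p\<bar> / sqrt (2 * pi) * norm (stirling \<beta> t)"
      using t0 by (simp add: norm_stirling p_def)
    also have "\<dots> \<le> 2 powr \<bar>p\<bar> / sqrt (2 * pi) * (2 * norm (Gamma_ratio \<beta> t) * norm (stirling \<beta> t))"
      using T(2)[OF t] by (intro mult_left_mono) (auto intro!: mult_right_mono[of 1, simplified])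
    also have "\<dots> = 2 * 2 powr \<bar>p\<bar> / sqrt (2 * pi) * norm (Gamma (of_real t + \<beta>))"
      by (simp add: Gamma_ratio_def norm_divide)
    finally have le: "?h t \<le> 2 * 2 powr \<bar>p\<bar> / sqrt (2 * pi) * norm (Gamma (of_real t + \<beta>))" .
    have "norm (Gamma_ratio \<beta> t) > 0" using T(2)[OF t] by linarith
    hence G0: "Gamma (of_real t + \<beta>) \<noteq> 0" by (auto simp: Gamma_ratio_def)
    have inv: "inverse N \<le> c * inverse h" if "0 < h" "0 < N" "h \<le> c * N" for h c N :: real
      using that by (simp add: field_simps)
    have "inverse (norm (Gamma (of_real t + \<beta>))) \<le> 2 * 2 powr \<bar>p\<bar> / sqrt (2 * pi) * inverse (?h t)"
      by (rule inv[OF _ _ le]) (use hpos[of t] t0 G0 in auto)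
    thus "norm (rGamma (of_real t + \<beta>)) \<le> 2 * 2 powr \<bar>p\<bar> / sqrt (2 * pi) * inverse (?h t)"
      by (simp only: rGamma_inverse_Gamma norm_inverse)
  next
    show "continuous_on {0..T} (\<lambda>t. inverse (?h t))"
      using hpos by (intro continuous_on_inverse continuous_on_stirling_shape) fastforce
    show "inverse (?h t) > 0" if "t \<ge> 0" for t using hpos[OF that] by (rule positive_imp_inverse_positive)
  qed (use T K in auto)
  thus ?thesis unfolding p_def divide_inverse .
qed

section \<open>Laplace's method for sums\<close>

text \<open>This is sqrt pi / 2 times the error function, the antiderivative against which lattice
  sums of the Gaussian are compared.\<close>

definition gauss_int :: "real \<Rightarrow> real" where
  "gauss_int y = integral {0..y} (\<lambda>s. exp (- s\<^sup>2))"

lemma gauss_int_deriv: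
  assumes "x \<ge> 0"
  shows "(gauss_int has_real_derivative exp (- x\<^sup>2)) (at x within {0..})"
proof -
  have "((\<lambda>y. integral {0..y} (\<lambda>s::real. exp (- s\<^sup>2))) has_real_derivative exp (- x\<^sup>2)) (at x within {0..x + 1})"
    using assms by (intro integral_has_real_derivative continuous_intros) auto
  moreover have "at x within {0..x + 1} = at x within {0..}"
    by (rule at_within_nhd[of _ "{..<x + 1}"]) (use assms in auto)
  ultimately show ?thesis by (simp add: gauss_int_def[abs_def])
qed

lemma gauss_int_LIM: "(gauss_int \<longlongrightarrow> sqrt pi / 2) at_top"
proof -
  have int: "set_integrable lborel {0..} (\<lambda>x::real. exp (- x\<^sup>2))"
    and val: "(LINT x:{0..}|lborel. exp (- x\<^sup>2)) = sqrt pi / (2::real)"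
    using gaussian_moment_0 by (auto simp: set_integrable_def set_lebesgue_integral_def has_bochner_integral_iff)
  have "((\<lambda>b. LINT x:{0..b}|lborel. exp (- x\<^sup>2)) \<longlongrightarrow> sqrt pi / (2::real)) at_top"
    using tendsto_set_lebesgue_integral_at_top[OF _ int] val by simp
  moreover have "(LINT x:{0..b}|lborel. exp (- x\<^sup>2)) = gauss_int b" for b
    unfolding gauss_int_def
    by (rule set_borel_integral_eq_integral) (rule set_integrable_subset[OF int], auto)
  ultimately show ?thesis by simp
qed

lemma gauss_int_bounds:
  assumes "0 \<le> x" "x \<le> y"
  shows "gauss_int y - gauss_int x \<le> (y - x) * exp (- x\<^sup>2)"
    and "(y - x) * exp (- y\<^sup>2) \<le> gauss_int y - gauss_int x"
proof -
  have *: "gauss_int y - gauss_int x \<le> (y - x) * exp (- x\<^sup>2) \<and> (y - x) * exp (- y\<^sup>2) \<le> gauss_int y - gauss_int x"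
  proof (cases "x = y")
    case False
    with assms have xy: "x < y" by simp
    have d: "(gauss_int has_real_derivative exp (- z\<^sup>2)) (at z within {x..y})" if "z \<in> {x..y}" for z
      by (rule DERIV_subset[OF gauss_int_deriv]) (use that assms in auto)
    have "continuous_on {x..y} gauss_int" using d by (rule DERIV_continuous_on)
    moreover have "(gauss_int has_real_derivative exp (- z\<^sup>2)) (at z)" if "x < z" "z < y" for z
      using d[of z] that by (simp add: at_within_Icc_at)
    ultimately obtain l z where z: "x < z" "z < y" "(gauss_int has_real_derivative l) (at z)"
      "gauss_int y - gauss_int x = (y - x) * l"
      using MVT[OF xy] by (metis real_differentiable_def)
    have "l = exp (- z\<^sup>2)"
      using z(3) \<open>\<And>z. \<lbrakk>x < z; z < y\<rbrakk> \<Longrightarrow> (gauss_int has_real_derivative exp (- z\<^sup>2)) (at z)\<close>[OF z(1,2)]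
      by (rule DERIV_unique)
    moreover have "exp (- z\<^sup>2) \<le> exp (- x\<^sup>2)" using z(1,2) assms by (simp add: power_mono)
    moreover have "exp (- y\<^sup>2) \<le> exp (- z\<^sup>2)" using z(1,2) assms by (simp add: power_mono)
    ultimately show ?thesis using xy z(4) by (auto intro!: mult_left_mono)
  qed auto
  from * show "gauss_int y - gauss_int x \<le> (y - x) * exp (- x\<^sup>2)"
    and "(y - x) * exp (- y\<^sup>2) \<le> gauss_int y - gauss_int x" by auto
qed

lemma gauss_int_mono: "0 \<le> x \<Longrightarrow> x \<le> y \<Longrightarrow> gauss_int x \<le> gauss_int y"
  using gauss_int_bounds(2)[of x y] by (smt (verit) mult_nonneg_nonneg exp_ge_zero)

lemma gauss_int_nonneg: "0 \<le> x \<Longrightarrow> 0 \<le> gauss_int x"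
  using gauss_int_mono[of 0 x] by (simp add: gauss_int_def)

lemma gauss_int_le: "0 \<le> x \<Longrightarrow> gauss_int x \<le> sqrt pi / 2"
  by (rule tendsto_lowerbound[OF gauss_int_LIM])
     (auto intro!: eventually_mono[OF eventually_ge_at_top[of x]] gauss_int_mono)

text \<open>From 2 x^2 \<le> 1 + x^2 + x^4 / 2 \<le> exp (x^2) follows exp (-x^2) \<le> 1 / (2 x^2).
  Hence gauss_int y + 1 / (2 y) is nonincreasing, and its limit sqrt pi / 2 bounds it from
  below.\<close>

lemma gauss_int_ge:
  assumes "y > 0"
  shows "gauss_int y \<ge> sqrt pi / 2 - 1 / (2 * y)"
proof -
  define F where "F = (\<lambda>y. gauss_int y + 1 / (2 * y))"
  have dec: "F b \<le> F y" if b: "b \<ge> y" for b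
  proof (rule DERIV_nonpos_imp_nonincreasing[OF b])
    fix x assume x: "y \<le> x" "x \<le> b"
    have "1 + x\<^sup>2 + (x\<^sup>2)\<^sup>2 / 2 \<le> exp (x\<^sup>2)" by (rule exp_lower_Taylor_quadratic) simp
    moreover have "2 * x\<^sup>2 \<le> 1 + x\<^sup>2 + (x\<^sup>2)\<^sup>2 / 2"
      using zero_le_power2[of "x\<^sup>2 - 1"] by (simp add: power2_eq_square algebra_simps)
    ultimately have "2 * x\<^sup>2 \<le> exp (x\<^sup>2)" by simp
    hence le: "exp (- x\<^sup>2) - 1 / (2 * x\<^sup>2) \<le> 0"
      using x assms by (simp add: exp_minus field_simps)
    have "(gauss_int has_real_derivative exp (- x\<^sup>2)) (at x)"
      using gauss_int_deriv[of x] at_within_interior[of x "{0..}"] x assms by simp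
    moreover have "((\<lambda>y. 1 / (2 * y)) has_real_derivative (- 1 / (2 * x\<^sup>2))) (at x)"
      using x assms by (auto intro!: derivative_eq_intros simp: power2_eq_square field_simps)
    ultimately have "(F has_real_derivative (exp (- x\<^sup>2) + - 1 / (2 * x\<^sup>2))) (at x)"
      unfolding F_def by (rule DERIV_add)
    hence "(F has_real_derivative (exp (- x\<^sup>2) - 1 / (2 * x\<^sup>2))) (at x)" by simp
    with le show "\<exists>y. (F has_real_derivative y) (at x) \<and> y \<le> 0" by blast
  qed
  have "((\<lambda>y::real. 1 / (2 * y)) \<longlongrightarrow> 0) at_top" by real_asymp
  from tendsto_add[OF gauss_int_LIM this] have "(F \<longlongrightarrow> sqrt pi / 2) at_top" by (simp add: F_def)
  hence "sqrt pi / 2 \<le> F y"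
    by (rule tendsto_upperbound) (auto intro!: eventually_mono[OF eventually_ge_at_top[of y]] dec)
  thus ?thesis by (simp add: F_def)
qed

text \<open>Integral comparison for a decreasing function with step h. The first sample lies at h
  \<theta> with 0 \<le> \<theta> \<le> 1, so the missing piece of the integral costs at most h in
  the lower bound, and the first term at most h in the upper one; stopping at M costs the Gaussian
  tail beyond h Y.\<close>

lemma half_gauss_sum:
  fixes h \<theta> :: real
  assumes h: "h > 0" and \<theta>: "0 \<le> \<theta>" "\<theta> \<le> 1"
  shows "h * (\<Sum>j<M. exp (- (h * (real j + \<theta>))\<^sup>2)) \<le> sqrt pi / 2 + h"
    and "real M + \<theta> \<ge> Y \<Longrightarrow> Y > 0 \<Longrightarrow>
      h * (\<Sum>j<M. exp (- (h * (real j + \<theta>))\<^sup>2)) \<ge> sqrt pi / 2 - h - 1 / (2 * h * Y)"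
proof -
  let ?g = "\<lambda>j. exp (- (h * (real j + \<theta>))\<^sup>2)"
  have nonneg: "0 \<le> h * (real j + \<theta>)" for j using h \<theta> by simp
  have step: "h * (real (Suc j) + \<theta>) - h * (real j + \<theta>) = h" for j by (simp add: algebra_simps)
  have le: "h * (real j + \<theta>) \<le> h * (real (Suc j) + \<theta>)" for j using h by simp
  \<comment> \<open>Left-endpoint sums dominate the integral; the sums over \<open>Suc j\<close>
    further down are the right-endpoint sums below it.\<close>
  have up: "h * (\<Sum>j<M. ?g j) \<ge> gauss_int (h * (real M + \<theta>)) - gauss_int (h * \<theta>)" for M
  proof (induction M)
    case (Suc M)
    have "gauss_int (h * (real (Suc M) + \<theta>)) - gauss_int (h * (real M + \<theta>)) \<le> h * ?g M"
      using gauss_int_bounds(1)[OF nonneg le, of M] by (simp only: step)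
    thus ?case using Suc.IH by (simp add: distrib_left)
  qed simp
  have low: "h * (\<Sum>j<M. ?g (Suc j)) \<le> gauss_int (h * (real M + \<theta>)) - gauss_int (h * \<theta>)" for M
  proof (induction M)
    case (Suc M)
    have "h * ?g (Suc M) \<le> gauss_int (h * (real (Suc M) + \<theta>)) - gauss_int (h * (real M + \<theta>))"
      using gauss_int_bounds(2)[OF nonneg le, of M] by (simp only: step)
    thus ?case using Suc.IH by (simp add: distrib_left)
  qed simp
  show "h * (\<Sum>j<M. ?g j) \<le> sqrt pi / 2 + h"
  proof (cases M)
    case (Suc M')
    have "h * (\<Sum>j<M. ?g j) = h * ?g 0 + h * (\<Sum>j<M'. ?g (Suc j))"
      by (simp only: Suc sum.lessThan_Suc_shift distrib_left)
    also have "h * ?g 0 \<le> h * 1" using h by (intro mult_left_mono) auto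
    also have "h * (\<Sum>j<M'. ?g (Suc j)) \<le> sqrt pi / 2"
      using low[of M'] gauss_int_le[OF nonneg, of M'] gauss_int_nonneg[of "h * \<theta>"] h \<theta> by simp
    finally show ?thesis by simp
  qed (use h in simp)
  show "h * (\<Sum>j<M. ?g j) \<ge> sqrt pi / 2 - h - 1 / (2 * h * Y)" if Y: "real M + \<theta> \<ge> Y" "Y > 0"
  proof -
    have "sqrt pi / 2 - 1 / (2 * (h * Y)) \<le> gauss_int (h * Y)" using gauss_int_ge[of "h * Y"] Y h by simp
    also have "\<dots> \<le> gauss_int (h * (real M + \<theta>))" by (rule gauss_int_mono) (use Y h in auto)
    finally have 1: "sqrt pi / 2 - 1 / (2 * (h * Y)) \<le> gauss_int (h * (real M + \<theta>))" .
    have "gauss_int (h * \<theta>) \<le> (h * \<theta>) * exp (- 0\<^sup>2)"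
      using gauss_int_bounds(1)[of 0 "h * \<theta>"] h \<theta> by (simp add: gauss_int_def)
    also have "\<dots> \<le> h" using h \<theta> by (simp add: mult_left_le)
    finally show ?thesis using up[of M] 1 by (simp add: mult.assoc)
  qed
qed

text \<open>Split at the first integer N \<ge> t. The right half has offset \<theta> = N - t, the
  left half after reflection has offset 1 - \<theta>. With h = sqrt b each half, times h, is sqrt pi
  / 2 up to h and a tail. Since Y \<le> t the window contains no negative number, so the sum over
  \<open>nat\<close> runs through all integers in it.\<close>

lemma gauss_sum:
  fixes b t Y :: real
  assumes b: "b > 0" and Y: "0 < Y" "Y \<le> t"
  shows "finite {k::nat. \<bar>real k - t\<bar> \<le> Y}"
    and "\<bar>(\<Sum>k | \<bar>real k - t\<bar> \<le> Y. exp (- b * (real k - t)\<^sup>2)) - sqrt (pi / b)\<bar> \<le> 2 + 1 / (b * Y)"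
proof -
  define h where "h = sqrt b"
  have h: "h > 0" "h\<^sup>2 = b" using b by (auto simp: h_def)
  define N where "N = nat \<lceil>t\<rceil>"
  define A where "A = nat \<lceil>t - Y\<rceil>"
  define B where "B = nat (\<lfloor>t + Y\<rfloor> + 1)"
  have N: "real N \<ge> t" "real N < t + 1" unfolding N_def using Y by linarith+
  have A: "real A \<ge> t - Y" "real A < t - Y + 1" "A \<le> N"
    unfolding A_def N_def using Y by (linarith, linarith, intro nat_mono ceiling_mono, linarith)
  have B: "real B > t + Y" "real B \<le> t + Y + 1" unfolding B_def using Y by linarith+
  have NB: "N \<le> B" using N B Y by linarith
  have set: "{k::nat. \<bar>real k - t\<bar> \<le> Y} = {A..<B}"
    unfolding A_def B_def using Y by (auto simp: abs_le_iff) linarith+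
  thus "finite {k::nat. \<bar>real k - t\<bar> \<le> Y}" by simp
  let ?f = "\<lambda>k. exp (- b * (real k - t)\<^sup>2)"
  have f_eq: "exp (- b * s\<^sup>2) = exp (- (h * s)\<^sup>2)" for s by (simp add: power_mult_distrib h)
  define \<theta> where "\<theta> = real N - t"
  have \<theta>: "0 \<le> \<theta>" "\<theta> \<le> 1" using N by (auto simp: \<theta>_def)
  have S2: "(\<Sum>k\<in>{N..<B}. ?f k) = (\<Sum>j<B - N. exp (- (h * (real j + \<theta>))\<^sup>2))"
  proof (rule sum.reindex_bij_witness[of _ "\<lambda>j. j + N" "\<lambda>k. k - N"])
    fix k assume k: "k \<in> {N..<B}"
    hence "real (k - N) + \<theta> = real k - t" by (simp add: of_nat_diff \<theta>_def)
    thus "exp (- (h * (real (k - N) + \<theta>))\<^sup>2) = ?f k" by (simp only: f_eq)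
  qed auto
  have S1: "(\<Sum>k\<in>{A..<N}. ?f k) = (\<Sum>j<N - A. exp (- (h * (real j + (1 - \<theta>)))\<^sup>2))"
  proof (rule sum.reindex_bij_witness[of _ "\<lambda>j. N - 1 - j" "\<lambda>k. N - 1 - k"])
    fix k assume k: "k \<in> {A..<N}"
    hence "real (N - 1 - k) = real N - 1 - real k" by (simp add: of_nat_diff)
    hence "real (N - 1 - k) + (1 - \<theta>) = - (real k - t)" by (simp add: \<theta>_def)
    thus "exp (- (h * (real (N - 1 - k) + (1 - \<theta>)))\<^sup>2) = ?f k"
      by (simp only: f_eq mult_minus_right power2_minus)
  qed (use A in auto)
  have S: "h * (\<Sum>k\<in>{A..<B}. ?f k) = h * (\<Sum>k\<in>{A..<N}. ?f k) + h * (\<Sum>k\<in>{N..<B}. ?f k)"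
    by (simp only: sum.atLeastLessThan_concat[OF A(3) NB, symmetric] distrib_left)
  have r1: "real (B - N) + \<theta> \<ge> Y" "real (N - A) + (1 - \<theta>) \<ge> Y"
    using B NB A by (auto simp: \<theta>_def of_nat_diff)
  have \<theta>': "0 \<le> 1 - \<theta>" "1 - \<theta> \<le> 1" using \<theta> by auto
  have half: "1 / (2 * h * Y) = 1 / (h * Y) / 2" by simp
  have comb: "\<bar>p + q - sqrt pi\<bar> \<le> 2 * h + 1 / (h * Y)"
    if "p \<le> sqrt pi / 2 + h" "q \<le> sqrt pi / 2 + h" "p \<ge> sqrt pi / 2 - h - 1 / (2 * h * Y)"
      "q \<ge> sqrt pi / 2 - h - 1 / (2 * h * Y)" for p q
  proof -
    have "1 / (h * Y) > 0" using h(1) Y by simp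
    with that show ?thesis unfolding half by linarith
  qed
  have "\<bar>h * (\<Sum>k\<in>{A..<B}. ?f k) - sqrt pi\<bar> \<le> 2 * h + 1 / (h * Y)"
    unfolding S S1 S2
    by (rule comb[OF half_gauss_sum(1)[OF h(1) \<theta>'] half_gauss_sum(1)[OF h(1) \<theta>]
      half_gauss_sum(2)[OF h(1) \<theta>' r1(2) Y(1)] half_gauss_sum(2)[OF h(1) \<theta> r1(1) Y(1)]])
  hence "\<bar>h * (\<Sum>k\<in>{A..<B}. ?f k) - sqrt pi\<bar> / h \<le> (2 * h + 1 / (h * Y)) / h"
    using h by (intro divide_right_mono) auto
  also have "(2 * h + 1 / (h * Y)) / h = 2 + 1 / (b * Y)"
    using h(1) Y by (simp add: h(2)[symmetric] field_simps power2_eq_square)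
  also have "\<bar>h * (\<Sum>k\<in>{A..<B}. ?f k) - sqrt pi\<bar> / h = \<bar>(h * (\<Sum>k\<in>{A..<B}. ?f k) - sqrt pi) / h\<bar>"
    using h by simp
  also have "(h * (\<Sum>k\<in>{A..<B}. ?f k) - sqrt pi) / h = (\<Sum>k\<in>{A..<B}. ?f k) - sqrt (pi / b)"
    using h(1) by (simp add: diff_divide_distrib h_def real_sqrt_divide)
  finally show "\<bar>(\<Sum>k | \<bar>real k - t\<bar> \<le> Y. ?f k) - sqrt (pi / b)\<bar> \<le> 2 + 1 / (b * Y)"
    unfolding set .
qed

section \<open>Replacing a peak by its Gaussian\<close>

lemma abs_diff_exp_neg_le:
  fixes p q r :: real
  assumes "r \<le> p" "r \<le> q"
  shows "\<bar>exp (- p) - exp (- q)\<bar> \<le> \<bar>p - q\<bar> * exp (- r)"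
proof -
  have *: "exp (- p) - exp (- q) \<le> (q - p) * exp (- r)" if "p \<le> q" "r \<le> p" for p q
  proof -
    have "1 + (p - q) \<le> exp (p - q)" by (rule exp_ge_add_one_self)
    hence "exp (- p) * (1 - exp (p - q)) \<le> exp (- p) * (q - p)" by (intro mult_left_mono) (linarith, simp)
    also have "\<dots> \<le> exp (- r) * (q - p)" using that by (intro mult_right_mono) auto
    finally show ?thesis by (simp add: algebra_simps flip: exp_add)
  qed
  show ?thesis
  proof (cases "p \<le> q")
    case True
    with *[OF True assms(1)] show ?thesis by (simp add: abs_if)
  next
    case False
    with *[of q p] assms show ?thesis by (simp add: abs_if)
  qed
qed

text \<open>Both powers are at most 1 + s^4, and s^4 = (64 / a^2) x^2 for x = a s^2 / 8, where x^2
  exp (-x) \<le> 2.\<close>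

lemma power_times_gauss_bounded:
  fixes a s :: real
  assumes "a > 0" "s \<ge> 0"
  shows "s * exp (- (a / 8) * s\<^sup>2) \<le> 1 + 128 / a\<^sup>2" and "s ^ 3 * exp (- (a / 8) * s\<^sup>2) \<le> 1 + 128 / a\<^sup>2"
proof -
  define x where "x = a / 8 * s\<^sup>2"
  have x: "x \<ge> 0" using assms by (simp add: x_def)
  have s4: "s ^ 4 = 64 / a\<^sup>2 * x\<^sup>2" using assms by (simp add: x_def power2_eq_square field_simps power4_eq_xxxx)
  have "x\<^sup>2 \<le> 2 * exp x" using exp_lower_Taylor_quadratic[OF x] x by simp
  hence "x\<^sup>2 * exp (- x) \<le> 2" by (simp add: exp_minus field_simps)
  hence "64 / a\<^sup>2 * (x\<^sup>2 * exp (- x)) \<le> 64 / a\<^sup>2 * 2" by (intro mult_left_mono) auto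
  hence "s ^ 4 * exp (- x) \<le> 128 / a\<^sup>2" by (simp add: s4 mult_ac)
  moreover have "exp (- x) \<le> 1" using x by simp
  ultimately have le: "(1 + s ^ 4) * exp (- x) \<le> 1 + 128 / a\<^sup>2"
    by (simp only: distrib_right mult_1_left add_mono)
  have "s \<le> 1 + s ^ 4 \<and> s ^ 3 \<le> 1 + s ^ 4"
  proof (cases "s \<le> 1")
    case True
    have "s ^ 3 \<le> 1" "0 \<le> s ^ 4" using True assms by (simp_all add: power_le_one)
    with True show ?thesis by linarith
  next
    case False
    hence "s ^ 1 \<le> s ^ 4" "s ^ 3 \<le> s ^ 4" by (intro power_increasing; simp)+
    thus ?thesis by auto
  qed
  hence "s * exp (- x) \<le> (1 + s ^ 4) * exp (- x)" "s ^ 3 * exp (- x) \<le> (1 + s ^ 4) * exp (- x)"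
    by (intro mult_right_mono; simp)+
  moreover have "- (a / 8) * s\<^sup>2 = - x" by (simp add: x_def)
  ultimately show "s * exp (- (a / 8) * s\<^sup>2) \<le> 1 + 128 / a\<^sup>2" "s ^ 3 * exp (- (a / 8) * s\<^sup>2) \<le> 1 + 128 / a\<^sup>2"
    using le by (metis order.trans)+
qed

text \<open>In the variable s = sqrt n |h| the amplitude error is C s / sqrt n and the phase error
  is n C |h|^3 = C s^3 / sqrt n. The quadratic lower bound on the phase leaves a Gaussian of rate
  a/4; half of that rate absorbs the powers of s, the other half stays to make the errors
  summable.\<close>

lemma laplace_sum_term:
  fixes u0 u1 T0 :: complex and a C h \<phi>0 n :: real
  assumes a: "a > 0" and C: "C \<ge> 0" and n: "n \<ge> 1"
    and u: "norm (u1 - u0) \<le> C * \<bar>h\<bar>"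
    and \<phi>3: "\<bar>\<phi>0 - a / 2 * h\<^sup>2\<bar> \<le> C * \<bar>h\<bar> ^ 3" and \<phi>2: "\<phi>0 \<ge> a / 4 * h\<^sup>2"
    and T: "norm (T0 - u1 * of_real (exp (- n * \<phi>0))) \<le> C / n * exp (- n * \<phi>0)"
  shows "norm (T0 - u0 * of_real (exp (- (a / 2) * n * h\<^sup>2))) \<le>
    (C + (C + C * norm u0) * (1 + 128 / a\<^sup>2)) / sqrt n * exp (- (a / 8) * n * h\<^sup>2)"
proof -
  define B where "B = 1 + 128 / a\<^sup>2"
  define s where "s = sqrt n * \<bar>h\<bar>"
  define E where "E = exp (- (a / 8) * n * h\<^sup>2)"
  have B: "B \<ge> 1" by (simp add: B_def)
  have s: "s \<ge> 0" "s\<^sup>2 = n * h\<^sup>2" using n by (auto simp: s_def power_mult_distrib)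
  have sn: "sqrt n \<ge> 1" using n by simp
  have hs: "\<bar>h\<bar> = s / sqrt n" using sn by (simp add: s_def)
  have EE: "exp (- (a / 4) * n * h\<^sup>2) = E * exp (- (a / 8) * s\<^sup>2)"
    by (simp add: E_def s(2) exp_add[symmetric] algebra_simps)
  have r: "n * \<phi>0 \<ge> a / 4 * n * h\<^sup>2" using mult_left_mono[OF \<phi>2, of n] n by (simp add: mult_ac)
  hence e\<phi>: "exp (- n * \<phi>0) \<le> exp (- (a / 4) * n * h\<^sup>2)" by simp
  have e4: "exp (- (a / 4) * n * h\<^sup>2) \<le> E"
    unfolding E_def exp_le_cancel_iff using a n by (intro mult_right_mono) auto
  have t1: "C / n * exp (- n * \<phi>0) \<le> C / sqrt n * E"
  proof (intro mult_mono)
    have "sqrt n * 1 \<le> sqrt n * sqrt n" using sn by (intro mult_left_mono) auto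
    hence "sqrt n \<le> n" using n by simp
    thus "C / n \<le> C / sqrt n" using C sn by (intro divide_left_mono) auto
    show "exp (- n * \<phi>0) \<le> E" using e\<phi> e4 by (rule order.trans)
  qed (use C sn in auto)
  have hB: "\<bar>h\<bar> * exp (- (a / 4) * n * h\<^sup>2) \<le> B / sqrt n * E"
  proof -
    have "\<bar>h\<bar> * exp (- (a / 4) * n * h\<^sup>2) = (s * exp (- (a / 8) * s\<^sup>2)) * (E / sqrt n)"
      unfolding EE hs by simp
    also have "\<dots> \<le> B * (E / sqrt n)"
      using power_times_gauss_bounded(1)[OF a s(1)] sn by (intro mult_right_mono) (auto simp: B_def E_def)
    finally show ?thesis by simp
  qed
  have "norm ((u1 - u0) * of_real (exp (- n * \<phi>0))) = norm (u1 - u0) * exp (- n * \<phi>0)"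
    by (simp only: norm_mult norm_of_real abs_exp_cancel)
  also have "\<dots> \<le> (C * \<bar>h\<bar>) * exp (- (a / 4) * n * h\<^sup>2)"
    using C by (intro mult_mono u e\<phi>) auto
  also have "\<dots> \<le> C * (B / sqrt n * E)" using mult_left_mono[OF hB C] by (simp only: mult.assoc)
  finally have t2: "norm ((u1 - u0) * of_real (exp (- n * \<phi>0))) \<le> C * (B / sqrt n * E)" .
  have "\<bar>exp (- (n * \<phi>0)) - exp (- (a / 2 * n * h\<^sup>2))\<bar> \<le> \<bar>n * \<phi>0 - a / 2 * n * h\<^sup>2\<bar> * exp (- (a / 4 * n * h\<^sup>2))"
    by (rule abs_diff_exp_neg_le[OF r]) (use a n in \<open>auto intro!: mult_right_mono\<close>)
  also have "n * \<phi>0 - a / 2 * n * h\<^sup>2 = n * (\<phi>0 - a / 2 * h\<^sup>2)" by (simp add: algebra_simps)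
  also have "\<bar>\<dots>\<bar> = n * \<bar>\<phi>0 - a / 2 * h\<^sup>2\<bar>" using n by (simp add: abs_mult)
  also have "n * \<bar>\<phi>0 - a / 2 * h\<^sup>2\<bar> * exp (- (a / 4 * n * h\<^sup>2)) \<le> n * (C * \<bar>h\<bar> ^ 3) * exp (- (a / 4 * n * h\<^sup>2))"
    using n by (intro mult_right_mono mult_left_mono \<phi>3) auto
  also have "\<dots> = C * (s ^ 3 * exp (- (a / 8) * s\<^sup>2)) * (E / sqrt n)"
  proof -
    have "n * \<bar>h\<bar> ^ 3 = s ^ 3 / sqrt n"
      using n by (simp add: hs power_divide power3_eq_cube field_simps)
    moreover have "n * (C * \<bar>h\<bar> ^ 3) = C * (n * \<bar>h\<bar> ^ 3)" by simp
    ultimately have "n * (C * \<bar>h\<bar> ^ 3) = C * (s ^ 3 / sqrt n)" by (simp only:)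
    moreover have "exp (- (a / 4 * n * h\<^sup>2)) = E * exp (- (a / 8) * s\<^sup>2)" using EE by simp
    ultimately show ?thesis by simp
  qed
  also have "\<dots> \<le> C * B * (E / sqrt n)"
    using power_times_gauss_bounded(2)[OF a s(1)] sn C
    by (intro mult_right_mono mult_left_mono) (auto simp: B_def E_def)
  finally have "\<bar>exp (- (n * \<phi>0)) - exp (- (a / 2 * n * h\<^sup>2))\<bar> \<le> C * B * (E / sqrt n)" .
  from mult_left_mono[OF this, of "norm u0"]
  have t3: "norm (u0 * of_real (exp (- n * \<phi>0) - exp (- (a / 2) * n * h\<^sup>2))) \<le> norm u0 * (C * B * (E / sqrt n))"
    by (simp only: norm_mult norm_of_real) simp
  \<comment> \<open>Three replacements: the term by its approximation, the amplitude by its value at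
    the peak, and the phase by its quadratic part.\<close>
  have "T0 - u0 * of_real (exp (- (a / 2) * n * h\<^sup>2)) =
     (T0 - u1 * of_real (exp (- n * \<phi>0))) + (u1 - u0) * of_real (exp (- n * \<phi>0)) +
     u0 * of_real (exp (- n * \<phi>0) - exp (- (a / 2) * n * h\<^sup>2))"
    by (simp add: algebra_simps)
  also have "norm \<dots> \<le> norm (T0 - u1 * of_real (exp (- n * \<phi>0))) + norm ((u1 - u0) * of_real (exp (- n * \<phi>0)))
     + norm (u0 * of_real (exp (- n * \<phi>0) - exp (- (a / 2) * n * h\<^sup>2)))"
    by (meson norm_triangle_ineq order.trans add_right_mono)
  also have "\<dots> \<le> C / sqrt n * E + C * (B / sqrt n * E) + norm u0 * (C * B * (E / sqrt n))"
    by (intro add_mono t2 t3 order.trans[OF T t1])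
  also have "\<dots> = (C + (C + C * norm u0) * B) / sqrt n * E"
    by (simp add: distrib_left distrib_right add_divide_distrib mult_ac)
  finally show ?thesis by (simp only: B_def E_def)
qed

text \<open>Each term has an error O(n^(-1/2)) times a Gaussian of rate a/8. Such Gaussians sum to
  O(sqrt n), so the total error is O(1) against a main term of order sqrt n. The phase vanishes at
  the peak: T is meant to be already divided by its size there.\<close>

lemma laplace_sum:
  fixes u :: "real \<Rightarrow> complex" and \<phi> :: "real \<Rightarrow> real" and T :: "nat \<Rightarrow> nat \<Rightarrow> complex"
  assumes a: "a > 0" and \<epsilon>: "0 < \<epsilon>" "\<epsilon> \<le> x0" and C: "C \<ge> 0" and N: "N \<ge> 1"
    and u: "\<And>x. \<bar>x - x0\<bar> \<le> \<epsilon> \<Longrightarrow> norm (u x - u x0) \<le> C * \<bar>x - x0\<bar>"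
    and \<phi>3: "\<And>x. \<bar>x - x0\<bar> \<le> \<epsilon> \<Longrightarrow> \<bar>\<phi> x - a / 2 * (x - x0)\<^sup>2\<bar> \<le> C * \<bar>x - x0\<bar> ^ 3"
    and \<phi>2: "\<And>x. \<bar>x - x0\<bar> \<le> \<epsilon> \<Longrightarrow> \<phi> x \<ge> a / 4 * (x - x0)\<^sup>2"
    and T: "\<And>n k. n \<ge> N \<Longrightarrow> \<bar>real k / real n - x0\<bar> \<le> \<epsilon> \<Longrightarrow>
      norm (T n k - u (real k / real n) * of_real (exp (- real n * \<phi> (real k / real n))))
        \<le> C / real n * exp (- real n * \<phi> (real k / real n))"
  shows "\<exists>C'. \<forall>n\<ge>N. norm ((\<Sum>k | \<bar>real k / real n - x0\<bar> \<le> \<epsilon>. T n k) - of_real (sqrt (2 * pi * real n / a)) * u x0) \<le> C'"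
proof -
  define C2 where "C2 = C + (C + C * norm (u x0)) * (1 + 128 / a\<^sup>2)"
  have C2: "C2 \<ge> 0" using C by (simp add: C2_def)
  define C' where "C' = C2 * (sqrt (8 * pi / a) + 2 + 8 / (a * \<epsilon>)) + norm (u x0) * (2 + 2 / (a * \<epsilon>))"
  have "norm ((\<Sum>k | \<bar>real k / real n - x0\<bar> \<le> \<epsilon>. T n k) - of_real (sqrt (2 * pi * real n / a)) * u x0) \<le> C'"
    if n: "n \<ge> N" for n
  proof -
    have n1: "real n \<ge> 1" using n N by simp
    define A where "A = {k::nat. \<bar>real k / real n - x0\<bar> \<le> \<epsilon>}"
    have A_eq: "A = {k::nat. \<bar>real k - real n * x0\<bar> \<le> real n * \<epsilon>}"
    proof -
      have "real k / real n - x0 = (real k - real n * x0) / real n" for k using n1 by (simp add: field_simps)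
      thus ?thesis using n1 by (simp add: A_def abs_divide pos_divide_le_eq mult_ac)
    qed
    have sq: "real n * (real k / real n - x0)\<^sup>2 = (real k - real n * x0)\<^sup>2 / real n" for k
      using n1 by (simp add: field_simps power2_eq_square)
    have Y: "0 < real n * \<epsilon>" "real n * \<epsilon> \<le> real n * x0" using n1 \<epsilon> by auto
    let ?g = "\<lambda>b k. exp (- b * real n * (real k / real n - x0)\<^sup>2)"
    have gauss: "\<bar>(\<Sum>k\<in>A. ?g b k) - sqrt (pi * real n / b)\<bar> \<le> 2 + 1 / (b * \<epsilon>)" if b: "b > 0" for b
    proof -
      \<comment> \<open>On the scale of k the rate is b / n, the centre n x0 and the half width n
        \<epsilon>.\<close>
      have "b / real n > 0" using b n1 by simp
      from gauss_sum(2)[OF this Y]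
      have "\<bar>(\<Sum>k\<in>A. exp (- (b / real n) * (real k - real n * x0)\<^sup>2)) - sqrt (pi / (b / real n))\<bar>
         \<le> 2 + 1 / (b / real n * (real n * \<epsilon>))" by (simp only: A_eq)
      also have "1 / (b / real n * (real n * \<epsilon>)) = 1 / (b * \<epsilon>)" using n1 by simp
      also have "pi / (b / real n) = pi * real n / b" by simp
      finally have le: "\<bar>(\<Sum>k\<in>A. exp (- (b / real n) * (real k - real n * x0)\<^sup>2)) - sqrt (pi * real n / b)\<bar> \<le> 2 + 1 / (b * \<epsilon>)" .
      have "exp (- (b / real n) * (real k - real n * x0)\<^sup>2) = ?g b k" for k
        using sq[of k] by (simp only: mult.assoc) simp
      with le show ?thesis by (simp only:)
    qed
    have finA: "finite A" using gauss_sum(1)[OF _ Y, of 1] by (simp add: A_eq)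
    have "norm ((\<Sum>k\<in>A. T n k) - u x0 * of_real (\<Sum>k\<in>A. ?g (a / 2) k)) =
        norm (\<Sum>k\<in>A. T n k - u x0 * of_real (?g (a / 2) k))"
      by (simp add: sum_subtractf sum_distrib_left)
    also have "\<dots> \<le> (\<Sum>k\<in>A. C2 / sqrt (real n) * ?g (a / 8) k)"
    proof (rule sum_norm_le)
      fix k assume k: "k \<in> A"
      hence k': "\<bar>real k / real n - x0\<bar> \<le> \<epsilon>" by (simp add: A_def)
      show "norm (T n k - u x0 * of_real (?g (a / 2) k)) \<le> C2 / sqrt (real n) * ?g (a / 8) k"
        unfolding C2_def by (rule laplace_sum_term[OF a C n1 u[OF k'] \<phi>3[OF k'] \<phi>2[OF k'] T[OF n k']])
    qed
    also have "\<dots> = C2 / sqrt (real n) * (\<Sum>k\<in>A. ?g (a / 8) k)" by (simp add: sum_distrib_left)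
    also have "\<dots> \<le> C2 / sqrt (real n) * (sqrt (8 * pi / a) * sqrt (real n) + (2 + 8 / (a * \<epsilon>)) * sqrt (real n))"
    proof (rule mult_left_mono)
      have "sqrt (pi * real n / (a / 8)) = sqrt (8 * pi / a) * sqrt (real n)"
        by (simp add: real_sqrt_mult[symmetric] mult_ac)
      moreover have "1 * (2 + 8 / (a * \<epsilon>)) \<le> sqrt (real n) * (2 + 8 / (a * \<epsilon>))"
        by (rule mult_right_mono) (use n1 a \<epsilon> in auto)
      moreover have "(\<Sum>k\<in>A. ?g (a / 8) k) \<le> sqrt (pi * real n / (a / 8)) + (2 + 1 / (a / 8 * \<epsilon>))"
        using gauss[of "a / 8"] a by (simp only: abs_le_iff) linarith
      moreover have "1 / (a / 8 * \<epsilon>) = 8 / (a * \<epsilon>)" by simp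
      ultimately show "(\<Sum>k\<in>A. ?g (a / 8) k) \<le> sqrt (8 * pi / a) * sqrt (real n) + (2 + 8 / (a * \<epsilon>)) * sqrt (real n)"
        by (simp add: mult.commute)
    qed (use C2 in auto)
    also have "\<dots> = C2 * (sqrt (8 * pi / a) + 2 + 8 / (a * \<epsilon>))"
      using n1 by (simp add: field_simps)
    finally have e1: "norm ((\<Sum>k\<in>A. T n k) - u x0 * of_real (\<Sum>k\<in>A. ?g (a / 2) k)) \<le>
      C2 * (sqrt (8 * pi / a) + 2 + 8 / (a * \<epsilon>))" .
    have "norm (u x0 * of_real ((\<Sum>k\<in>A. ?g (a / 2) k) - sqrt (2 * pi * real n / a))) =
       norm (u x0) * \<bar>(\<Sum>k\<in>A. ?g (a / 2) k) - sqrt (2 * pi * real n / a)\<bar>"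
      by (simp only: norm_mult norm_of_real)
    also have "\<dots> \<le> norm (u x0) * (2 + 2 / (a * \<epsilon>))"
      using gauss[of "a / 2"] a by (intro mult_left_mono) (simp_all add: mult_ac)
    finally have e2: "norm (u x0 * of_real ((\<Sum>k\<in>A. ?g (a / 2) k) - sqrt (2 * pi * real n / a))) \<le>
       norm (u x0) * (2 + 2 / (a * \<epsilon>))" .
    have "(\<Sum>k\<in>A. T n k) - of_real (sqrt (2 * pi * real n / a)) * u x0 =
      ((\<Sum>k\<in>A. T n k) - u x0 * of_real (\<Sum>k\<in>A. ?g (a / 2) k)) +
      u x0 * of_real ((\<Sum>k\<in>A. ?g (a / 2) k) - sqrt (2 * pi * real n / a))"
      by (simp only: of_real_diff right_diff_distrib mult.commute) simp
    also have "norm \<dots> \<le> C'" unfolding C'_def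
      by (intro order.trans[OF norm_triangle_ineq] add_mono e1 e2)
    finally show ?thesis by (simp only: A_def)
  qed
  thus ?thesis by blast
qed

section \<open>Gamma products\<close>

text \<open>Positivity is given on the half-open segment without p. A negative value at p would
  force the affine function to vanish at some s in between.\<close>

lemma affine_endpoint_nonneg:
  fixes a b p q :: real
  assumes "\<And>s. 0 < s \<Longrightarrow> s \<le> 1 \<Longrightarrow> 0 < a * (p + s * (q - p)) + b"
  shows "0 \<le> a * p + b"
proof (rule ccontr)
  assume neg: "\<not> 0 \<le> a * p + b"
  define c where "c = a * p + b"
  define d where "d = a * q + b"
  have c: "c < 0" using neg by (simp add: c_def)
  have d: "d > 0" using assms[of 1] by (simp add: d_def)
  define s where "s = - c / (d - c)"
  have s: "0 < s" "s \<le> 1" using c d by (auto simp: s_def field_simps)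
  have "a * (p + s * (q - p)) + b = c + s * (d - c)" by (simp add: c_def d_def algebra_simps)
  also have "\<dots> = 0" using c d by (simp add: s_def)
  finally show False using assms[OF s] by simp
qed

text \<open>(n t)^(n t) e^(-n t) = (n/e)^(n t) (t^t)^n: the scale n separates from the shape t. For
  t = 0 both sides are 1.\<close>

lemma self_pow_mult_of_nat:
  assumes "t \<ge> 0" "n \<ge> 1"
  shows "self_pow (real n * t) * exp (- (real n * t)) = exp (real n * t * (ln (real n) - 1)) * self_pow t ^ n"
proof (cases "t = 0")
  case False
  with assms have "t > 0" "real n > 0" by auto
  hence "self_pow (real n * t) * exp (- (real n * t)) = exp (real n * t * (ln (real n) + ln t) - real n * t)"
    by (simp add: self_pow_eq_exp ln_mult exp_diff exp_minus field_simps)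
  also have "\<dots> = exp (real n * t * (ln (real n) - 1)) * exp (real n * (t * ln t))"
    by (simp add: algebra_simps flip: exp_add)
  also have "exp (real n * (t * ln t)) = self_pow t ^ n"
    using \<open>t > 0\<close> by (simp add: self_pow_eq_exp exp_of_nat_mult)
  finally show ?thesis .
qed (simp add: self_pow_def)

lemma stirling_mult_of_nat:
  assumes "t > 0" "n \<ge> 1"
  shows "stirling \<alpha> (real n * t) = of_real (exp (real n * t * (ln (real n) - 1)) * self_pow t ^ n) *
    (exp (of_real (ln (real n)) * (\<alpha> - 1 / 2)) * of_real t powr (\<alpha> - 1 / 2)) * of_real (exp (ln (2 * pi) / 2))"
proof -
  have n: "real n > 0" using assms by simp
  have p: "of_real t powr (\<alpha> - 1 / 2) = exp ((\<alpha> - 1 / 2) * of_real (ln t))"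
    using assms by (simp add: powr_def Ln_of_real)
  have "exp (real n * t * (ln (real n) - 1)) * self_pow t ^ n = exp (real n * t * (ln (real n) - 1) + real n * (t * ln t))"
    using assms by (simp add: self_pow_eq_exp exp_add exp_of_nat_mult)
  hence q: "(of_real (exp (real n * t * (ln (real n) - 1)) * self_pow t ^ n) :: complex) =
      exp (of_real (real n * t * (ln (real n) - 1) + real n * (t * ln t)))"
    by (simp only: exp_of_real)
  have "of_real (ln (real n * t)) * (of_real (real n * t) + \<alpha> - 1 / 2) - of_real (real n * t) + of_real (ln (2 * pi) / 2) =
     of_real (real n * t * (ln (real n) - 1) + real n * (t * ln t)) +
      (of_real (ln (real n)) * (\<alpha> - 1 / 2) + (\<alpha> - 1 / 2) * of_real (ln t)) + of_real (ln (2 * pi) / 2)"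
    using assms n by (simp add: ln_mult algebra_simps)
  thus ?thesis unfolding stirling_def p q by (simp only: exp_add exp_of_real)
qed

lemma prod_near_one:
  fixes f :: "'a \<Rightarrow> nat \<Rightarrow> nat \<Rightarrow> complex"
  assumes "finite I" "\<And>i. i \<in> I \<Longrightarrow> \<exists>C N. \<forall>n\<ge>N. \<forall>k\<in>A n. norm (f i n k - 1) \<le> C / real n"
  shows "\<exists>C N. \<forall>n\<ge>N. \<forall>k\<in>A n. norm ((\<Prod>i\<in>I. f i n k) - 1) \<le> C / real n"
  using assms
proof (induction I rule: finite_induct)
  case empty
  show ?case by (intro exI[of _ 0]) auto
next
  case (insert i I)
  from insert.IH insert.prems obtain C N where CN: "\<And>n k. n \<ge> N \<Longrightarrow> k \<in> A n \<Longrightarrow> norm ((\<Prod>i\<in>I. f i n k) - 1) \<le> C / real n"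
    by (metis insertCI)
  from insert.prems[of i] obtain C' N' where CN': "\<And>n k. n \<ge> N' \<Longrightarrow> k \<in> A n \<Longrightarrow> norm (f i n k - 1) \<le> C' / real n" by blast
  have "norm ((\<Prod>i\<in>insert i I. f i n k) - 1) \<le> (C' + C + \<bar>C' * C\<bar>) / real n"
    if n: "n \<ge> max (max N N') 1" and k: "k \<in> A n" for n k
  proof -
    define a where "a = f i n k - 1"
    define b where "b = (\<Prod>i\<in>I. f i n k) - 1"
    have n1: "real n \<ge> 1" using n by simp
    have ab: "norm a \<le> C' / real n" "norm b \<le> C / real n" using CN CN' n k by (auto simp: a_def b_def)
    have "(\<Prod>i\<in>insert i I. f i n k) = f i n k * (\<Prod>i\<in>I. f i n k)"
      by (rule prod.insert) (use insert.hyps in auto)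
    also have "\<dots> = (a + 1) * (b + 1)" by (simp only: a_def b_def diff_add_cancel)
    finally have "(\<Prod>i\<in>insert i I. f i n k) - 1 = a + b + a * b"
      by (simp add: algebra_simps)
    also have "norm \<dots> \<le> norm a + norm b + norm a * norm b"
      by (metis norm_mult norm_triangle_ineq add_right_mono order.trans)
    also have "norm a * norm b \<le> C' / real n * (C / real n)"
      using ab by (intro mult_mono) (auto intro: order.trans[OF norm_ge_zero])
    also have "\<dots> = (C' * C) / (real n * real n)" by simp
    also have "\<dots> \<le> \<bar>C' * C\<bar> / real n"
      using n1 by (intro frac_le) auto
    finally show ?thesis using ab by (simp add: add_divide_distrib)
  qed
  thus ?case by blast
qed

lemma inverse_near_one:
  fixes f :: "nat \<Rightarrow> nat \<Rightarrow> complex"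
  assumes "\<exists>C N. \<forall>n\<ge>N. \<forall>k\<in>A n. norm (f n k - 1) \<le> C / real n"
  shows "\<exists>C N. \<forall>n\<ge>N. \<forall>k\<in>A n. norm (inverse (f n k) - 1) \<le> C / real n"
proof -
  obtain C N where CN: "\<And>n k. n \<ge> N \<Longrightarrow> k \<in> A n \<Longrightarrow> norm (f n k - 1) \<le> C / real n" using assms by blast
  \<comment> \<open>Beyond M the distance of f to 1 is at most 1/2, which keeps f away from
    0.\<close>
  obtain M :: nat where M: "real M \<ge> 2 * \<bar>C\<bar> + 1" using real_arch_simple by blast
  have "norm (inverse (f n k) - 1) \<le> 2 * C / real n" if n: "n \<ge> max N M" and k: "k \<in> A n" for n k
  proof -
    have n1: "real n \<ge> 2 * \<bar>C\<bar> + 1" using n M by linarith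
    have le: "norm (f n k - 1) \<le> C / real n" using CN n k by simp
    also have "C / real n \<le> 1 / 2" using n1 by (simp add: field_simps)
    finally have half: "norm (f n k) \<ge> 1 / 2"
      using norm_triangle_ineq2[of 1 "f n k"] by (simp add: norm_minus_commute)
    hence nz: "f n k \<noteq> 0" by auto
    have "inverse (f n k) - 1 = - (f n k - 1) / f n k" using nz by (simp add: field_simps)
    hence "norm (inverse (f n k) - 1) = norm (f n k - 1) / norm (f n k)"
      by (simp only: norm_divide norm_minus_cancel)
    also have "\<dots> \<le> norm (f n k - 1) / (1 / 2)" using half by (intro divide_left_mono) auto
    also have "\<dots> \<le> 2 * C / real n" using le by simp
    finally show ?thesis .
  qed
  thus ?thesis by blast
qed

lemma prod_exp_scaled:
  fixes f :: "'a \<Rightarrow> real"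
  shows "finite A \<Longrightarrow> (\<Prod>i\<in>A. exp (s * f i * c)) = exp (s * c * sum f A)"
proof -
  assume A: "finite A"
  have "s * c * sum f A = (\<Sum>i\<in>A. s * f i * c)" by (simp add: sum_distrib_left mult_ac)
  thus ?thesis by (simp only: exp_sum[OF A])
qed

section \<open>The Gamma sum and its exact main terms\<close>

locale gamma_sum =
  fixes D :: "('i, 'j) gamma_sum_data"
  assumes r0_nonneg: "0 \<le> r0 D" and r0_less_r1: "ereal (r0 D) < r1 D"
    and finite_I: "finite (Iset D)" and finite_J: "finite (Jset D)"
    and sig_nonzero: "\<And>i. i \<in> Iset D \<Longrightarrow> sig D i \<noteq> 0" and tau_nonzero: "\<And>j. j \<in> Jset D \<Longrightarrow> tau D j \<noteq> 0"
    and z_pos: "zval D > 0"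
    and balanced: "(\<Sum>i\<in>Iset D. sig D i) = (\<Sum>j\<in>Jset D. tau D j)"
    and lform_pos: "\<And>x i. r0 D < x \<Longrightarrow> ereal x < r1 D \<Longrightarrow> i \<in> Iset D \<Longrightarrow> lform D i x > 0"
    and mform_pos: "\<And>x j. r0 D < x \<Longrightarrow> ereal x < r1 D \<Longrightarrow> j \<in> Jset D \<Longrightarrow> mform D j x > 0"
begin

text \<open>Only the finite points of the closed interval: the forms and \<open>Phi_real\<close>
  live on the reals, and \<infinity> is reached through limits.\<close>

definition X :: "real set" where "X = {x. r0 D \<le> x \<and> ereal x \<le> r1 D}"

definition summand :: "nat \<Rightarrow> nat \<Rightarrow> complex" where
  "summand n k = Gterm D k n * of_real (zval D ^ k)"

text \<open>Convexity: moving from x towards a fixed interior point q enters the open interval at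
  once. This carries the positivity hypothesis to the endpoints, as nonnegativity.\<close>

lemma X_between:
  assumes "x \<in> X"
  obtains q where "\<And>s. 0 < s \<Longrightarrow> s \<le> 1 \<Longrightarrow> r0 D < x + s * (q - x) \<and> ereal (x + s * (q - x)) < r1 D"
proof -
  obtain q where q: "r0 D < q" "ereal q < r1 D"
    using ereal_dense2[OF r0_less_r1] by auto
  have "r0 D < x + s * (q - x) \<and> ereal (x + s * (q - x)) < r1 D" if s: "0 < s" "s \<le> 1" for s
  proof -
    have eq: "x + s * (q - x) = (1 - s) * x + s * q" by (simp add: algebra_simps)
    have "(1 - s) * r0 D + s * r0 D < (1 - s) * x + s * q"
      using assms s q by (intro add_le_less_mono mult_left_mono) (auto simp: X_def)
    hence 1: "r0 D < x + s * (q - x)" by (simp add: eq algebra_simps)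
    have 2: "ereal (x + s * (q - x)) < r1 D"
    proof (cases "r1 D")
      case (real r)
      have "(1 - s) * x + s * q < (1 - s) * r + s * r"
        using assms s q real by (intro add_le_less_mono mult_left_mono) (auto simp: X_def)
      thus ?thesis by (simp add: eq real algebra_simps)
    qed (use r0_less_r1 in auto)
    from 1 2 show ?thesis ..
  qed
  with that show ?thesis by blast
qed

lemma lform_nonneg:
  assumes "x \<in> X" "i \<in> Iset D"
  shows "lform D i x \<ge> 0"
proof -
  obtain q where q: "\<And>s. 0 < s \<Longrightarrow> s \<le> 1 \<Longrightarrow> r0 D < x + s * (q - x) \<and> ereal (x + s * (q - x)) < r1 D"
    using X_between[OF assms(1)] by blast
  have "0 < lform D i (x + s * (q - x))" if "0 < s" "s \<le> 1" for s
    using q[OF that] lform_pos[OF _ _ assms(2)] by blast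
  thus ?thesis unfolding lform_def by (rule affine_endpoint_nonneg)
qed

lemma mform_nonneg:
  assumes "x \<in> X" "j \<in> Jset D"
  shows "mform D j x \<ge> 0"
proof -
  obtain q where q: "\<And>s. 0 < s \<Longrightarrow> s \<le> 1 \<Longrightarrow> r0 D < x + s * (q - x) \<and> ereal (x + s * (q - x)) < r1 D"
    using X_between[OF assms(1)] by blast
  have "0 < mform D j (x + s * (q - x))" if "0 < s" "s \<le> 1" for s
    using q[OF that] mform_pos[OF _ _ assms(2)] by blast
  thus ?thesis unfolding mform_def by (rule affine_endpoint_nonneg)
qed

text \<open>Balancedness cancels the dependence on x. The powers of n/e from the single Gamma
  factors therefore combine to (n/e)^(nu n), the same for every k.\<close>

lemma sum_forms: "(\<Sum>i\<in>Iset D. lform D i x) - (\<Sum>j\<in>Jset D. mform D j x) = nu D"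
  by (simp add: lform_def mform_def nu_def sum.distrib balanced flip: sum_distrib_right)

lemma prod_self_pow_pos:
  assumes "x \<in> X"
  shows "(\<Prod>i\<in>Iset D. self_pow (lform D i x)) > 0" "(\<Prod>j\<in>Jset D. self_pow (mform D j x)) > 0"
  using assms by (auto intro!: prod_pos self_pow_pos lform_nonneg mform_nonneg)

lemma Phi_real_pos: "x \<in> X \<Longrightarrow> Phi_real D x > 0"
  using prod_self_pow_pos z_pos by (simp add: Phi_real_def)

lemma prod_exp_forms:
  assumes "n \<ge> 1"
  shows "(\<Prod>i\<in>Iset D. exp (real n * lform D i x * (ln (real n) - 1))) /
     (\<Prod>j\<in>Jset D. exp (real n * mform D j x * (ln (real n) - 1))) = (real n / exp 1) powr (nu D * real n)"
proof -
  have *: "(\<Prod>i\<in>Iset D. exp (s * lform D i x * c)) / (\<Prod>j\<in>Jset D. exp (s * mform D j x * c)) =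
      exp (s * c * nu D)" for s c
    by (simp only: prod_exp_scaled[OF finite_I] prod_exp_scaled[OF finite_J] exp_diff[symmetric]
        right_diff_distrib[symmetric] sum_forms)
  have "exp (real n * (ln (real n) - 1) * nu D) = (real n / exp 1) powr (nu D * real n)"
    using assms by (simp add: powr_def ln_div mult_ac)
  thus ?thesis by (simp only: *)
qed

lemma Phi_real_power:
  assumes "n \<ge> 1" "x = real k / real n"
  shows "(\<Prod>i\<in>Iset D. self_pow (lform D i x) ^ n) / (\<Prod>j\<in>Jset D. self_pow (mform D j x) ^ n) * zval D ^ k =
    Phi_real D x ^ n"
proof -
  have "(zval D powr x) ^ n = zval D powr real k"
    using assms z_pos by (simp add: powr_power)
  also have "\<dots> = zval D ^ k" using z_pos by (simp add: powr_realpow)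
  finally show ?thesis
    by (simp add: Phi_real_def power_mult_distrib power_divide prod_power_distrib mult_ac)
qed

text \<open>After this the dependence on k sits in \<open>Phi_real D x ^ n\<close> alone, which has
  absorbed z^k as (z^x)^n.\<close>

lemma self_pow_forms:
  assumes n: "n \<ge> 1" and x: "x = real k / real n" "x \<in> X"
  shows "(\<Prod>i\<in>Iset D. self_pow (real n * lform D i x) * exp (- (real n * lform D i x))) /
     (\<Prod>j\<in>Jset D. self_pow (real n * mform D j x) * exp (- (real n * mform D j x))) * zval D ^ k =
     (real n / exp 1) powr (nu D * real n) * Phi_real D x ^ n"
proof -
  have A: "(\<Prod>i\<in>Iset D. self_pow (real n * lform D i x) * exp (- (real n * lform D i x))) =
     (\<Prod>i\<in>Iset D. exp (real n * lform D i x * (ln (real n) - 1))) * (\<Prod>i\<in>Iset D. self_pow (lform D i x) ^ n)"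
    unfolding prod.distrib[symmetric]
    by (rule prod.cong[OF refl]) (rule self_pow_mult_of_nat[OF lform_nonneg[OF x(2)] n])
  have B: "(\<Prod>j\<in>Jset D. self_pow (real n * mform D j x) * exp (- (real n * mform D j x))) =
     (\<Prod>j\<in>Jset D. exp (real n * mform D j x * (ln (real n) - 1))) * (\<Prod>j\<in>Jset D. self_pow (mform D j x) ^ n)"
    unfolding prod.distrib[symmetric]
    by (rule prod.cong[OF refl]) (rule self_pow_mult_of_nat[OF mform_nonneg[OF x(2)] n])
  have "a * b / (c * d) * z = a / c * (b / d * z)" for a b c d z :: real by simp
  thus ?thesis
    unfolding A B Phi_real_power[OF n x(1), symmetric] prod_exp_forms[OF n, of x, symmetric] .
qed

lemma Gterm_eq:
  assumes "n \<ge> 1"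
  shows "Gterm D k n = (\<Prod>i\<in>Iset D. Gamma (of_real (real n * lform D i (real k / real n)) + alp D i)) /
     (\<Prod>j\<in>Jset D. Gamma (of_real (real n * mform D j (real k / real n)) + bet D j))"
proof -
  have "real n * lform D i (real k / real n) = sig D i * real k + lam D i * real n" for i
    using assms by (simp add: lform_def field_simps)
  moreover have "real n * mform D j (real k / real n) = tau D j * real k + mu D j * real n" for j
    using assms by (simp add: mform_def field_simps)
  ultimately show ?thesis by (simp add: Gterm_def)
qed

text \<open>The powers of t + 1 that remain from \<open>norm_Gamma_le\<close> and
  \<open>norm_rGamma_le\<close> once the factors t^t e^(-t) are split off.\<close>

definition weight :: "nat \<Rightarrow> real \<Rightarrow> real" where
  "weight n x = (\<Prod>i\<in>Iset D. (real n * lform D i x + 1) powr (Re (alp D i) - 1 / 2)) /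
     (\<Prod>j\<in>Jset D. (real n * mform D j x + 1) powr (Re (bet D j) - 1 / 2))"

definition pole_prod :: "nat \<Rightarrow> real \<Rightarrow> real" where
  "pole_prod n x = (\<Prod>i\<in>Iset D. pole_dist (of_real (real n * lform D i x) + alp D i))"

text \<open>With the pole weight on the left the bound holds for every k with k/n in the closed
  interval, however close an argument is to a pole. The denominator is treated through the entire
  function 1/Gamma.\<close>

lemma norm_summand_le:
  obtains K where "K > 0"
    "\<And>n k. n \<ge> 1 \<Longrightarrow> real k / real n \<in> X \<Longrightarrow> norm (summand n k) * pole_prod n (real k / real n) \<le>
       K * weight n (real k / real n) * ((real n / exp 1) powr (nu D * real n) * Phi_real D (real k / real n) ^ n)"
proof -
  from norm_Gamma_le obtain Ka where Ka: "\<And>\<alpha>. Ka \<alpha> > 0" "\<And>\<alpha> t. t \<ge> 0 \<Longrightarrow>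
    norm (Gamma (of_real t + \<alpha>)) * pole_dist (of_real t + \<alpha>) \<le> Ka \<alpha> * ((t + 1) powr (Re \<alpha> - 1 / 2) * self_pow t * exp (- t))"
    by metis
  from norm_rGamma_le obtain Kb where Kb: "\<And>\<alpha>. Kb \<alpha> > 0" "\<And>\<alpha> t. t \<ge> 0 \<Longrightarrow>
    norm (rGamma (of_real t + \<alpha>)) \<le> Kb \<alpha> / ((t + 1) powr (Re \<alpha> - 1 / 2) * self_pow t * exp (- t))"
    by metis
  define K where "K = (\<Prod>i\<in>Iset D. Ka (alp D i)) * (\<Prod>j\<in>Jset D. Kb (bet D j))"
  have "K > 0" using Ka(1) Kb(1) by (auto simp: K_def intro!: mult_pos_pos prod_pos)
  moreover have "norm (summand n k) * pole_prod n x \<le>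
       K * weight n x * ((real n / exp 1) powr (nu D * real n) * Phi_real D x ^ n)"
    if n: "n \<ge> 1" and x: "x = real k / real n" "x \<in> X" for n k x
  proof -
    let ?t = "\<lambda>i. real n * lform D i x" and ?s = "\<lambda>j. real n * mform D j x"
    have t0: "?t i \<ge> 0" if "i \<in> Iset D" for i using that lform_nonneg x by simp
    have s0: "?s j \<ge> 0" if "j \<in> Jset D" for j using that mform_nonneg x by simp
    define G where "G = (\<lambda>i. Gamma (of_real (?t i) + alp D i))"
    define H where "H = (\<lambda>j. Gamma (of_real (?s j) + bet D j))"
    \<comment> \<open>At a pole of Gamma both sides are 0.\<close>
    have H: "norm (rGamma (of_real (?s j) + bet D j)) = 1 / norm (H j)" for j
      by (simp add: H_def rGamma_inverse_Gamma norm_inverse divide_inverse)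
    have Ka': "norm (G i) * pole_dist (of_real (?t i) + alp D i) \<le>
          Ka (alp D i) * ((?t i + 1) powr (Re (alp D i) - 1 / 2) * self_pow (?t i) * exp (- ?t i))" if "i \<in> Iset D" for i
      unfolding G_def by (rule Ka(2)[OF t0[OF that]])
    have P1: "(\<Prod>i\<in>Iset D. norm (G i) * pole_dist (of_real (?t i) + alp D i)) \<le>
        (\<Prod>i\<in>Iset D. Ka (alp D i) * ((?t i + 1) powr (Re (alp D i) - 1 / 2) * self_pow (?t i) * exp (- ?t i)))"
      by (rule prod_mono) (use Ka' in simp)
    have P2: "(\<Prod>j\<in>Jset D. norm (rGamma (of_real (?s j) + bet D j))) \<le>
        (\<Prod>j\<in>Jset D. Kb (bet D j) / ((?s j + 1) powr (Re (bet D j) - 1 / 2) * self_pow (?s j) * exp (- ?s j)))"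
      by (rule prod_mono) (use Kb(2)[OF s0] in simp)
    have P0: "0 \<le> (\<Prod>i\<in>Iset D. norm (G i) * pole_dist (of_real (?t i) + alp D i))" by (simp add: prod_nonneg)
    have "norm (summand n k) = (\<Prod>i\<in>Iset D. norm (G i)) / (\<Prod>j\<in>Jset D. norm (H j)) * zval D ^ k"
      unfolding summand_def Gterm_eq[OF n] x(1)[symmetric] G_def[symmetric] H_def[symmetric]
      using z_pos by (simp add: norm_mult norm_divide norm_power prod_norm)
    hence "norm (summand n k) * pole_prod n x =
       (\<Prod>i\<in>Iset D. norm (G i) * pole_dist (of_real (?t i) + alp D i)) * (\<Prod>j\<in>Jset D. norm (rGamma (of_real (?s j) + bet D j))) * zval D ^ k"
      unfolding pole_prod_def H by (simp add: prod.distrib prod_dividef)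
    also have "\<dots> \<le> (\<Prod>i\<in>Iset D. Ka (alp D i) * ((?t i + 1) powr (Re (alp D i) - 1 / 2) * self_pow (?t i) * exp (- ?t i))) *
       (\<Prod>j\<in>Jset D. Kb (bet D j) / ((?s j + 1) powr (Re (bet D j) - 1 / 2) * self_pow (?s j) * exp (- ?s j))) * zval D ^ k"
      by (intro mult_right_mono mult_mono P1 P2 order.trans[OF P0 P1]) (use z_pos in \<open>auto intro: prod_nonneg\<close>)
    also have "\<dots> = K * weight n x *
      ((\<Prod>i\<in>Iset D. self_pow (?t i) * exp (- ?t i)) / (\<Prod>j\<in>Jset D. self_pow (?s j) * exp (- ?s j)) * zval D ^ k)"
      by (simp add: K_def weight_def prod.distrib prod_dividef mult_ac)
    finally show ?thesis unfolding self_pow_forms[OF n x] .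
  qed
  ultimately show ?thesis using that by blast
qed

text \<open>An exact identity: with every Gamma replaced by its main term a summand is the product
  of these factors. All approximation is thereby confined to the ratios that appear in
  \<open>summand_eq\<close>.\<close>

lemma prod_stirling:
  assumes n: "n \<ge> 1" and x: "x = real k / real n"
    and l: "\<And>i. i \<in> Iset D \<Longrightarrow> lform D i x > 0" and m: "\<And>j. j \<in> Jset D \<Longrightarrow> mform D j x > 0"
  shows "(\<Prod>i\<in>Iset D. stirling (alp D i) (real n * lform D i x)) /
      (\<Prod>j\<in>Jset D. stirling (bet D j) (real n * mform D j x)) * of_real (zval D ^ k) =
    of_nat n powr gam D * of_real ((real n / exp 1) powr (nu D * real n)) * ufun D x * of_real (Phi_real D x ^ n)"
proof -
  let ?L = "of_real (ln (real n)) :: complex"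
  define E :: complex where "E = of_real (exp (ln (2 * pi) / 2))"
  have A: "(\<Prod>i\<in>Iset D. exp (?L * (alp D i - 1 / 2))) / (\<Prod>j\<in>Jset D. exp (?L * (bet D j - 1 / 2))) = of_nat n powr gam D"
  proof -
    have g: "(\<Sum>i\<in>Iset D. alp D i - 1 / 2) - (\<Sum>j\<in>Jset D. bet D j - 1 / 2) = gam D"
      by (simp add: gam_def sum_subtractf diff_divide_distrib)
    have "(\<Prod>i\<in>Iset D. exp (?L * (alp D i - 1 / 2))) / (\<Prod>j\<in>Jset D. exp (?L * (bet D j - 1 / 2))) =
       exp (?L * ((\<Sum>i\<in>Iset D. alp D i - 1 / 2) - (\<Sum>j\<in>Jset D. bet D j - 1 / 2)))"
      by (simp only: exp_sum[symmetric] finite_I finite_J exp_diff[symmetric] sum_distrib_left right_diff_distrib)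
    also have "\<dots> = exp (gam D * ?L)" by (simp only: g mult.commute)
    also have "\<dots> = of_nat n powr gam D" using n by (simp add: powr_def Ln_of_nat)
    finally show ?thesis .
  qed
  \<comment> \<open>The factors sqrt (2 pi) of the main terms, which make up the numerical constant
    in \<open>ufun\<close>.\<close>
  have B: "(\<Prod>i\<in>Iset D. E) / (\<Prod>j\<in>Jset D. E) = of_real ((2 * pi) powr ((real (card (Iset D)) - real (card (Jset D))) / 2))"
    by (simp add: E_def powr_def exp_of_nat_mult[symmetric] exp_diff[symmetric] field_simps flip: of_real_power of_real_divide)
  have "(\<Prod>i\<in>Iset D. stirling (alp D i) (real n * lform D i x)) /
      (\<Prod>j\<in>Jset D. stirling (bet D j) (real n * mform D j x)) * of_real (zval D ^ k) =
    of_real ((\<Prod>i\<in>Iset D. exp (real n * lform D i x * (ln (real n) - 1))) /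
     (\<Prod>j\<in>Jset D. exp (real n * mform D j x * (ln (real n) - 1)))) *
    of_real ((\<Prod>i\<in>Iset D. self_pow (lform D i x) ^ n) / (\<Prod>j\<in>Jset D. self_pow (mform D j x) ^ n) * zval D ^ k) *
    ((\<Prod>i\<in>Iset D. exp (?L * (alp D i - 1 / 2))) / (\<Prod>j\<in>Jset D. exp (?L * (bet D j - 1 / 2)))) *
    (((\<Prod>i\<in>Iset D. E) / (\<Prod>j\<in>Jset D. E)) * ((\<Prod>i\<in>Iset D. of_real (lform D i x) powr (alp D i - 1 / 2)) /
      (\<Prod>j\<in>Jset D. of_real (mform D j x) powr (bet D j - 1 / 2))))"
  proof -
    have I: "(\<Prod>i\<in>Iset D. stirling (alp D i) (real n * lform D i x)) =
      of_real ((\<Prod>i\<in>Iset D. exp (real n * lform D i x * (ln (real n) - 1))) * (\<Prod>i\<in>Iset D. self_pow (lform D i x) ^ n)) *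
      ((\<Prod>i\<in>Iset D. exp (?L * (alp D i - 1 / 2))) * (\<Prod>i\<in>Iset D. of_real (lform D i x) powr (alp D i - 1 / 2))) * (\<Prod>i\<in>Iset D. E)"
      unfolding prod.distrib[symmetric] of_real_prod E_def
      by (rule prod.cong[OF refl]) (rule stirling_mult_of_nat[OF l n])
    have J: "(\<Prod>j\<in>Jset D. stirling (bet D j) (real n * mform D j x)) =
      of_real ((\<Prod>j\<in>Jset D. exp (real n * mform D j x * (ln (real n) - 1))) * (\<Prod>j\<in>Jset D. self_pow (mform D j x) ^ n)) *
      ((\<Prod>j\<in>Jset D. exp (?L * (bet D j - 1 / 2))) * (\<Prod>j\<in>Jset D. of_real (mform D j x) powr (bet D j - 1 / 2))) * (\<Prod>j\<in>Jset D. E)"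
      unfolding prod.distrib[symmetric] of_real_prod E_def
      by (rule prod.cong[OF refl]) (rule stirling_mult_of_nat[OF m n])
    have "of_real (e * p) * (a * b) * E' / (of_real (f * q) * (c * d) * F) * of_real z =
        of_real (e / f) * of_real (p / q * z) * (a / c) * (E' / F * (b / d))"
      for e p f q z :: real and a b c d E' F :: complex by (simp add: mult_ac)
    thus ?thesis unfolding I J .
  qed
  thus ?thesis
    unfolding A B prod_exp_forms[OF n] Phi_real_power[OF n x]
    by (simp add: ufun_def mult_ac)
qed

lemma summand_eq:
  assumes n: "n \<ge> 1" and x: "x = real k / real n"
    and l: "\<And>i. i \<in> Iset D \<Longrightarrow> lform D i x > 0" and m: "\<And>j. j \<in> Jset D \<Longrightarrow> mform D j x > 0"
  shows "summand n k = (\<Prod>i\<in>Iset D. Gamma_ratio (alp D i) (real n * lform D i x)) *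
      (\<Prod>j\<in>Jset D. inverse (Gamma_ratio (bet D j) (real n * mform D j x))) *
      (of_nat n powr gam D * of_real ((real n / exp 1) powr (nu D * real n)) * ufun D x * of_real (Phi_real D x ^ n))"
proof -
  define G where "G = (\<lambda>i. Gamma (of_real (real n * lform D i x) + alp D i))"
  define H where "H = (\<lambda>j. Gamma (of_real (real n * mform D j x) + bet D j))"
  define S where "S = (\<lambda>i. stirling (alp D i) (real n * lform D i x))"
  define T where "T = (\<lambda>j. stirling (bet D j) (real n * mform D j x))"
  have ST: "(\<Prod>i\<in>Iset D. S i) \<noteq> 0" "(\<Prod>j\<in>Jset D. T j) \<noteq> 0"
    by (simp_all add: S_def T_def finite_I finite_J)
  have "summand n k = (\<Prod>i\<in>Iset D. G i) / (\<Prod>j\<in>Jset D. H j) * of_real (zval D ^ k)"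
    unfolding summand_def Gterm_eq[OF n] x[symmetric] G_def H_def ..
  also have "\<dots> = (\<Prod>i\<in>Iset D. G i / S i) * (\<Prod>j\<in>Jset D. T j / H j) *
      ((\<Prod>i\<in>Iset D. S i) / (\<Prod>j\<in>Jset D. T j) * of_real (zval D ^ k))"
    using ST by (simp add: prod_dividef)
  also have "(\<lambda>j. T j / H j) = (\<lambda>j. inverse (Gamma_ratio (bet D j) (real n * mform D j x)))"
    by (simp add: Gamma_ratio_def T_def H_def)
  also have "(\<lambda>i. G i / S i) = (\<lambda>i. Gamma_ratio (alp D i) (real n * lform D i x))"
    by (simp add: Gamma_ratio_def G_def S_def)
  finally show ?thesis using prod_stirling[OF n x l m] by (simp only: S_def T_def)
qed

end

section \<open>Convergence of the series\<close>

lemma summable_power_times_powr_iff: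
  fixes r p :: real
  assumes r: "r > 0"
  shows "summable (\<lambda>k. r ^ k * real k powr p) \<longleftrightarrow> r < 1 \<or> r = 1 \<and> p < -1"
proof -
  consider "r < 1" | "r = 1" | "r > 1" by linarith
  thus ?thesis
  proof cases
    case 1
    have "(\<lambda>k::nat. r ^ k * real k powr p) \<in> O(\<lambda>k. real k powr (-2))"
      using r 1 by real_asymp
    moreover have "summable (\<lambda>k. norm (real k powr (-2)))"
      using summable_real_powr_iff[of "-2"] by simp
    ultimately have "summable (\<lambda>k. r ^ k * real k powr p)" by (rule summable_comparison_test_bigo[rotated])
    with 1 show ?thesis by simp
  next
    case 2
    thus ?thesis by (simp add: summable_real_powr_iff)
  next
    case 3
    have "\<not> summable (\<lambda>k. r ^ k * real k powr p)"
    proof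
      assume "summable (\<lambda>k. r ^ k * real k powr p)"
      hence "(\<lambda>k. r ^ k * real k powr p) \<longlonglongrightarrow> 0" by (rule summable_LIMSEQ_zero)
      moreover have "filterlim (\<lambda>k::nat. r ^ k * real k powr p) at_top at_top" using 3 by real_asymp
      hence "filterlim (\<lambda>k::nat. r ^ k * real k powr p) at_infinity at_top"
        by (rule filterlim_at_top_imp_at_infinity)
      ultimately show False using not_tendsto_and_filterlim_at_infinity[of sequentially] by simp
    qed
    with 3 show ?thesis by simp
  qed
qed

lemma summable_iff_limit_ratio:
  fixes f g :: "nat \<Rightarrow> real"
  assumes "(\<lambda>k. f k / g k) \<longlonglongrightarrow> c" "c > 0" "eventually (\<lambda>k. g k > 0) sequentially"
    "\<And>k. f k \<ge> 0" "\<And>k. g k \<ge> 0"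
  shows "summable f \<longleftrightarrow> summable g"
proof -
  have g0: "eventually (\<lambda>k. g k \<noteq> 0) sequentially" using assms(3) by eventually_elim simp
  have "eventually (\<lambda>k. f k / g k > 0) sequentially" using order_tendstoD(1)[OF assms(1,2)] .
  hence f0: "eventually (\<lambda>k. f k \<noteq> 0) sequentially" by eventually_elim auto
  have "(\<lambda>k. inverse (f k / g k)) \<longlonglongrightarrow> inverse c" using assms(1,2) by (intro tendsto_intros) auto
  hence "(\<lambda>k. g k / f k) \<longlonglongrightarrow> inverse c" by simp
  from bigoI_tendsto[OF this f0] bigoI_tendsto[OF assms(1) g0]
  have "g \<in> O(f)" "f \<in> O(g)" .
  thus ?thesis
    using summable_comparison_test_bigo[of f g] summable_comparison_test_bigo[of g f] assms(4,5) by auto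
qed

text \<open>(s x + l) ln (s x + l) is expanded by means of x ln (1 + c/x) -> c with c = l/s; what
  the comparison function leaves over tends to l ln s + l.\<close>

lemma self_pow_affine_asymp:
  fixes s l :: real
  assumes "s > 0"
  shows "((\<lambda>x. self_pow (s * x + l) / exp (s * x * ln x + l * ln x + s * x * ln s)) \<longlongrightarrow> exp (l * ln s + l)) at_top"
proof -
  have lim1: "((\<lambda>x::real. x * ln (1 + c / x)) \<longlongrightarrow> c) at_top" for c
  proof -
    consider "c = 0" | "c > 0" | "c < 0" by linarith
    thus ?thesis by cases (simp, real_asymp+)
  qed
  have "((\<lambda>x. l / x) \<longlongrightarrow> 0) at_top" by real_asymp
  hence "((\<lambda>x. ln (s + l / x)) \<longlongrightarrow> ln (s + 0)) at_top"
    using assms \<open>((\<lambda>x. l / x) \<longlongrightarrow> 0) at_top\<close> by (intro tendsto_ln tendsto_add tendsto_const) auto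
  hence lim2: "((\<lambda>x. s * (x * ln (1 + (l / s) / x)) + l * ln (s + l / x)) \<longlongrightarrow> s * (l / s) + l * ln (s + 0)) at_top"
    by (intro tendsto_add tendsto_mult tendsto_const lim1)
  have eq: "s * (l / s) + l * ln (s + 0) = l * ln s + l" using assms by simp
  have "eventually (\<lambda>x. s * x + l > 0) at_top" using assms by real_asymp
  hence ev: "eventually (\<lambda>x. s * (x * ln (1 + (l / s) / x)) + l * ln (s + l / x) =
      (s * x + l) * ln (s * x + l) - (s * x * ln x + l * ln x + s * x * ln s)) at_top"
    using eventually_gt_at_top[of 0]
  proof eventually_elim
    case (elim x)
    have "1 + (l / s) / x = (s * x + l) / (s * x)" "s + l / x = (s * x + l) / x"
      using elim assms by (simp_all add: field_simps)
    thus ?case using elim assms by (simp only: ln_div ln_mult mult_pos_pos) (simp add: ln_mult algebra_simps)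
  qed
  have "((\<lambda>x. (s * x + l) * ln (s * x + l) - (s * x * ln x + l * ln x + s * x * ln s)) \<longlongrightarrow> l * ln s + l) at_top"
    using Lim_transform_eventually[OF lim2 ev] unfolding eq .
  hence "((\<lambda>x. exp ((s * x + l) * ln (s * x + l) - (s * x * ln x + l * ln x + s * x * ln s))) \<longlongrightarrow> exp (l * ln s + l)) at_top"
    by (rule tendsto_exp)
  moreover have "eventually (\<lambda>x. s * x + l > 0) at_top" using assms by real_asymp
  hence "eventually (\<lambda>x. exp ((s * x + l) * ln (s * x + l) - (s * x * ln x + l * ln x + s * x * ln s)) =
      self_pow (s * x + l) / exp (s * x * ln x + l * ln x + s * x * ln s)) at_top"
    by eventually_elim (simp add: self_pow_eq_exp exp_diff)
  ultimately show ?thesis by (rule Lim_transform_eventually)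
qed

text \<open>Stirling's formula at t = s k, with every constant shift of the argument put into a. The
  exponential has the shape of a summand in \<open>sum_entropy\<close> with d = 1.\<close>

lemma norm_Gamma_affine_asymp:
  fixes s :: real and a :: complex
  assumes "s > 0"
  shows "(\<lambda>k. norm (Gamma (of_real (s * real k) + a)) /
     exp (s * real k * ln (real k) + (Re a - 1 / 2) * ln (real k) + s * real k * ln s - s * real k)) \<longlonglongrightarrow>
     sqrt (2 * pi) * s powr (Re a - 1 / 2)"
proof -
  obtain C T where CT: "C > 0" "T > 0" "\<And>t. t \<ge> T \<Longrightarrow> norm (Gamma_ratio a t - 1) \<le> C / t"
    using Gamma_ratio_asymp[of a] by blast
  have "((\<lambda>t. Gamma_ratio a t - 1) \<longlongrightarrow> 0) at_top"
  proof (rule Lim_null_comparison)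
    show "eventually (\<lambda>t. norm (Gamma_ratio a t - 1) \<le> C / t) at_top"
      using eventually_ge_at_top[of T] by eventually_elim (rule CT(3))
    show "((\<lambda>t. C / t) \<longlongrightarrow> 0) at_top" by real_asymp
  qed
  hence "(Gamma_ratio a \<longlongrightarrow> 1) at_top" by (simp add: LIM_zero_iff)
  moreover have "filterlim (\<lambda>k. s * real k) at_top sequentially" using assms by real_asymp
  ultimately have "(\<lambda>k. Gamma_ratio a (s * real k)) \<longlonglongrightarrow> 1" by (rule filterlim_compose)
  hence "(\<lambda>k. norm (Gamma_ratio a (s * real k)) * (sqrt (2 * pi) * s powr (Re a - 1 / 2))) \<longlonglongrightarrow>
     norm (1::complex) * (sqrt (2 * pi) * s powr (Re a - 1 / 2))"
    by (intro tendsto_intros)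
  moreover have "eventually (\<lambda>k. norm (Gamma_ratio a (s * real k)) * (sqrt (2 * pi) * s powr (Re a - 1 / 2)) =
     norm (Gamma (of_real (s * real k) + a)) /
     exp (s * real k * ln (real k) + (Re a - 1 / 2) * ln (real k) + s * real k * ln s - s * real k)) sequentially"
    using eventually_gt_at_top[of 0]
  proof eventually_elim
    case (elim k)
    have k: "real k > 0" "s * real k > 0" using elim assms by auto
    have sq: "sqrt (2 * pi) = exp (ln (2 * pi) / 2)" by (simp add: ln_sqrt[symmetric])
    have "norm (stirling a (s * real k)) = exp (ln (s * real k) * (s * real k + Re a - 1 / 2) - s * real k + ln (2 * pi) / 2)"
      by (simp add: stirling_def)
    also have "ln (s * real k) * (s * real k + Re a - 1 / 2) - s * real k + ln (2 * pi) / 2 = ln (2 * pi) / 2 + (Re a - 1 / 2) * ln s +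
      (s * real k * ln (real k) + (Re a - 1 / 2) * ln (real k) + s * real k * ln s - s * real k)"
      using k assms by (simp add: ln_mult algebra_simps)
    also have "exp \<dots> = sqrt (2 * pi) * s powr (Re a - 1 / 2) *
      exp (s * real k * ln (real k) + (Re a - 1 / 2) * ln (real k) + s * real k * ln s - s * real k)"
      using assms unfolding sq by (simp only: exp_add) (simp add: powr_def)
    finally have st: "norm (stirling a (s * real k)) = sqrt (2 * pi) * s powr (Re a - 1 / 2) *
      exp (s * real k * ln (real k) + (Re a - 1 / 2) * ln (real k) + s * real k * ln s - s * real k)" .
    have "norm (Gamma_ratio a (s * real k)) * norm (stirling a (s * real k)) = norm (Gamma (of_real (s * real k) + a))"
      by (simp add: Gamma_ratio_def norm_divide)
    thus ?case unfolding st by (metis exp_not_eq_zero nonzero_eq_divide_eq mult.assoc)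
  qed
  ultimately show ?thesis by (simp add: tendsto_cong)
qed

text \<open>Here y stands for ln x. The parameter d is 0 for the factors t^t of
  \<open>Phi_real\<close> and 1 for the Gamma factors, which carry an extra e^(-t). Either way x ln
  x - d x is multiplied by the sum of the slopes, so that balancedness cancels it between numerator
  and denominator.\<close>

lemma sum_entropy:
  fixes s q :: "'a \<Rightarrow> real"
  shows "(\<Sum>i\<in>I. s i * x * y + q i * y + s i * x * ln (s i) - d * s i * x) =
     (x * y - d * x) * sum s I + sum q I * y + x * (\<Sum>i\<in>I. s i * ln (s i))"
proof -
  have "(\<Sum>i\<in>I. s i * x * y + q i * y + s i * x * ln (s i) - d * s i * x) =
      (\<Sum>i\<in>I. (x * y - d * x) * s i + q i * y + x * (s i * ln (s i)))"
    by (rule sum.cong) (simp_all add: algebra_simps)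
  thus ?thesis by (simp only: sum.distrib sum_distrib_left sum_distrib_right)
qed

section \<open>Growth of Phi in x and of a summand in k\<close>

context gamma_sum
begin

text \<open>On an unbounded interval a form of negative slope would be at most 0 from its zero
  on.\<close>

lemma sig_pos: "r1 D = \<infinity> \<Longrightarrow> i \<in> Iset D \<Longrightarrow> sig D i > 0"
proof (rule ccontr)
  assume inf: "r1 D = \<infinity>" and i: "i \<in> Iset D" and "\<not> sig D i > 0"
  hence neg: "sig D i < 0" using sig_nonzero[OF i] by simp
  define x where "x = max (r0 D + 1) (lam D i / (- sig D i))"
  have "r0 D < x" by (simp add: x_def)
  hence "lform D i x > 0" by (rule lform_pos) (simp_all add: inf i)
  moreover have "x \<ge> lam D i / (- sig D i)" by (simp add: x_def)
  hence "lam D i \<le> x * (- sig D i)" using neg by (simp only: pos_divide_le_eq neg_0_less_iff_less)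
  ultimately show False by (simp add: lform_def mult.commute)
qed

lemma tau_pos: "r1 D = \<infinity> \<Longrightarrow> j \<in> Jset D \<Longrightarrow> tau D j > 0"
proof (rule ccontr)
  assume inf: "r1 D = \<infinity>" and j: "j \<in> Jset D" and "\<not> tau D j > 0"
  hence neg: "tau D j < 0" using tau_nonzero[OF j] by simp
  define x where "x = max (r0 D + 1) (mu D j / (- tau D j))"
  have "r0 D < x" by (simp add: x_def)
  hence "mform D j x > 0" by (rule mform_pos) (simp_all add: inf j)
  moreover have "x \<ge> mu D j / (- tau D j)" by (simp add: x_def)
  hence "mu D j \<le> x * (- tau D j)" using neg by (simp only: pos_divide_le_eq neg_0_less_iff_less)
  ultimately show False by (simp add: mform_def mult.commute)
qed

lemma rho_pos: "rho D > 0"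
proof -
  have "0 < \<bar>s\<bar> powr s" if "s \<noteq> 0" for s :: real using that by simp
  thus ?thesis unfolding rho_def
    by (intro mult_pos_pos divide_pos_pos prod_pos z_pos) (use sig_nonzero tau_nonzero in blast)+
qed

text \<open>The common part x ln x - d x cancels by balancedness, while ln z and the terms s ln s
  assemble to ln rho; only powers of x remain beside rho^x.\<close>

lemma prod_exp_asymp:
  fixes qI :: "'i \<Rightarrow> real" and qJ :: "'j \<Rightarrow> real"
  assumes inf: "r1 D = \<infinity>" and x: "x > 0"
  shows "(\<Prod>i\<in>Iset D. exp (sig D i * x * ln x + qI i * ln x + sig D i * x * ln (sig D i) - d * sig D i * x)) /
    (\<Prod>j\<in>Jset D. exp (tau D j * x * ln x + qJ j * ln x + tau D j * x * ln (tau D j) - d * tau D j * x)) * zval D powr x =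
    rho D powr x * x powr (sum qI (Iset D) - sum qJ (Jset D))"
proof -
  have "ln (rho D) = ln (zval D) + (\<Sum>i\<in>Iset D. sig D i * ln (sig D i)) - (\<Sum>j\<in>Jset D. tau D j * ln (tau D j))"
  proof -
    have pw: "\<bar>s\<bar> powr s = exp (s * ln s)" if "s > 0" for s :: real using that by (simp add: powr_def)
    have "(\<Prod>i\<in>Iset D. \<bar>sig D i\<bar> powr sig D i) = exp (\<Sum>i\<in>Iset D. sig D i * ln (sig D i))"
      unfolding exp_sum[OF finite_I] by (rule prod.cong[OF refl]) (rule pw[OF sig_pos[OF inf]])
    moreover have "(\<Prod>j\<in>Jset D. \<bar>tau D j\<bar> powr tau D j) = exp (\<Sum>j\<in>Jset D. tau D j * ln (tau D j))"
      unfolding exp_sum[OF finite_J] by (rule prod.cong[OF refl]) (rule pw[OF tau_pos[OF inf]])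
    ultimately have "rho D = exp (ln (zval D) + ((\<Sum>i\<in>Iset D. sig D i * ln (sig D i)) - (\<Sum>j\<in>Jset D. tau D j * ln (tau D j))))"
      using z_pos by (simp only: rho_def exp_add exp_diff exp_ln)
    thus ?thesis by simp
  qed
  hence R: "rho D powr x * x powr (sum qI (Iset D) - sum qJ (Jset D)) =
     exp (x * (ln (zval D) + (\<Sum>i\<in>Iset D. sig D i * ln (sig D i)) - (\<Sum>j\<in>Jset D. tau D j * ln (tau D j))) +
       (sum qI (Iset D) - sum qJ (Jset D)) * ln x)"
    using rho_pos x by (simp add: powr_def exp_add)
  have I: "(\<Sum>i\<in>Iset D. sig D i * x * ln x + qI i * ln x + sig D i * x * ln (sig D i) - d * sig D i * x) =
     (x * ln x - d * x) * sum (sig D) (Iset D) + sum qI (Iset D) * ln x + x * (\<Sum>i\<in>Iset D. sig D i * ln (sig D i))"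
    by (rule sum_entropy)
  have J: "(\<Sum>j\<in>Jset D. tau D j * x * ln x + qJ j * ln x + tau D j * x * ln (tau D j) - d * tau D j * x) =
     (x * ln x - d * x) * sum (sig D) (Iset D) + sum qJ (Jset D) * ln x + x * (\<Sum>j\<in>Jset D. tau D j * ln (tau D j))"
    unfolding balanced by (rule sum_entropy)
  have Z: "zval D powr x = exp (x * ln (zval D))" using z_pos by (simp add: powr_def)
  show ?thesis
    unfolding exp_sum[OF finite_I, symmetric] exp_sum[OF finite_J, symmetric] I J R Z exp_diff[symmetric] exp_add[symmetric]
    by (simp add: algebra_simps)
qed

lemma Phi_real_asymp:
  assumes inf: "r1 D = \<infinity>"
  obtains L where "L > 0" "((\<lambda>x. Phi_real D x / (rho D powr x * x powr nu D)) \<longlongrightarrow> L) at_top"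
proof -
  define a where "a = (\<lambda>i x. exp (sig D i * x * ln x + lam D i * ln x + sig D i * x * ln (sig D i)))"
  define b where "b = (\<lambda>j x. exp (tau D j * x * ln x + mu D j * ln x + tau D j * x * ln (tau D j)))"
  define L where "L = (\<Prod>i\<in>Iset D. exp (lam D i * ln (sig D i) + lam D i)) / (\<Prod>j\<in>Jset D. exp (mu D j * ln (tau D j) + mu D j))"
  have "L > 0" unfolding L_def by (intro divide_pos_pos prod_pos) auto
  have lim: "((\<lambda>x. (\<Prod>i\<in>Iset D. self_pow (lform D i x) / a i x) / (\<Prod>j\<in>Jset D. self_pow (mform D j x) / b j x)) \<longlongrightarrow> L) at_top"
    unfolding L_def a_def b_def lform_def mform_def
    by (intro tendsto_divide tendsto_prod self_pow_affine_asymp sig_pos[OF inf] tau_pos[OF inf])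
       (auto simp: finite_J)
  have ev: "eventually (\<lambda>x. (\<Prod>i\<in>Iset D. self_pow (lform D i x) / a i x) / (\<Prod>j\<in>Jset D. self_pow (mform D j x) / b j x) =
     Phi_real D x / (rho D powr x * x powr nu D)) at_top"
    using eventually_gt_at_top[of 0]
  proof eventually_elim
    case (elim x)
    have r: "(\<Prod>i\<in>Iset D. a i x) / (\<Prod>j\<in>Jset D. b j x) * zval D powr x = rho D powr x * x powr nu D"
      using prod_exp_asymp[OF inf elim, of "lam D" 0 "mu D"] by (simp add: a_def b_def nu_def)
    have z: "zval D powr x > 0" "(\<Prod>i\<in>Iset D. a i x) > 0" "(\<Prod>j\<in>Jset D. b j x) > 0"
      using z_pos by (auto simp: a_def b_def intro!: prod_pos)
    show ?case unfolding Phi_real_def r[symmetric] using z by (simp add: prod_dividef)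
  qed
  show ?thesis by (rule that[OF \<open>L > 0\<close> Lim_transform_eventually[OF lim ev]])
qed

text \<open>For fixed n and growing k the term \<lambda>_i n counts as part of the parameter
  \<alpha>_i. This is how nu n gets into the exponent of k.\<close>

lemma norm_summand_asymp:
  assumes inf: "r1 D = \<infinity>"
  obtains c where "c > 0" "(\<lambda>k. norm (summand n k) / (rho D ^ k * real k powr (nu D * real n + Re (gam D)))) \<longlonglongrightarrow> c"
proof -
  define qI where "qI = (\<lambda>i. Re (of_real (lam D i * real n) + alp D i) - 1 / 2)"
  define qJ where "qJ = (\<lambda>j. Re (of_real (mu D j * real n) + bet D j) - 1 / 2)"
  define a where "a = (\<lambda>i x. exp (sig D i * x * ln x + qI i * ln x + sig D i * x * ln (sig D i) - sig D i * x))"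
  define b where "b = (\<lambda>j x. exp (tau D j * x * ln x + qJ j * ln x + tau D j * x * ln (tau D j) - tau D j * x))"
  define G where "G = (\<lambda>i k. norm (Gamma (of_real (sig D i * real k) + (of_real (lam D i * real n) + alp D i))))"
  define H where "H = (\<lambda>j k. norm (Gamma (of_real (tau D j * real k) + (of_real (mu D j * real n) + bet D j))))"
  define c where "c = (\<Prod>i\<in>Iset D. sqrt (2 * pi) * sig D i powr qI i) / (\<Prod>j\<in>Jset D. sqrt (2 * pi) * tau D j powr qJ j)"
  have sp: "0 < sqrt (2 * pi) * s powr q" if "s > 0" for s q :: real using that by simp
  have "c > 0" unfolding c_def by (intro divide_pos_pos prod_pos ballI sp sig_pos[OF inf] tau_pos[OF inf])
  have lim: "(\<lambda>k. (\<Prod>i\<in>Iset D. G i k / a i (real k)) / (\<Prod>j\<in>Jset D. H j k / b j (real k))) \<longlonglongrightarrow> c"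
    unfolding c_def G_def H_def a_def b_def qI_def qJ_def
    by (intro tendsto_divide tendsto_prod norm_Gamma_affine_asymp sig_pos[OF inf] tau_pos[OF inf])
       (use tau_nonzero in \<open>auto simp: finite_J\<close>)
  have ev: "eventually (\<lambda>k. (\<Prod>i\<in>Iset D. G i k / a i (real k)) / (\<Prod>j\<in>Jset D. H j k / b j (real k)) =
     norm (summand n k) / (rho D ^ k * real k powr (nu D * real n + Re (gam D)))) sequentially"
    using eventually_gt_at_top[of 0]
  proof eventually_elim
    case (elim k)
    have q: "sum qI (Iset D) - sum qJ (Jset D) = nu D * real n + Re (gam D)"
      by (simp add: qI_def qJ_def nu_def gam_def sum.distrib sum_subtractf left_diff_distrib sum_distrib_right diff_divide_distrib)
    have r: "(\<Prod>i\<in>Iset D. a i (real k)) / (\<Prod>j\<in>Jset D. b j (real k)) * zval D ^ k = rho D ^ k * real k powr (nu D * real n + Re (gam D))"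
      using prod_exp_asymp[OF inf, of "real k" qI 1 qJ] elim z_pos rho_pos by (simp add: a_def b_def q powr_realpow)
    have z: "zval D ^ k > 0" "(\<Prod>i\<in>Iset D. a i (real k)) > 0" "(\<Prod>j\<in>Jset D. b j (real k)) > 0"
      using z_pos by (auto simp: a_def b_def intro!: prod_pos)
    have "norm (summand n k) = (\<Prod>i\<in>Iset D. G i k) / (\<Prod>j\<in>Jset D. H j k) * zval D ^ k"
      using z_pos by (simp add: summand_def Gterm_def norm_mult norm_divide norm_power prod_norm[symmetric] G_def H_def add.assoc)
    thus ?case unfolding r[symmetric] using z z_pos by (simp add: prod_dividef)
  qed
  show ?thesis by (rule that[OF \<open>c > 0\<close> Lim_transform_eventually[OF lim ev]])
qed

text \<open>The criterion for a single n: the summands have a positive finite ratio limit to rho^k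
  k^(nu n + Re gam), and only finitely many natural numbers are missing from the range.\<close>

lemma gsum_abs_convergent_iff:
  assumes inf: "r1 D = \<infinity>"
  shows "gsum_abs_convergent D n \<longleftrightarrow> rho D < 1 \<or> rho D = 1 \<and> nu D * real n + Re (gam D) < - 1"
proof -
  obtain c where c: "c > 0" "(\<lambda>k. norm (summand n k) / (rho D ^ k * real k powr (nu D * real n + Re (gam D)))) \<longlonglongrightarrow> c"
    using norm_summand_asymp[OF inf] by blast
  have "finite (UNIV - krange D n)"
  proof (rule finite_subset)
    show "UNIV - krange D n \<subseteq> {..nat \<lceil>r0 D * real n\<rceil>}" by (auto simp: krange_def inf)
  qed simp
  hence "(\<lambda>k. norm (summand n k)) summable_on (UNIV - krange D n)" by (rule summable_on_finite)
  hence "gsum_abs_convergent D n \<longleftrightarrow> (\<lambda>k. norm (summand n k)) summable_on UNIV"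
    unfolding gsum_abs_convergent_def summand_def[symmetric]
    using summable_on_Un_disjoint[of "\<lambda>k. norm (summand n k)" "krange D n" "UNIV - krange D n"]
      summable_on_subset_banach[of "\<lambda>k. norm (summand n k)" UNIV "krange D n"] by auto
  also have "\<dots> \<longleftrightarrow> summable (\<lambda>k. norm (summand n k))"
    by (rule summable_on_UNIV_nonneg_real_iff) simp
  also have "\<dots> \<longleftrightarrow> summable (\<lambda>k. rho D ^ k * real k powr (nu D * real n + Re (gam D)))"
    by (rule summable_iff_limit_ratio[OF c(2,1)])
       (use rho_pos in \<open>auto intro: eventually_mono[OF eventually_gt_at_top[of 0]]\<close>)
  finally show ?thesis by (simp add: summable_power_times_powr_iff rho_pos)
qed

text \<open>For rho = 1 and large n the exponent nu n + Re gam is decided by the sign of nu, and by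
  Re gam alone if nu = 0.\<close>

lemma eventually_gsum_abs_convergent_iff:
  assumes inf: "r1 D = \<infinity>"
  shows "(\<forall>\<^sub>F n in sequentially. gsum_abs_convergent D n) \<longleftrightarrow>
    0 < rho D \<and> rho D < 1 \<or> rho D = 1 \<and> nu D < 0 \<or> rho D = 1 \<and> nu D = 0 \<and> Re (gam D) < - 1"
proof -
  have neg: "\<forall>\<^sub>F n in sequentially. v * real n + g < -1" if "v < 0" for v g :: real using that by real_asymp
  have pos: "\<forall>\<^sub>F n in sequentially. v * real n + g > 0" if "v > 0" for v g :: real using that by real_asymp
  consider "rho D < 1" | "rho D = 1" "nu D < 0" | "rho D = 1" "nu D = 0" | "rho D = 1" "nu D > 0" | "rho D > 1"
    by linarith
  thus ?thesis
  proof cases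
    case 2
    thus ?thesis using neg[of "nu D" "Re (gam D)"] by (simp add: gsum_abs_convergent_iff[OF inf])
  next
    case 4
    have "\<not> (\<forall>\<^sub>F n in sequentially. nu D * real n + Re (gam D) < - 1)"
    proof
      assume "\<forall>\<^sub>F n in sequentially. nu D * real n + Re (gam D) < - 1"
      with pos[OF 4(2), of "Re (gam D)"] have "\<forall>\<^sub>F n::nat in sequentially. False" by eventually_elim linarith
      thus False by simp
    qed
    thus ?thesis using 4 by (simp add: gsum_abs_convergent_iff[OF inf])
  qed (use rho_pos in \<open>auto simp: gsum_abs_convergent_iff[OF inf]\<close>)
qed

end

section \<open>Local expansion of the phase\<close>

lemma field_differentiable_imp_local_lipschitz:
  fixes g :: "complex \<Rightarrow> complex"
  assumes "g field_differentiable at w"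
  shows "\<exists>C\<ge>0. \<exists>e>0. \<forall>v. dist v w < e \<longrightarrow> norm (g v - g w) \<le> C * norm (v - w)"
proof -
  obtain d where d: "(g has_field_derivative d) (at w)" using assms by (auto simp: field_differentiable_def)
  hence "((\<lambda>v. norm ((g v - g w) / (v - w))) \<longlongrightarrow> norm d) (at w)"
    by (intro tendsto_norm) (simp add: has_field_derivative_iff)
  hence "eventually (\<lambda>v. norm ((g v - g w) / (v - w)) < norm d + 1) (at w)"
    by (rule order_tendstoD) simp
  then obtain e where e: "e > 0" "\<And>v. v \<noteq> w \<Longrightarrow> dist v w < e \<Longrightarrow> norm ((g v - g w) / (v - w)) < norm d + 1"
    by (auto simp: eventually_at)
  have "norm (g v - g w) \<le> (norm d + 1) * norm (v - w)" if "dist v w < e" for v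
  proof (cases "v = w")
    case False
    with e(2)[OF False that] show ?thesis by (simp add: norm_divide pos_divide_less_eq less_imp_le)
  qed simp
  thus ?thesis using e(1) by (intro exI[of _ "norm d + 1"] conjI exI[of _ e]) auto
qed

context gamma_sum
begin

text \<open>The open interval, where all forms are positive and \<open>phi\<close> is smooth;
  \<open>X\<close> adds the finite endpoints.\<close>

definition U :: "real set" where "U = {x. r0 D < x \<and> ereal x < r1 D}"

lemma open_U: "open U"
proof -
  have "open {x. ereal x < r1 D}"
    by (cases "r1 D") (simp_all add: lessThan_def[symmetric])
  hence "open ({r0 D<..} \<inter> {x. ereal x < r1 D})" by (intro open_Int) auto
  also have "{r0 D<..} \<inter> {x. ereal x < r1 D} = U" by (auto simp: U_def)
  finally show ?thesis .
qed

lemma U_subset_X: "U \<subseteq> X"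
  by (auto simp: U_def X_def)

lemma lform_pos_U: "x \<in> U \<Longrightarrow> i \<in> Iset D \<Longrightarrow> lform D i x > 0"
  and mform_pos_U: "x \<in> U \<Longrightarrow> j \<in> Jset D \<Longrightarrow> mform D j x > 0"
  using lform_pos mform_pos by (auto simp: U_def)

definition phi_d1 :: "real \<Rightarrow> real" where
  "phi_d1 x = - (ln (zval D) + (\<Sum>i\<in>Iset D. sig D i * ln (lform D i x)) - (\<Sum>j\<in>Jset D. tau D j * ln (mform D j x)))"

definition phi_d2 :: "real \<Rightarrow> real" where
  "phi_d2 x = - ((\<Sum>i\<in>Iset D. (sig D i)\<^sup>2 / lform D i x) - (\<Sum>j\<in>Jset D. (tau D j)\<^sup>2 / mform D j x))"

definition phi_d3 :: "real \<Rightarrow> real" where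
  "phi_d3 x = (\<Sum>i\<in>Iset D. (sig D i) ^ 3 / (lform D i x)\<^sup>2) - (\<Sum>j\<in>Jset D. (tau D j) ^ 3 / (mform D j x)\<^sup>2)"

lemma lform_deriv: "(lform D i has_real_derivative sig D i) (at x)"
  unfolding lform_def[abs_def] by (auto intro!: derivative_eq_intros)

lemma mform_deriv: "(mform D j has_real_derivative tau D j) (at x)"
  unfolding mform_def[abs_def] by (auto intro!: derivative_eq_intros)

lemma phi_eq:
  assumes "x \<in> U"
  shows "phi D x = - (x * ln (zval D) + (\<Sum>i\<in>Iset D. lform D i x * ln (lform D i x)) -
    (\<Sum>j\<in>Jset D. mform D j x * ln (mform D j x)))"
proof -
  have I: "(\<Prod>i\<in>Iset D. self_pow (lform D i x)) = exp (\<Sum>i\<in>Iset D. lform D i x * ln (lform D i x))"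
    unfolding exp_sum[OF finite_I] by (rule prod.cong[OF refl]) (rule self_pow_eq_exp[OF lform_pos_U[OF assms]])
  have J: "(\<Prod>j\<in>Jset D. self_pow (mform D j x)) = exp (\<Sum>j\<in>Jset D. mform D j x * ln (mform D j x))"
    unfolding exp_sum[OF finite_J] by (rule prod.cong[OF refl]) (rule self_pow_eq_exp[OF mform_pos_U[OF assms]])
  have Z: "zval D powr x = exp (x * ln (zval D))" using z_pos by (simp add: powr_def)
  show ?thesis unfolding phi_def Phi_real_def I J Z exp_diff[symmetric] exp_add[symmetric] ln_exp by simp
qed

text \<open>Differentiating t ln t along a form gives slope * (ln t + 1); the sums of the bare
  slopes cancel by balancedness, which is why \<open>phi_d1\<close> contains only
  logarithms.\<close>

lemma phi_deriv:
  assumes "x \<in> U"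
  shows "(phi D has_real_derivative phi_d1 x) (at x)"
proof -
  have I: "((\<lambda>x. lform D i x * ln (lform D i x)) has_real_derivative (sig D i * ln (lform D i x) + sig D i)) (at x)"
    if "i \<in> Iset D" for i
    using lform_pos_U[OF assms that] by (auto intro!: derivative_eq_intros lform_deriv)
  have J: "((\<lambda>x. mform D j x * ln (mform D j x)) has_real_derivative (tau D j * ln (mform D j x) + tau D j)) (at x)"
    if "j \<in> Jset D" for j
    using mform_pos_U[OF assms that] by (auto intro!: derivative_eq_intros mform_deriv)
  have "((\<lambda>x. - (x * ln (zval D) + (\<Sum>i\<in>Iset D. lform D i x * ln (lform D i x)) -
    (\<Sum>j\<in>Jset D. mform D j x * ln (mform D j x)))) has_real_derivative
    (- (1 * ln (zval D) + (\<Sum>i\<in>Iset D. sig D i * ln (lform D i x) + sig D i) - (\<Sum>j\<in>Jset D. tau D j * ln (mform D j x) + tau D j)))) (at x)"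
    by (intro DERIV_minus DERIV_diff DERIV_add DERIV_sum I J DERIV_cmult_right DERIV_ident)
  also have "- (1 * ln (zval D) + (\<Sum>i\<in>Iset D. sig D i * ln (lform D i x) + sig D i) - (\<Sum>j\<in>Jset D. tau D j * ln (mform D j x) + tau D j)) = phi_d1 x"
    by (simp add: phi_d1_def sum.distrib balanced)
  finally show ?thesis
    by (rule has_field_derivative_transform_within_open[OF _ open_U assms]) (simp add: phi_eq)
qed

lemma phi_d1_deriv:
  assumes "x \<in> U"
  shows "(phi_d1 has_real_derivative phi_d2 x) (at x)"
proof -
  have I: "((\<lambda>x. sig D i * ln (lform D i x)) has_real_derivative ((sig D i)\<^sup>2 / lform D i x)) (at x)"
    if "i \<in> Iset D" for i
    using lform_pos_U[OF assms that] by (auto intro!: derivative_eq_intros lform_deriv simp: power2_eq_square)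
  have J: "((\<lambda>x. tau D j * ln (mform D j x)) has_real_derivative ((tau D j)\<^sup>2 / mform D j x)) (at x)"
    if "j \<in> Jset D" for j
    using mform_pos_U[OF assms that] by (auto intro!: derivative_eq_intros mform_deriv simp: power2_eq_square)
  have "(phi_d1 has_real_derivative - (0 + (\<Sum>i\<in>Iset D. (sig D i)\<^sup>2 / lform D i x) - (\<Sum>j\<in>Jset D. (tau D j)\<^sup>2 / mform D j x))) (at x)"
    unfolding phi_d1_def[abs_def] by (intro DERIV_minus DERIV_diff DERIV_add DERIV_sum I J DERIV_const)
  thus ?thesis by (simp add: phi_d2_def)
qed

lemma phi_d2_deriv:
  assumes "x \<in> U"
  shows "(phi_d2 has_real_derivative phi_d3 x) (at x)"
proof -
  have I: "((\<lambda>x. (sig D i)\<^sup>2 / lform D i x) has_real_derivative (- ((sig D i) ^ 3 / (lform D i x)\<^sup>2))) (at x)"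
    if "i \<in> Iset D" for i
    using lform_pos_U[OF assms that]
    by (auto intro!: derivative_eq_intros lform_deriv simp: power2_eq_square power3_eq_cube)
  have J: "((\<lambda>x. (tau D j)\<^sup>2 / mform D j x) has_real_derivative (- ((tau D j) ^ 3 / (mform D j x)\<^sup>2))) (at x)"
    if "j \<in> Jset D" for j
    using mform_pos_U[OF assms that]
    by (auto intro!: derivative_eq_intros mform_deriv simp: power2_eq_square power3_eq_cube)
  have "(phi_d2 has_real_derivative - ((\<Sum>i\<in>Iset D. - ((sig D i) ^ 3 / (lform D i x)\<^sup>2)) - (\<Sum>j\<in>Jset D. - ((tau D j) ^ 3 / (mform D j x)\<^sup>2)))) (at x)"
    unfolding phi_d2_def[abs_def] by (intro DERIV_minus DERIV_diff DERIV_sum I J)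
  thus ?thesis by (simp add: phi_d3_def sum_negf)
qed

lemma continuous_on_phi_d3: "continuous_on U phi_d3"
proof -
  have l: "continuous_on U (lform D i)" for i unfolding lform_def[abs_def] by (intro continuous_intros)
  have m: "continuous_on U (mform D j)" for j unfolding mform_def[abs_def] by (intro continuous_intros)
  show ?thesis unfolding phi_d3_def[abs_def]
    by (intro continuous_intros l m ballI) (use lform_pos_U mform_pos_U in force)+
qed

text \<open>The inner derivative agrees with \<open>phi_d1\<close> on a whole neighbourhood of x, as
  U is open, and so may be replaced before differentiating again.\<close>

lemma phi''_eq:
  assumes "x \<in> U"
  shows "phi'' D x = phi_d2 x"
proof -
  have "deriv (phi D) y = phi_d1 y" if "y \<in> U" for y using DERIV_imp_deriv[OF phi_deriv[OF that]] .
  hence "(deriv (phi D) has_real_derivative phi_d2 x) (at x)"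
    by (intro has_field_derivative_transform_within_open[OF phi_d1_deriv[OF assms] open_U assms]) simp
  thus ?thesis unfolding phi''_def by (rule DERIV_imp_deriv)
qed

text \<open>Lagrange remainder of order 3, with the third derivative bounded by B on a compact ball.
  The radius is cut so that B e / 6 \<le> \<open>phi_d2 x0\<close> / 4; the cubic term then consumes
  at most half of the quadratic one.\<close>

lemma phi_taylor:
  assumes x0: "x0 \<in> U" "phi_d1 x0 = 0" and a: "phi_d2 x0 > 0"
  shows "\<exists>C\<ge>0. \<exists>e>0. \<forall>x. \<bar>x - x0\<bar> \<le> e \<longrightarrow> x \<in> U \<and>
     \<bar>phi D x - phi D x0 - phi_d2 x0 / 2 * (x - x0)\<^sup>2\<bar> \<le> C * \<bar>x - x0\<bar> ^ 3 \<and>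
     phi D x - phi D x0 \<ge> phi_d2 x0 / 4 * (x - x0)\<^sup>2"
proof -
  obtain e1 where e1: "e1 > 0" "cball x0 e1 \<subseteq> U" using open_U x0(1) open_contains_cball by blast
  have "compact (phi_d3 ` cball x0 e1)"
    by (intro compact_continuous_image continuous_on_subset[OF continuous_on_phi_d3 e1(2)]) auto
  then obtain B where B: "B > 0" "\<And>x. x \<in> cball x0 e1 \<Longrightarrow> \<bar>phi_d3 x\<bar> \<le> B"
    using compact_imp_bounded by (force simp: bounded_pos)
  define e where "e = min e1 (3 * phi_d2 x0 / (2 * B))"
  have e: "e > 0" "e \<le> e1" "B * e \<le> 3 * phi_d2 x0 / 2" using e1 B a
    by (auto simp: e_def min_def field_simps)
  have *: "\<bar>phi D x - phi D x0 - phi_d2 x0 / 2 * (x - x0)\<^sup>2\<bar> \<le> B / 6 * \<bar>x - x0\<bar> ^ 3" if x: "\<bar>x - x0\<bar> \<le> e" for x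
  proof (cases "x = x0")
    case False
    define diff where "diff = (\<lambda>m::nat. if m = 0 then phi D else if m = 1 then phi_d1 else if m = 2 then phi_d2 else phi_d3)"
    have inU: "t \<in> U" if "\<bar>t - x0\<bar> \<le> e" for t using that e e1(2) by (auto simp: dist_real_def abs_minus_commute)
    have "\<exists>t. (if x < x0 then x < t \<and> t < x0 else x0 < t \<and> t < x) \<and>
        phi D x = (\<Sum>m<3. diff m x0 / fact m * (x - x0) ^ m) + diff 3 t / fact 3 * (x - x0) ^ 3"
    proof (rule Taylor)
      show "\<forall>m t. m < 3 \<and> x0 - e \<le> t \<and> t \<le> x0 + e \<longrightarrow> DERIV (diff m) t :> diff (Suc m) t"
      proof (intro allI impI)
        fix m :: nat and t :: real assume mt: "m < 3 \<and> x0 - e \<le> t \<and> t \<le> x0 + e"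
        hence tU: "t \<in> U" by (intro inU) auto
        have "m = 0 \<or> m = 1 \<or> m = 2" using mt by auto
        thus "DERIV (diff m) t :> diff (Suc m) t"
          using phi_deriv[OF tU] phi_d1_deriv[OF tU] phi_d2_deriv[OF tU] by (auto simp: diff_def)
      qed
    qed (use x False e in \<open>auto simp: diff_def\<close>)
    then obtain t where t: "if x < x0 then x < t \<and> t < x0 else x0 < t \<and> t < x"
      "phi D x = (\<Sum>m<3. diff m x0 / fact m * (x - x0) ^ m) + diff 3 t / fact 3 * (x - x0) ^ 3" by blast
    have "phi D x - phi D x0 - phi_d2 x0 / 2 * (x - x0)\<^sup>2 = phi_d3 t / 6 * (x - x0) ^ 3"
      using t(2) x0(2) by (simp add: diff_def eval_nat_numeral fact_numeral)
    hence "\<bar>phi D x - phi D x0 - phi_d2 x0 / 2 * (x - x0)\<^sup>2\<bar> = \<bar>phi_d3 t\<bar> / 6 * \<bar>x - x0\<bar> ^ 3"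
      by (simp only: abs_mult power_abs abs_divide abs_numeral)
    also have "\<bar>t - x0\<bar> \<le> e" using t(1) x by (auto split: if_splits)
    hence "\<bar>phi_d3 t\<bar> \<le> B" using e by (intro B) (auto simp: dist_real_def abs_minus_commute)
    hence "\<bar>phi_d3 t\<bar> / 6 * \<bar>x - x0\<bar> ^ 3 \<le> B / 6 * \<bar>x - x0\<bar> ^ 3" by (intro mult_right_mono) auto
    finally show ?thesis .
  qed simp
  have **: "phi D x - phi D x0 \<ge> phi_d2 x0 / 4 * (x - x0)\<^sup>2" if x: "\<bar>x - x0\<bar> \<le> e" for x
  proof -
    have "B / 6 * \<bar>x - x0\<bar> ^ 3 = (B * \<bar>x - x0\<bar>) / 6 * (x - x0)\<^sup>2"
      by (simp add: power3_eq_cube power2_eq_square mult.assoc)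
    also have "\<dots> \<le> (B * e) / 6 * (x - x0)\<^sup>2"
      using x B by (intro mult_right_mono divide_right_mono mult_left_mono) auto
    also have "\<dots> \<le> (3 * phi_d2 x0 / 2) / 6 * (x - x0)\<^sup>2"
      using e by (intro mult_right_mono divide_right_mono) auto
    finally have "B / 6 * \<bar>x - x0\<bar> ^ 3 \<le> phi_d2 x0 / 4 * (x - x0)\<^sup>2" by simp
    moreover have "phi_d2 x0 / 2 * (x - x0)\<^sup>2 = phi_d2 x0 / 4 * (x - x0)\<^sup>2 + phi_d2 x0 / 4 * (x - x0)\<^sup>2" by simp
    ultimately show ?thesis using *[OF x] by linarith
  qed
  show ?thesis
  proof (rule exI[of _ "B / 6"], intro conjI, goal_cases)
    case 2
    show ?case
    proof (rule exI[of _ e], intro conjI allI impI)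
      fix x assume "\<bar>x - x0\<bar> \<le> e"
      thus "x \<in> U" using e e1(2) by (auto simp: dist_real_def abs_minus_commute)
    qed (use e * ** in auto)
  qed (use B in simp)
qed

text \<open>As a function of a complex variable the amplitude is analytic at x0, since the forms are
  positive there and so avoid the branch cut of the powers. Complex differentiability at one point
  gives the Lipschitz bound.\<close>

lemma ufun_lipschitz:
  assumes x0: "x0 \<in> U"
  shows "\<exists>C\<ge>0. \<exists>e>0. \<forall>x. \<bar>x - x0\<bar> \<le> e \<longrightarrow> norm (ufun D x - ufun D x0) \<le> C * \<bar>x - x0\<bar>"
proof -
  define g where "g = (\<lambda>w. of_real ((2 * pi) powr ((real (card (Iset D)) - real (card (Jset D))) / 2)) *
     ((\<Prod>i\<in>Iset D. (of_real (sig D i) * w + of_real (lam D i)) powr (alp D i - 1 / 2)) /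
      (\<Prod>j\<in>Jset D. (of_real (tau D j) * w + of_real (mu D j)) powr (bet D j - 1 / 2))))"
  have eq: "ufun D x = g (of_real x)" for x by (simp add: ufun_def g_def lform_def mform_def)
  have I: "of_real (sig D i) * of_real x0 + of_real (lam D i) \<notin> (\<real>\<^sub>\<le>\<^sub>0 :: complex set)" if "i \<in> Iset D" for i
    using lform_pos_U[OF x0 that] by (simp add: lform_def complex_nonpos_Reals_iff)
  have J: "of_real (tau D j) * of_real x0 + of_real (mu D j) \<notin> (\<real>\<^sub>\<le>\<^sub>0 :: complex set)" if "j \<in> Jset D" for j
    using mform_pos_U[OF x0 that] by (simp add: mform_def complex_nonpos_Reals_iff)
  have "of_real (tau D j) * of_real x0 + of_real (mu D j) \<noteq> (0 :: complex)" if "j \<in> Jset D" for j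
    using J[OF that] by auto
  hence "g analytic_on {of_real x0}"
    unfolding g_def using I J finite_J by (intro analytic_intros) auto
  hence "g field_differentiable at (of_real x0)" by (rule analytic_on_imp_differentiable_at) simp
  then obtain C e where C: "C \<ge> 0" "e > 0" "\<And>v. dist v (of_real x0) < e \<Longrightarrow> norm (g v - g (of_real x0)) \<le> C * norm (v - of_real x0)"
    using field_differentiable_imp_local_lipschitz by blast
  have "norm (ufun D x - ufun D x0) \<le> C * \<bar>x - x0\<bar>" if "\<bar>x - x0\<bar> \<le> e / 2" for x
    using C(3)[of "of_real x"] that C(2) by (simp add: eq dist_norm flip: of_real_diff)
  thus ?thesis using C(1,2) by (intro exI[of _ C] conjI exI[of _ "e / 2"]) auto
qed

text \<open>At an endpoint where a form vanishes this rests on the convention 0^0 = 1 in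
  \<open>self_pow\<close>.\<close>

lemma continuous_on_Phi_real: "continuous_on X (Phi_real D)"
proof -
  have l: "continuous_on X (\<lambda>x. self_pow (lform D i x))" if "i \<in> Iset D" for i
    by (rule continuous_on_compose2[OF continuous_on_self_pow])
       (use lform_nonneg that in \<open>auto simp: lform_def[abs_def] intro!: continuous_intros\<close>)
  have m: "continuous_on X (\<lambda>x. self_pow (mform D j x))" if "j \<in> Jset D" for j
    by (rule continuous_on_compose2[OF continuous_on_self_pow])
       (use mform_nonneg that in \<open>auto simp: mform_def[abs_def] intro!: continuous_intros\<close>)
  show ?thesis unfolding Phi_real_def[abs_def]
    using z_pos prod_self_pow_pos(2)
    by (intro continuous_on_mult continuous_on_divide continuous_on_prod l m ballI continuous_intros) fastforce+
qed

end

section \<open>Peaks of the phase\<close>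

text \<open>Convergence enters in the explicit form of the criterion, from which the decay of Phi
  can be read off.\<close>

locale gamma_sum_peak = gamma_sum +
  assumes convergent: "r1 D = \<infinity> \<Longrightarrow> rho D < 1 \<or> rho D = 1 \<and> nu D < 0 \<or> rho D = 1 \<and> nu D = 0 \<and> Re (gam D) < - 1"
    and below_r0: "Phi D (ereal (r0 D)) < Phi_max D" and below_r1: "Phi D (r1 D) < Phi_max D"
    and nondegenerate: "\<And>x. x \<in> Maxset D \<Longrightarrow> phi'' D (real_of_ereal x) > 0"
    and generic: "\<And>n. n \<ge> 1 \<Longrightarrow> delta0 D n > 0 \<and> delta1 D n > 0"
begin

text \<open>Prepares the sum over an unbounded range: with n_0 copies of this bound a weight k^(Re
  gam) becomes a power of k with exponent below -1. If Phi decays, c is positive and n_0 is taken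
  large; if Phi tends to a positive constant, c = 0 and Re gam < -1 suffices.\<close>

lemma Phi_real_decay:
  assumes inf: "r1 D = \<infinity>"
  obtains C R c and n0 :: nat where "C > 0" "R \<ge> 1" "c \<ge> 0" "Re (gam D) - c * real n0 < -1"
    "\<And>x. x \<ge> R \<Longrightarrow> Phi_real D x \<le> C * x powr (- c)"
proof -
  obtain L where L: "L > 0" "((\<lambda>x. Phi_real D x / (rho D powr x * x powr nu D)) \<longlongrightarrow> L) at_top"
    using Phi_real_asymp[OF inf] by blast
  have ev: "eventually (\<lambda>x. Phi_real D x / (rho D powr x * x powr nu D) < L + 1) at_top"
    using order_tendstoD(2)[OF L(2)] by simp
  obtain c where c: "c \<ge> 0" "c > 0 \<or> Re (gam D) < -1"
    "eventually (\<lambda>x. rho D powr x * x powr nu D \<le> x powr (- c)) at_top"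
  proof -
    from convergent[OF inf] show ?thesis
    proof (elim disjE conjE)
      assume "rho D < 1"
      hence "eventually (\<lambda>x. rho D powr x * x powr nu D \<le> x powr (- 1)) at_top"
        using rho_pos by real_asymp
      with that[of 1] show ?thesis by simp
    next
      assume "rho D = 1" "nu D < 0"
      with that[of "- nu D"] show ?thesis by simp
    next
      assume "rho D = 1" "nu D = 0" "Re (gam D) < -1"
      with that[of 0] show ?thesis by simp
    qed
  qed
  obtain n0 :: nat where n0: "Re (gam D) - c * real n0 < -1"
  proof (cases "c > 0")
    case True
    obtain n0 :: nat where "(Re (gam D) + 1) / c < real n0" using reals_Archimedean2 by blast
    with True that[of n0] show ?thesis by (simp add: field_simps)
  next
    case False
    with c that[of 0] show ?thesis by simp
  qed
  have "eventually (\<lambda>x. Phi_real D x \<le> (L + 1) * x powr (- c)) at_top"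
    using ev c(3) eventually_gt_at_top[of 0]
  proof eventually_elim
    case (elim x)
    have "rho D powr x * x powr nu D > 0" using elim rho_pos by simp
    hence "Phi_real D x \<le> (L + 1) * (rho D powr x * x powr nu D)"
      using elim(1) by (simp add: pos_divide_less_eq less_imp_le del: mult_pos_pos)
    also have "\<dots> \<le> (L + 1) * x powr (- c)" using elim(2) L by (intro mult_left_mono) auto
    finally show ?case .
  qed
  then obtain R where "\<And>x. x \<ge> R \<Longrightarrow> Phi_real D x \<le> (L + 1) * x powr (- c)"
    by (auto simp: eventually_at_top_linorder)
  with L that[of "L + 1" "max R 1" c n0] c(1) n0 show ?thesis by auto
qed

text \<open>\<open>Phi D \<infinity>\<close> is given by \<open>Lim\<close>, so the existence of the
  limit has to be shown. In the three cases of convergence it is 0, 0 and a positive number.\<close>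

lemma Phi_infinity:
  assumes inf: "r1 D = \<infinity>"
  obtains L where "L \<ge> 0" "(Phi_real D \<longlongrightarrow> L) at_top" "Phi D \<infinity> = L"
proof -
  obtain L where L: "L > 0" "((\<lambda>x. Phi_real D x / (rho D powr x * x powr nu D)) \<longlongrightarrow> L) at_top"
    using Phi_real_asymp[OF inf] by blast
  obtain l where l: "l \<ge> 0" "((\<lambda>x. rho D powr x * x powr nu D) \<longlongrightarrow> l) at_top"
  proof -
    from convergent[OF inf] show ?thesis
    proof (elim disjE conjE)
      assume "rho D < 1"
      hence "((\<lambda>x. rho D powr x * x powr nu D) \<longlongrightarrow> 0) at_top"
        using rho_pos by real_asymp
      with that[of 0] show ?thesis by simp
    next
      assume r: "rho D = 1" "nu D < 0"
      hence "((\<lambda>x. x powr nu D) \<longlongrightarrow> 0) at_top" by real_asymp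
      with r that[of 0] show ?thesis by simp
    next
      assume r: "rho D = 1" "nu D = 0"
      have "((\<lambda>x. rho D powr x * x powr nu D) \<longlongrightarrow> 1) at_top"
        by (rule tendsto_eventually) (use r in \<open>auto intro: eventually_mono[OF eventually_gt_at_top[of 0]]\<close>)
      with that[of 1] show ?thesis by simp
    qed
  qed
  have "((\<lambda>x. Phi_real D x / (rho D powr x * x powr nu D) * (rho D powr x * x powr nu D)) \<longlongrightarrow> L * l) at_top"
    by (rule tendsto_mult[OF L(2) l(2)])
  moreover have "eventually (\<lambda>x. Phi_real D x / (rho D powr x * x powr nu D) * (rho D powr x * x powr nu D) = Phi_real D x) at_top"
    using eventually_gt_at_top[of 0] by eventually_elim (use rho_pos in simp)
  ultimately have lim: "(Phi_real D \<longlongrightarrow> L * l) at_top" by (rule Lim_transform_eventually)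
  have "Phi D \<infinity> = L * l" using tendsto_Lim[OF _ lim] by (simp add: Phi_def)
  with lim L(1) l(1) show ?thesis by (intro that[of "L * l"]) simp_all
qed

lemma r0_in_X: "r0 D \<in> X"
  using r0_less_r1 by (simp add: X_def less_imp_le)

lemma Phi_real_r0: "Phi_real D (r0 D) < Phi_max D"
  using below_r0 by (simp add: Phi_def)

lemma Phi_max_pos: "Phi_max D > 0"
  using Phi_real_r0 Phi_real_pos[OF r0_in_X] by linarith

lemma interval_subset_X: "R \<in> X \<Longrightarrow> {r0 D..R} \<subseteq> X"
  unfolding X_def by (auto, meson ereal_less_eq(3) order.trans)

text \<open>For finite r_1 the tail is the single point R = r_1. For r_1 = \<infinity> the number q
  is such that q * \<open>Phi_max D\<close> lies halfway between the limit and the maximum.\<close>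

lemma tail_below_max:
  obtains R q where "R \<in> X" "0 < q" "q < 1" "\<And>x. x \<in> X \<Longrightarrow> R \<le> x \<Longrightarrow> Phi_real D x \<le> q * Phi_max D"
proof (cases "r1 D")
  case (real r)
  have r: "r \<in> X" using r0_less_r1 real by (simp add: X_def)
  have lt: "Phi_real D r < Phi_max D" using below_r1 real by (simp add: Phi_def)
  show ?thesis
  proof (rule that[of r "Phi_real D r / Phi_max D"])
    fix x assume "x \<in> X" "r \<le> x"
    hence "x = r" using real by (simp add: X_def)
    thus "Phi_real D x \<le> Phi_real D r / Phi_max D * Phi_max D" using Phi_max_pos by simp
  qed (use r lt Phi_max_pos Phi_real_pos[OF r] in auto)
next
  case PInf
  obtain L where L: "L \<ge> 0" "(Phi_real D \<longlongrightarrow> L) at_top" "Phi D \<infinity> = L"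
    using Phi_infinity[OF PInf] by blast
  have lt: "L < Phi_max D" using below_r1 L(3) PInf by simp
  define q where "q = (L + Phi_max D) / (2 * Phi_max D)"
  have q: "0 < q" "q < 1" "q * Phi_max D = (L + Phi_max D) / 2"
    using lt L(1) Phi_max_pos by (auto simp: q_def field_simps)
  have "eventually (\<lambda>x. Phi_real D x < q * Phi_max D) at_top"
    by (rule order_tendstoD(2)[OF L(2)]) (use lt in \<open>simp add: q(3)\<close>)
  then obtain R where R: "\<And>x. x \<ge> R \<Longrightarrow> Phi_real D x < q * Phi_max D" by (auto simp: eventually_at_top_linorder)
  show ?thesis
  proof (rule that[of "max R (r0 D)" q])
    fix x assume "max R (r0 D) \<le> x"
    hence "R \<le> x" by simp
    from R[OF this] show "Phi_real D x \<le> q * Phi_max D" by simp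
  qed (use q PInf in \<open>auto simp: X_def\<close>)
next
  case MInf
  with r0_less_r1 show ?thesis by simp
qed

lemma Phi_real_bounded: "\<exists>B. \<forall>x\<in>X. Phi_real D x \<le> B"
proof -
  obtain R q where R: "R \<in> X" "0 < q" "q < 1" "\<And>x. x \<in> X \<Longrightarrow> R \<le> x \<Longrightarrow> Phi_real D x \<le> q * Phi_max D"
    using tail_below_max by blast
  have "compact (Phi_real D ` {r0 D..R})"
    by (intro compact_continuous_image continuous_on_subset[OF continuous_on_Phi_real interval_subset_X[OF R(1)]]) auto
  then obtain B where B: "\<And>x. x \<in> {r0 D..R} \<Longrightarrow> Phi_real D x \<le> B"
    using bounded_imp_bdd_above[OF compact_imp_bounded] by (force simp: bdd_above_def)
  have "Phi_real D x \<le> max B (q * Phi_max D)" if "x \<in> X" for x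
    using R(4)[OF that] B[of x] that by (cases "x \<le> R") (auto simp: X_def le_max_iff_disj)
  thus ?thesis by blast
qed

text \<open>\<open>Phi_max\<close> is a supremum of real numbers, so an upper bound has to be
  exhibited before any value can be compared with it.\<close>

lemma Phi_real_le_max: "x \<in> X \<Longrightarrow> Phi_real D x \<le> Phi_max D"
proof -
  assume x: "x \<in> X"
  obtain B where B: "\<And>x. x \<in> X \<Longrightarrow> Phi_real D x \<le> B" using Phi_real_bounded by blast
  have "Phi D y \<le> max B (Phi_max D)" if "y \<in> {ereal (r0 D)..r1 D}" for y
  proof (cases y)
    case (real t)
    hence "t \<in> X" using that by (simp add: X_def)
    thus ?thesis using B[of t] real by (simp add: Phi_def le_max_iff_disj)
  next
    case PInf
    hence "r1 D = \<infinity>" using that by simp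
    thus ?thesis using below_r1 PInf by (simp add: le_max_iff_disj less_imp_le)
  qed (use that in auto)
  hence "bdd_above (Phi D ` {ereal (r0 D)..r1 D})" by (rule bdd_aboveI2)
  moreover have "ereal x \<in> {ereal (r0 D)..r1 D}" using x by (simp add: X_def)
  ultimately have "Phi D (ereal x) \<le> Phi_max D" unfolding Phi_max_def by (intro cSUP_upper)
  thus ?thesis by (simp add: Phi_def)
qed

text \<open>The real counterpart of \<open>Maxset D\<close>; nothing is lost because \<infinity> is
  not a maximum point.\<close>

definition peaks :: "real set" where "peaks = {x \<in> X. Phi_real D x = Phi_max D}"

lemma peaks_subset_U: "peaks \<subseteq> U"
proof
  fix x assume x: "x \<in> peaks"
  have "x \<noteq> r0 D" using x Phi_real_r0 by (auto simp: peaks_def)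
  moreover have "ereal x \<noteq> r1 D"
  proof
    assume "ereal x = r1 D"
    hence "Phi_real D x < Phi_max D" using below_r1 by (metis Phi_def PInfty_neq_ereal(1) real_of_ereal.simps(1))
    thus False using x by (simp add: peaks_def)
  qed
  ultimately show "x \<in> U" using x by (auto simp: peaks_def X_def U_def)
qed

lemma Maxset_eq: "Maxset D = ereal ` peaks"
proof (intro equalityI subsetI)
  fix y assume y: "y \<in> Maxset D"
  show "y \<in> ereal ` peaks"
  proof (cases y)
    case (real t)
    thus ?thesis using y by (auto simp: Maxset_def peaks_def X_def Phi_def)
  next
    case PInf
    hence "r1 D = \<infinity>" using y by (simp add: Maxset_def)
    thus ?thesis using below_r1 PInf y by (simp add: Maxset_def)
  qed (use y in \<open>auto simp: Maxset_def\<close>)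
qed (auto simp: Maxset_def peaks_def X_def Phi_def)

lemma peak_curvature: "x \<in> peaks \<Longrightarrow> phi_d2 x > 0"
  using nondegenerate[of "ereal x"] peaks_subset_U phi''_eq[of x] by (auto simp: Maxset_eq)

lemma phi_ge_peak:
  assumes "x0 \<in> peaks" "x \<in> X"
  shows "phi D x \<ge> phi D x0"
  using Phi_real_le_max[OF assms(2)] assms(1) Phi_real_pos[OF assms(2)] Phi_max_pos by (simp add: phi_def peaks_def)

lemma peak_critical:
  assumes "x0 \<in> peaks"
  shows "phi_d1 x0 = 0"
proof -
  have U: "x0 \<in> U" using assms peaks_subset_U by blast
  then obtain e where e: "e > 0" "ball x0 e \<subseteq> U" using open_U open_contains_ball by blast
  show ?thesis
  proof (rule DERIV_local_min[OF phi_deriv[OF U] e(1)], intro allI impI)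
    fix y assume "\<bar>x0 - y\<bar> < e"
    hence "y \<in> X" using e U_subset_X by (auto simp: dist_real_def)
    thus "phi D x0 \<le> phi D y" by (rule phi_ge_peak[OF assms])
  qed
qed

text \<open>Infinitely many peaks would accumulate in a compact interval, and the accumulation point
  would again be a peak, the set of peaks being closed. But the quadratic lower bound on the phase
  isolates every non-degenerate peak.\<close>

lemma finite_peaks: "finite peaks"
proof (rule ccontr)
  assume inf: "infinite peaks"
  obtain R q where R: "R \<in> X" "0 < q" "q < 1" "\<And>x. x \<in> X \<Longrightarrow> R \<le> x \<Longrightarrow> Phi_real D x \<le> q * Phi_max D"
    using tail_below_max by blast
  have "x \<in> {r0 D..R}" if x: "x \<in> peaks" for x
  proof (rule ccontr)
    assume "x \<notin> {r0 D..R}"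
    hence "Phi_real D x \<le> q * Phi_max D" using x by (intro R(4)) (auto simp: peaks_def X_def)
    also have "\<dots> < 1 * Phi_max D" using R(3) Phi_max_pos by (intro mult_strict_right_mono)
    finally show False using x by (simp add: peaks_def)
  qed
  hence sub: "peaks \<subseteq> {r0 D..R}" by blast
  then obtain x0 where x0: "x0 \<in> {r0 D..R}" "x0 islimpt peaks"
    using Heine_Borel_imp_Bolzano_Weierstrass[OF _ inf] compact_Icc by blast
  have "closed {x \<in> {r0 D..R}. Phi_real D x = Phi_max D}"
    by (intro continuous_closed_preimage_constant continuous_on_subset[OF continuous_on_Phi_real interval_subset_X[OF R(1)]]) auto
  also have "{x \<in> {r0 D..R}. Phi_real D x = Phi_max D} = peaks"
    using sub interval_subset_X[OF R(1)] by (auto simp: peaks_def)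
  finally have x0p: "x0 \<in> peaks" using x0(2) by (simp add: closed_limpt)
  have x0U: "x0 \<in> U" using x0p peaks_subset_U by blast
  obtain C e where Ce: "C \<ge> 0" "e > 0" "\<And>x. \<bar>x - x0\<bar> \<le> e \<Longrightarrow> x \<in> U \<and>
     \<bar>phi D x - phi D x0 - phi_d2 x0 / 2 * (x - x0)\<^sup>2\<bar> \<le> C * \<bar>x - x0\<bar> ^ 3 \<and>
     phi D x - phi D x0 \<ge> phi_d2 x0 / 4 * (x - x0)\<^sup>2"
    using phi_taylor[OF x0U peak_critical[OF x0p] peak_curvature[OF x0p]] by blast
  obtain y where y: "y \<in> peaks" "y \<noteq> x0" "dist y x0 < e"
    using x0(2) Ce(2) by (auto simp: islimpt_approachable)
  have "phi D y - phi D x0 \<ge> phi_d2 x0 / 4 * (y - x0)\<^sup>2" using Ce(3)[of y] y(3) by (simp add: dist_real_def)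
  moreover have "phi_d2 x0 / 4 * (y - x0)\<^sup>2 > 0" using peak_curvature[OF x0p] y(2) by simp
  moreover have "phi D y = phi D x0" using y(1) x0p by (simp add: peaks_def phi_def)
  ultimately show False by simp
qed

text \<open>Up to R a compact set remains when open balls around the peaks are removed, and on it
  the maximum of Phi is below \<open>Phi_max\<close>; beyond R the tail bound applies.\<close>

lemma far_below_max:
  assumes \<epsilon>: "\<epsilon> > 0"
  obtains q where "0 < q" "q < 1" "\<And>x. x \<in> X \<Longrightarrow> \<forall>x0\<in>peaks. \<epsilon> < \<bar>x - x0\<bar> \<Longrightarrow> Phi_real D x \<le> q * Phi_max D"
proof -
  obtain R q where R: "R \<in> X" "0 < q" "q < 1" "\<And>x. x \<in> X \<Longrightarrow> R \<le> x \<Longrightarrow> Phi_real D x \<le> q * Phi_max D"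
    using tail_below_max by blast
  define K where "K = {r0 D..R} - (\<Union>x0\<in>peaks. ball x0 \<epsilon>)"
  have K: "compact K" unfolding K_def by (intro compact_diff open_UN) auto
  have KX: "K \<subseteq> X" using interval_subset_X[OF R(1)] by (auto simp: K_def)
  have inK: "x \<in> K" if "x \<in> X" "\<forall>x0\<in>peaks. \<epsilon> < \<bar>x - x0\<bar>" "x \<le> R" for x
    using that by (force simp: K_def X_def dist_real_def)
  obtain q' where q': "0 < q'" "q' < 1" "\<And>x. x \<in> K \<Longrightarrow> Phi_real D x \<le> q' * Phi_max D"
  proof (cases "K = {}")
    case True
    with that[of "1 / 2"] show ?thesis by simp
  next
    case False
    obtain y where y: "y \<in> K" "\<And>x. x \<in> K \<Longrightarrow> Phi_real D x \<le> Phi_real D y"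
      using continuous_attains_sup[OF K False continuous_on_subset[OF continuous_on_Phi_real KX]] by blast
    have "y \<notin> peaks" using y(1) \<epsilon> by (auto simp: K_def)
    hence lt: "Phi_real D y < Phi_max D" using Phi_real_le_max[of y] y(1) KX by (auto simp: peaks_def order.order_iff_strict)
    show ?thesis
      by (rule that[of "Phi_real D y / Phi_max D"]) (use y KX lt Phi_max_pos Phi_real_pos[of y] in auto)
  qed
  show ?thesis
  proof (rule that[of "max q q'"])
    fix x assume x: "x \<in> X" "\<forall>x0\<in>peaks. \<epsilon> < \<bar>x - x0\<bar>"
    have "Phi_real D x \<le> q * Phi_max D \<or> Phi_real D x \<le> q' * Phi_max D"
      using R(4)[OF x(1)] q'(3)[OF inK[OF x]] by linarith
    moreover have "q * Phi_max D \<le> max q q' * Phi_max D" "q' * Phi_max D \<le> max q q' * Phi_max D"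
      using Phi_max_pos by (auto intro!: mult_right_mono)
    ultimately show "Phi_real D x \<le> max q q' * Phi_max D" by linarith
  qed (use R q' in auto)
qed

end

section \<open>Distance to the poles\<close>

lemma pole_dist_eq_1:
  assumes "Re w \<ge> 1"
  shows "pole_dist w = 1"
proof -
  have "1 \<le> infdist w \<int>\<^sub>\<le>\<^sub>0"
  proof (subst infdist_notempty[OF nonpos_Ints_nonempty], rule cINF_greatest[OF nonpos_Ints_nonempty])
    fix p :: complex assume "p \<in> \<int>\<^sub>\<le>\<^sub>0"
    hence "Re p \<le> 0" by (auto elim!: nonpos_Ints_cases)
    hence "1 \<le> Re (w - p)" using assms by simp
    also have "\<dots> \<le> dist w p" unfolding dist_norm by (rule complex_Re_le_cmod)
    finally show "1 \<le> dist w p" .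
  qed
  thus ?thesis by (simp add: pole_dist_def)
qed

text \<open>The distance from w to a pole a is the distance from \<alpha> to a - s m, a point of the
  lattice because -m \<le> -e. The constant takes care of the cap in \<open>pole_dist\<close>: where
  the weight is 1, the left side is still at most the distance to the lattice point - s e.\<close>

lemma infdist_shifted_lattice_le:
  fixes \<alpha> :: complex and s :: real and m :: int and e :: nat
  assumes m: "m \<ge> int e" and w: "w = \<alpha> + of_real s * of_int m"
  shows "infdist \<alpha> {of_int a + of_real s * of_int b | a b :: int. a \<le> 0 \<and> b \<le> - int e} \<le>
    (1 + norm \<alpha> + \<bar>s\<bar> * real e) * pole_dist w"
proof -
  let ?S = "{of_int a + of_real s * of_int b | a b :: int. a \<le> 0 \<and> b \<le> - int e} :: complex set"
  have le: "infdist \<alpha> ?S \<le> infdist w \<int>\<^sub>\<le>\<^sub>0"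
    unfolding infdist_notempty[OF nonpos_Ints_nonempty]
  proof (rule cINF_greatest[OF nonpos_Ints_nonempty])
    fix p :: complex assume "p \<in> \<int>\<^sub>\<le>\<^sub>0"
    then obtain a where a: "p = of_int a" "a \<le> 0" by (auto elim: nonpos_Ints_cases)
    have "of_int a + of_real s * of_int (- m) \<in> ?S"
      using a m by (intro CollectI exI[of _ a] exI[of _ "- m"]) auto
    from infdist_le[OF this, of \<alpha>] show "infdist \<alpha> ?S \<le> dist w p"
      by (simp add: w a dist_norm algebra_simps)
  qed
  have "of_int 0 + of_real s * of_int (- int e) \<in> ?S"
    by (intro CollectI exI[of _ 0] exI[of _ "- int e"]) auto
  from infdist_le[OF this, of \<alpha>] have "infdist \<alpha> ?S \<le> norm (\<alpha> + of_real s * of_nat e)"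
    by (simp add: dist_norm)
  also have "\<dots> \<le> norm \<alpha> + \<bar>s\<bar> * real e"
    by (rule order.trans[OF norm_triangle_ineq]) (simp add: norm_mult)
  finally have bd: "infdist \<alpha> ?S \<le> norm \<alpha> + \<bar>s\<bar> * real e" .
  show ?thesis
  proof (cases "infdist w \<int>\<^sub>\<le>\<^sub>0 \<ge> 1")
    case True
    thus ?thesis using bd by (simp add: pole_dist_def)
  next
    case False
    hence "pole_dist w = infdist w \<int>\<^sub>\<le>\<^sub>0" by (simp add: pole_dist_def)
    moreover have "1 * pole_dist w \<le> (1 + norm \<alpha> + \<bar>s\<bar> * real e) * pole_dist w" by (intro mult_right_mono) auto
    ultimately show ?thesis using le by simp
  qed
qed

section \<open>Pole weights against delta_0 and delta_1\<close>

context gamma_sum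
begin

lemma krange_X:
  assumes "n \<ge> 1" "k \<in> krange D n"
  shows "real k / real n \<in> X"
proof -
  have n: "real n > 0" using assms by simp
  have "r0 D * real n \<le> real k" using assms by (simp add: krange_def ceiling_le_iff)
  hence 1: "r0 D \<le> real k / real n" using n by (simp add: pos_le_divide_eq)
  have 2: "ereal (real k / real n) \<le> r1 D"
  proof (cases "r1 D")
    case (real r)
    hence "int k < \<lceil>r * real n\<rceil>" using assms by (simp add: krange_def)
    hence "real k < r * real n" by (simp add: less_ceiling_iff)
    thus ?thesis using n real by (simp add: pos_divide_le_eq)
  qed (use r0_less_r1 in auto)
  from 1 2 show ?thesis by (simp add: X_def)
qed

lemma norm_alp_at_le: "norm (alp_at D r i n) \<le> norm (alp D i) + \<bar>sig D i\<bar>"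
proof -
  have "\<bar>of_int \<lceil>r * real n\<rceil> - r * real n\<bar> \<le> 1" by linarith
  hence "\<bar>sig D i\<bar> * \<bar>of_int \<lceil>r * real n\<rceil> - r * real n\<bar> \<le> \<bar>sig D i\<bar> * 1" by (rule mult_left_mono) simp
  thus ?thesis unfolding alp_at_def
    by (intro order.trans[OF norm_triangle_ineq] add_mono order.refl) (simp only: norm_of_real abs_mult mult_1_right)
qed

text \<open>Common to both endpoints; A n is the part of the range on the side of r. Factors whose
  form vanishes at r are matched one by one with those of \<open>delta\<close>. The other forms are
  bounded below, so for large n their arguments have real part at least 1 and their weights are
  1.\<close>

lemma delta_le_pole_prod:
  fixes A :: "nat \<Rightarrow> nat set" and r :: ereal
  assumes at: "\<And>i n k. i \<in> I_at D r \<Longrightarrow> n \<ge> 1 \<Longrightarrow> k \<in> A n \<Longrightarrow> \<exists>m::int. m \<ge> int s \<and>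
      of_real (real n * lform D i (real k / real n)) + alp D i = alp_at D (real_of_ereal r) i n + of_real \<bar>sig D i\<bar> * of_int m"
    and away: "\<And>i. i \<in> Iset D - I_at D r \<Longrightarrow> \<exists>c>0. \<forall>n\<ge>1. \<forall>k\<in>A n. c \<le> lform D i (real k / real n)"
  shows "\<exists>B>0. \<exists>N. \<forall>n\<ge>N. \<forall>k\<in>A n. delta D s r n \<le> B * pole_prod n (real k / real n)"
proof -
  let ?w = "\<lambda>i n k. of_real (real n * lform D i (real k / real n)) + alp D i"
  let ?B = "\<lambda>i. 1 + norm (alp D i) + \<bar>sig D i\<bar> + \<bar>sig D i\<bar> * real s"
  let ?e = "\<lambda>i n. infdist (alp_at D (real_of_ereal r) i n)
     {of_int a + of_real \<bar>sig D i\<bar> * of_int b | a b :: int. a \<le> 0 \<and> b \<le> - int s}"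
  have sub: "I_at D r \<subseteq> Iset D" by (auto simp: I_at_def)
  have 1: "?e i n \<le> ?B i * pole_dist (?w i n k)" if i: "i \<in> I_at D r" and n: "n \<ge> 1" and k: "k \<in> A n" for i n k
  proof -
    obtain m :: int where m: "m \<ge> int s" "?w i n k = alp_at D (real_of_ereal r) i n + of_real \<bar>sig D i\<bar> * of_int m"
      using at[OF i n k] by blast
    have "?e i n \<le> (1 + norm (alp_at D (real_of_ereal r) i n) + \<bar>\<bar>sig D i\<bar>\<bar> * real s) * pole_dist (?w i n k)"
      by (rule infdist_shifted_lattice_le[OF m])
    also have "\<dots> \<le> ?B i * pole_dist (?w i n k)"
      using norm_alp_at_le[of "real_of_ereal r" i n] by (intro mult_right_mono) auto
    finally show ?thesis .
  qed
  have "\<forall>i\<in>Iset D - I_at D r. eventually (\<lambda>n. \<forall>k\<in>A n. pole_dist (?w i n k) = 1) sequentially"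
  proof
    fix i assume "i \<in> Iset D - I_at D r"
    then obtain c where c: "c > 0" "\<And>n k. n \<ge> 1 \<Longrightarrow> k \<in> A n \<Longrightarrow> c \<le> lform D i (real k / real n)" using away by blast
    have "eventually (\<lambda>n. real n * c \<ge> 1 + norm (alp D i)) sequentially" using c(1) by real_asymp
    thus "eventually (\<lambda>n. \<forall>k\<in>A n. pole_dist (?w i n k) = 1) sequentially"
      using eventually_ge_at_top[of 1]
    proof eventually_elim
      case (elim n)
      show ?case
      proof
        fix k assume k: "k \<in> A n"
        have "real n * c \<le> real n * lform D i (real k / real n)" using c(2)[OF elim(2) k] by (intro mult_left_mono) auto
        hence "Re (?w i n k) \<ge> 1" using elim(1) abs_Re_le_cmod[of "alp D i"] by simp
        thus "pole_dist (?w i n k) = 1" by (rule pole_dist_eq_1)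
      qed
    qed
  qed
  hence "eventually (\<lambda>n. \<forall>i\<in>Iset D - I_at D r. \<forall>k\<in>A n. pole_dist (?w i n k) = 1) sequentially"
    by (intro eventually_ball_finite finite_Diff finite_I)
  then obtain N where N: "\<And>n i k. n \<ge> N \<Longrightarrow> i \<in> Iset D - I_at D r \<Longrightarrow> k \<in> A n \<Longrightarrow> pole_dist (?w i n k) = 1"
    unfolding eventually_sequentially by blast
  have "delta D s r n \<le> (\<Prod>i\<in>I_at D r. ?B i) * pole_prod n (real k / real n)" if n: "n \<ge> max N 1" and k: "k \<in> A n" for n k
  proof -
    have "pole_prod n (real k / real n) = (\<Prod>i\<in>Iset D - I_at D r. pole_dist (?w i n k)) * (\<Prod>i\<in>I_at D r. pole_dist (?w i n k))"
      unfolding pole_prod_def by (rule prod.subset_diff[OF sub finite_I])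
    also have "(\<Prod>i\<in>Iset D - I_at D r. pole_dist (?w i n k)) = 1"
      by (rule prod.neutral) (use N n k in auto)
    finally have p: "pole_prod n (real k / real n) = (\<Prod>i\<in>I_at D r. pole_dist (?w i n k))" by simp
    have "delta D s r n \<le> (\<Prod>i\<in>I_at D r. ?e i n)" unfolding delta_def by (rule min.cobounded2)
    also have "\<dots> \<le> (\<Prod>i\<in>I_at D r. ?B i * pole_dist (?w i n k))"
      by (rule prod_mono) (use 1 n k in \<open>auto simp: infdist_nonneg\<close>)
    finally show ?thesis by (simp add: p prod.distrib)
  qed
  moreover have "(\<Prod>i\<in>I_at D r. ?B i) > 0" by (rule prod_pos) (auto intro!: add_pos_nonneg)
  ultimately show ?thesis by blast
qed

lemma U_nonempty: obtains xm where "xm \<in> U"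
proof -
  obtain q where "ereal (r0 D) < ereal q" "ereal q < r1 D" using ereal_dense2[OF r0_less_r1] by blast
  thus ?thesis by (intro that[of q]) (simp add: U_def)
qed

text \<open>A form vanishing at r_0 has positive slope, and n l_i(k/n) = \<sigma>_i (k - r_0 n).
  Writing k as the ceiling of r_0 n plus m splits this into the shift contained in
  \<open>alp_at\<close> and |\<sigma>_i| m with m \<ge> 0.\<close>

lemma delta0_le_pole_prod:
  assumes xm: "xm \<in> U"
  shows "\<exists>B>0. \<exists>N. \<forall>n\<ge>N. \<forall>k\<in>{k\<in>krange D n. real k / real n \<le> xm}. delta0 D n \<le> B * pole_prod n (real k / real n)"
  unfolding delta0_def
proof (rule delta_le_pole_prod)
  fix i and n k :: nat assume i: "i \<in> I_at D (ereal (r0 D))" and n: "n \<ge> 1"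
    and k: "k \<in> {k\<in>krange D n. real k / real n \<le> xm}"
  have i': "i \<in> Iset D" and l0: "sig D i * r0 D + lam D i = 0" using i by (auto simp: I_at_def lform_def)
  have "lform D i xm = sig D i * (xm - r0 D)" using l0 by (simp add: lform_def algebra_simps)
  hence s: "sig D i > 0" using lform_pos_U[OF xm i'] xm by (simp add: U_def zero_less_mult_iff)
  have lam: "lam D i = - (sig D i * r0 D)" using l0 by simp
  have "real n * lform D i (real k / real n) = sig D i * (real k - r0 D * real n)"
    using n by (simp add: lform_def lam field_simps)
  hence "real n * lform D i (real k / real n) = sig D i * (of_int \<lceil>r0 D * real n\<rceil> - r0 D * real n) + \<bar>sig D i\<bar> * of_int (int k - \<lceil>r0 D * real n\<rceil>)"
    using s by (simp add: algebra_simps)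
  hence "of_real (real n * lform D i (real k / real n)) + alp D i =
      alp_at D (real_of_ereal (ereal (r0 D))) i n + of_real \<bar>sig D i\<bar> * of_int (int k - \<lceil>r0 D * real n\<rceil>)"
    by (simp only: alp_at_def real_of_ereal.simps of_real_add of_real_mult of_real_of_int_eq) simp
  moreover have "int k - \<lceil>r0 D * real n\<rceil> \<ge> int 0" using k by (simp add: krange_def)
  ultimately show "\<exists>m::int. m \<ge> int 0 \<and> of_real (real n * lform D i (real k / real n)) + alp D i =
      alp_at D (real_of_ereal (ereal (r0 D))) i n + of_real \<bar>sig D i\<bar> * of_int m" by blast
next
  fix i assume i: "i \<in> Iset D - I_at D (ereal (r0 D))"
  hence "lform D i (r0 D) \<noteq> 0" by (simp add: I_at_def)
  moreover have "r0 D \<in> X" using r0_less_r1 by (simp add: X_def less_imp_le)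
  ultimately have l0: "lform D i (r0 D) > 0" using lform_nonneg[of "r0 D" i] i by auto
  have l1: "lform D i xm > 0" using lform_pos_U[OF xm] i by simp
  have "min (lform D i (r0 D)) (lform D i xm) \<le> lform D i (real k / real n)"
    if "n \<ge> 1" "k \<in> {k\<in>krange D n. real k / real n \<le> xm}" for n k
  proof -
    define x where "x = real k / real n"
    have x: "r0 D \<le> x" "x \<le> xm" using krange_X[OF that(1)] that(2) by (auto simp: X_def x_def)
    have "lform D i (r0 D) \<le> lform D i x \<or> lform D i xm \<le> lform D i x"
      using x by (cases "sig D i \<ge> 0") (auto simp: lform_def mult_left_mono mult_left_mono_neg)
    thus ?thesis by (auto simp: x_def min_le_iff_disj)
  qed
  thus "\<exists>c>0. \<forall>n\<ge>1. \<forall>k\<in>{k\<in>krange D n. real k / real n \<le> xm}. c \<le> lform D i (real k / real n)"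
    using l0 l1 by (intro exI[of _ "min (lform D i (r0 D)) (lform D i xm)"]) auto
qed

text \<open>Mirror image at r_1, where vanishing forms have negative slope and m counts down from
  the ceiling of r_1 n. The last index lies one below that ceiling, so m \<ge> 1; this is why the
  lattice of \<open>delta1\<close> starts at -1.\<close>

lemma delta1_le_pole_prod:
  assumes xm: "xm \<in> U"
  shows "\<exists>B>0. \<exists>N. \<forall>n\<ge>N. \<forall>k\<in>{k\<in>krange D n. xm \<le> real k / real n}. delta1 D n \<le> B * pole_prod n (real k / real n)"
  unfolding delta1_def
proof (rule delta_le_pole_prod)
  fix i and n k :: nat assume i: "i \<in> I_at D (r1 D)" and n: "n \<ge> 1"
    and k: "k \<in> {k\<in>krange D n. xm \<le> real k / real n}"
  obtain r where r: "r1 D = ereal r" using i r0_less_r1 by (cases "r1 D") (auto simp: I_at_def)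
  have i': "i \<in> Iset D" and l0: "sig D i * r + lam D i = 0" using i by (auto simp: I_at_def lform_def r)
  have "lform D i xm = (- sig D i) * (r - xm)" using l0 by (simp add: lform_def algebra_simps)
  hence s: "sig D i < 0" using lform_pos_U[OF xm i'] xm by (auto simp: U_def r zero_less_mult_iff mult_less_0_iff)
  have lam: "lam D i = - (sig D i * r)" using l0 by simp
  have "real n * lform D i (real k / real n) = sig D i * (real k - r * real n)"
    using n by (simp add: lform_def lam field_simps)
  hence "real n * lform D i (real k / real n) = sig D i * (of_int \<lceil>r * real n\<rceil> - r * real n) + \<bar>sig D i\<bar> * of_int (\<lceil>r * real n\<rceil> - int k)"
    using s by (simp add: algebra_simps)
  hence "of_real (real n * lform D i (real k / real n)) + alp D i =
      alp_at D (real_of_ereal (r1 D)) i n + of_real \<bar>sig D i\<bar> * of_int (\<lceil>r * real n\<rceil> - int k)"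
    by (simp only: r alp_at_def real_of_ereal.simps of_real_add of_real_mult of_real_of_int_eq) simp
  moreover have "\<lceil>r * real n\<rceil> - int k \<ge> int 1" using k by (simp add: krange_def r)
  ultimately show "\<exists>m::int. m \<ge> int 1 \<and> of_real (real n * lform D i (real k / real n)) + alp D i =
      alp_at D (real_of_ereal (r1 D)) i n + of_real \<bar>sig D i\<bar> * of_int m" by blast
next
  fix i assume i: "i \<in> Iset D - I_at D (r1 D)"
  have l1: "lform D i xm > 0" using lform_pos_U[OF xm] i by simp
  show "\<exists>c>0. \<forall>n\<ge>1. \<forall>k\<in>{k\<in>krange D n. xm \<le> real k / real n}. c \<le> lform D i (real k / real n)"
  proof (cases "r1 D")
    case (real r)
    have "lform D i r \<noteq> 0" using i real by (simp add: I_at_def)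
    moreover have "r \<in> X" using r0_less_r1 real by (simp add: X_def)
    ultimately have l0: "lform D i r > 0" using lform_nonneg[of r i] i by auto
    have "min (lform D i r) (lform D i xm) \<le> lform D i (real k / real n)"
      if "n \<ge> 1" "k \<in> {k\<in>krange D n. xm \<le> real k / real n}" for n k
    proof -
      define x where "x = real k / real n"
      have x: "x \<le> r" "xm \<le> x" using krange_X[OF that(1)] that(2) real by (auto simp: X_def x_def)
      have "lform D i r \<le> lform D i x \<or> lform D i xm \<le> lform D i x"
        using x by (cases "sig D i \<ge> 0") (auto simp: lform_def mult_left_mono mult_left_mono_neg)
      thus ?thesis by (auto simp: x_def min_le_iff_disj)
    qed
    thus ?thesis using l0 l1 by (intro exI[of _ "min (lform D i r) (lform D i xm)"]) auto
  next
    case PInf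
    \<comment> \<open>All forms increase on an unbounded interval, so the value at xm is a lower
      bound to the right of it.\<close>
    have "sig D i > 0" using sig_pos[OF PInf] i by simp
    hence "lform D i xm \<le> lform D i x" if "xm \<le> x" for x using that by (simp add: lform_def)
    thus ?thesis using l1 by (intro exI[of _ "lform D i xm"]) auto
  qed (use r0_less_r1 in simp)
qed

text \<open>An interior point splits the range; each half is controlled by the delta of its own
  endpoint, and the sum of the two reciprocals covers both.\<close>

lemma inverse_pole_prod_le:
  assumes generic: "\<And>n. n \<ge> 1 \<Longrightarrow> delta0 D n > 0 \<and> delta1 D n > 0"
  shows "\<exists>B>0. \<exists>N. \<forall>n\<ge>N. \<forall>k\<in>krange D n. pole_prod n (real k / real n) > 0 \<and>
     inverse (pole_prod n (real k / real n)) \<le> B * (inverse (delta0 D n) + inverse (delta1 D n))"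
proof -
  obtain xm where xm: "xm \<in> U" using U_nonempty by blast
  obtain B0 N0 where B0: "B0 > 0" "\<And>n k. n \<ge> N0 \<Longrightarrow> k \<in> krange D n \<Longrightarrow> real k / real n \<le> xm \<Longrightarrow>
      delta0 D n \<le> B0 * pole_prod n (real k / real n)"
    using delta0_le_pole_prod[OF xm] by blast
  obtain B1 N1 where B1: "B1 > 0" "\<And>n k. n \<ge> N1 \<Longrightarrow> k \<in> krange D n \<Longrightarrow> xm \<le> real k / real n \<Longrightarrow>
      delta1 D n \<le> B1 * pole_prod n (real k / real n)"
    using delta1_le_pole_prod[OF xm] by blast
  have *: "p > 0 \<and> inverse p \<le> b * inverse d" if "0 < d" "d \<le> b * p" "b > 0" for d b p :: real
  proof -
    have p: "p > 0" using that by (metis less_le_trans zero_less_mult_pos)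
    with that show ?thesis by (simp add: field_simps)
  qed
  have "pole_prod n (real k / real n) > 0 \<and>
     inverse (pole_prod n (real k / real n)) \<le> max B0 B1 * (inverse (delta0 D n) + inverse (delta1 D n))"
    if n: "n \<ge> max (max N0 N1) 1" and k: "k \<in> krange D n" for n k
  proof -
    have d: "delta0 D n > 0" "delta1 D n > 0" using generic n by auto
    have up: "B0 * inverse (delta0 D n) \<le> max B0 B1 * (inverse (delta0 D n) + inverse (delta1 D n))"
      "B1 * inverse (delta1 D n) \<le> max B0 B1 * (inverse (delta0 D n) + inverse (delta1 D n))"
      using d B0(1) B1(1) by (auto intro!: mult_mono)
    show ?thesis
    proof (cases "real k / real n \<le> xm")
      case True
      from *[OF d(1) B0(2)[OF _ k True] B0(1)] n up(1) show ?thesis by auto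
    next
      case False
      from *[OF d(2) B1(2)[OF _ k] B1(1)] n up(2) False show ?thesis by auto
    qed
  qed
  thus ?thesis using B0(1) by (intro exI[of _ "max B0 B1"] conjI exI[of _ "max (max N0 N1) 1"]) auto
qed

section \<open>Size of the polynomial weight\<close>

lemma weight_eq:
  "weight n x = (\<Prod>i\<in>Iset D. (real n * lform D i x + 1) powr (Re (alp D i) - 1 / 2)) *
     (\<Prod>j\<in>Jset D. (real n * mform D j x + 1) powr (- (Re (bet D j) - 1 / 2)))"
  by (simp only: weight_def powr_minus_divide prod_dividef prod.neutral_const times_divide_eq_right mult_1_right)

text \<open>For k \<le> R n the weight is polynomial in n. The factor (1 + k)^(-s) is inserted at
  the price of n^s, which gives this bound the same shape as the one in the tail.\<close>

lemma weight_bounded_region: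
  fixes R s :: real
  assumes s: "s \<ge> 0"
  shows "\<exists>K>0. \<exists>A. \<forall>n\<ge>1. \<forall>k. real k / real n \<in> X \<longrightarrow> real k / real n \<le> R \<longrightarrow>
     weight n (real k / real n) \<le> K * real n powr A * (1 + real k) powr (- s)"
proof -
  let ?p = "\<lambda>i. Re (alp D i) - 1 / 2" and ?q = "\<lambda>j. Re (bet D j) - 1 / 2"
  define BI where "BI = (\<lambda>i. \<bar>sig D i\<bar> * \<bar>R\<bar> + \<bar>lam D i\<bar>)"
  define BJ where "BJ = (\<lambda>j. \<bar>tau D j\<bar> * \<bar>R\<bar> + \<bar>mu D j\<bar>)"
  \<comment> \<open>The extra 1 yields n l + 1 \<le> B n for every form value l and every n \<ge>
    1.\<close>
  define B where "B = 1 + sum BI (Iset D) + sum BJ (Jset D)"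
  have nn: "BI i \<ge> 0" "BJ j \<ge> 0" for i j by (auto simp: BI_def BJ_def)
  have B1: "B \<ge> 1" using sum_nonneg[of "Iset D" BI] sum_nonneg[of "Jset D" BJ] nn by (simp add: B_def)
  have BI: "BI i \<le> B - 1" if "i \<in> Iset D" for i
    using member_le_sum[of i "Iset D" BI] that nn finite_I sum_nonneg[of "Jset D" BJ] by (simp add: B_def)
  have BJ: "BJ j \<le> B - 1" if "j \<in> Jset D" for j
    using member_le_sum[of j "Jset D" BJ] that nn finite_J sum_nonneg[of "Iset D" BI] by (simp add: B_def)
  define P where "P = (\<Sum>i\<in>Iset D. \<bar>?p i\<bar>) + (\<Sum>j\<in>Jset D. \<bar>?q j\<bar>)"
  have "weight n x \<le> B powr P * (1 + \<bar>R\<bar>) powr s * real n powr (P + s) * (1 + real k) powr (- s)"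
    if n: "n \<ge> 1" and x: "x \<in> X" "x \<le> R" and xk: "x = real k / real n" for n k x
  proof -
    have n1: "real n \<ge> 1" using n by simp
    have ax: "\<bar>x\<bar> \<le> \<bar>R\<bar>" using x r0_nonneg by (auto simp: X_def)
    have fac: "(real n * l + 1) powr p \<le> (B * real n) powr \<bar>p\<bar>" if l: "0 \<le> l" "l \<le> B - 1" for l p
    proof -
      have "real n * l + 1 \<le> real n * (B - 1) + real n" using l n1 by (intro add_mono mult_left_mono) auto
      hence y: "real n * l + 1 \<le> B * real n" by (simp add: algebra_simps)
      have y1: "1 \<le> real n * l + 1" using l by simp
      have "(real n * l + 1) powr p \<le> (real n * l + 1) powr \<bar>p\<bar>" using y1 by (intro powr_mono) auto
      also have "\<dots> \<le> (B * real n) powr \<bar>p\<bar>" using y y1 by (intro powr_mono2) auto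
      finally show ?thesis .
    qed
    have lb: "lform D i x \<le> BI i" for i
    proof -
      have "sig D i * x \<le> \<bar>sig D i\<bar> * \<bar>x\<bar>" by (metis abs_ge_self abs_mult)
      also have "\<dots> \<le> \<bar>sig D i\<bar> * \<bar>R\<bar>" using ax by (rule mult_left_mono) simp
      finally show ?thesis using abs_ge_self[of "lam D i"] by (simp add: lform_def BI_def)
    qed
    have mb: "mform D j x \<le> BJ j" for j
    proof -
      have "tau D j * x \<le> \<bar>tau D j\<bar> * \<bar>x\<bar>" by (metis abs_ge_self abs_mult)
      also have "\<dots> \<le> \<bar>tau D j\<bar> * \<bar>R\<bar>" using ax by (rule mult_left_mono) simp
      finally show ?thesis using abs_ge_self[of "mu D j"] by (simp add: mform_def BJ_def)
    qed
    have Bn: "B * real n > 0" using B1 n1 by simp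
    have "weight n x = (\<Prod>i\<in>Iset D. (real n * lform D i x + 1) powr ?p i) * (\<Prod>j\<in>Jset D. (real n * mform D j x + 1) powr (- ?q j))"
      by (rule weight_eq)
    also have "\<dots> \<le> (\<Prod>i\<in>Iset D. (B * real n) powr \<bar>?p i\<bar>) * (\<Prod>j\<in>Jset D. (B * real n) powr \<bar>- ?q j\<bar>)"
    proof (rule mult_mono)
      show "(\<Prod>i\<in>Iset D. (real n * lform D i x + 1) powr ?p i) \<le> (\<Prod>i\<in>Iset D. (B * real n) powr \<bar>?p i\<bar>)"
        by (rule prod_mono, rule conjI[OF powr_ge_zero], rule fac) (use lform_nonneg[OF x(1)] lb BI order.trans in blast)+
      show "(\<Prod>j\<in>Jset D. (real n * mform D j x + 1) powr (- ?q j)) \<le> (\<Prod>j\<in>Jset D. (B * real n) powr \<bar>- ?q j\<bar>)"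
        by (rule prod_mono, rule conjI[OF powr_ge_zero], rule fac) (use mform_nonneg[OF x(1)] mb BJ order.trans in blast)+
    qed (auto intro: prod_nonneg)
    also have "\<dots> = (B * real n) powr P"
      using Bn by (simp only: P_def abs_minus_cancel powr_add powr_sum)
    also have "\<dots> = B powr P * real n powr P" using B1 by (simp add: powr_mult)
    also have "\<dots> \<le> B powr P * real n powr P * (((1 + \<bar>R\<bar>) * real n) powr s * (1 + real k) powr (- s))"
    proof -
      have "real k = x * real n" using n1 xk by simp
      also have "\<dots> \<le> \<bar>R\<bar> * real n" using ax by (intro mult_right_mono) auto
      finally have "real k \<le> \<bar>R\<bar> * real n" .
      hence "1 + real k \<le> (1 + \<bar>R\<bar>) * real n" using n1 by (simp add: algebra_simps)
      hence "(1 + real k) powr s \<le> ((1 + \<bar>R\<bar>) * real n) powr s" using s by (intro powr_mono2) auto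
      hence "(1 + real k) powr s * (1 + real k) powr (- s) \<le> ((1 + \<bar>R\<bar>) * real n) powr s * (1 + real k) powr (- s)"
        by (rule mult_right_mono) simp
      moreover have "(1 + real k) powr s * (1 + real k) powr (- s) = 1" by (simp flip: powr_add)
      ultimately have "B powr P * real n powr P * 1 \<le> B powr P * real n powr P * (((1 + \<bar>R\<bar>) * real n) powr s * (1 + real k) powr (- s))"
        by (intro mult_left_mono) auto
      thus ?thesis by simp
    qed
    finally show ?thesis by (simp add: powr_mult powr_add mult_ac)
  qed
  moreover have "B powr P * (1 + \<bar>R\<bar>) powr s > 0" using B1 by auto
  ultimately show ?thesis by blast
qed

text \<open>For large k/n the constant part |l| n is at most half of s k, and 1 is at most k. Hence
  n times the form plus 1 is comparable with k, with constants free of n.\<close>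

lemma affine_comparable:
  fixes s l :: real
  assumes "s > 0"
  shows "eventually (\<lambda>R. \<forall>n\<ge>1. \<forall>k. R \<le> real k / real n \<longrightarrow> 0 < real k \<and> 0 < real n * (s * (real k / real n) + l) + 1 \<and>
     real n * (s * (real k / real n) + l) + 1 \<le> max (3 * s / 2 + 1) (2 / s) * real k \<and>
     real k \<le> max (3 * s / 2 + 1) (2 / s) * (real n * (s * (real k / real n) + l) + 1)) at_top"
  using eventually_ge_at_top[of "max 1 (2 * \<bar>l\<bar> / s)"]
proof eventually_elim
  case (elim R)
  show ?case
  proof (intro allI impI)
    fix n k :: nat assume n: "n \<ge> 1" and "R \<le> real k / real n"
    hence x: "max 1 (2 * \<bar>l\<bar> / s) \<le> real k / real n" using elim by linarith
    have n1: "real n \<ge> 1" using n by simp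
    hence k: "real n \<le> real k" "2 * \<bar>l\<bar> / s * real n \<le> real k" using x by (auto simp: pos_le_divide_eq)
    have l: "\<bar>l\<bar> * real n \<le> s / 2 * real k" using k(2) assms by (simp add: field_simps)
    define y where "y = real n * (s * (real k / real n) + l) + 1"
    have y: "y = s * real k + l * real n + 1" using n1 by (simp add: y_def field_simps)
    have ln: "- (\<bar>l\<bar> * real n) \<le> l * real n" "l * real n \<le> \<bar>l\<bar> * real n"
      by (metis abs_ge_minus_self abs_mult abs_of_nat minus_le_iff mult_minus_left, simp add: mult_right_mono)
    define z where "z = s * real k"
    have z: "s / 2 * real k = z / 2" "(3 * s / 2 + 1) * real k = 3 * z / 2 + real k"
      by (simp_all add: z_def algebra_simps)
    have y1: "y \<ge> s / 2 * real k" "y \<le> (3 * s / 2 + 1) * real k"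
      using ln l k(1) n1 unfolding y z z_def[symmetric] by linarith+
    have kpos: "real k > 0" using k n1 by simp
    have ypos: "y > 0" using y1(1) kpos assms by (smt (verit) mult_pos_pos half_gt_zero)
    have "real k \<le> 2 / s * y" using y1(1) assms by (simp add: field_simps)
    also have "\<dots> \<le> max (3 * s / 2 + 1) (2 / s) * y" using ypos by (intro mult_right_mono) auto
    finally have a: "real k \<le> max (3 * s / 2 + 1) (2 / s) * y" .
    have "(3 * s / 2 + 1) * real k \<le> max (3 * s / 2 + 1) (2 / s) * real k"
      by (intro mult_right_mono) auto
    with y1(2) have "y \<le> max (3 * s / 2 + 1) (2 / s) * real k" by (rule order.trans)
    with a kpos ypos show "0 < real k \<and> 0 < real n * (s * (real k / real n) + l) + 1 \<and>
     real n * (s * (real k / real n) + l) + 1 \<le> max (3 * s / 2 + 1) (2 / s) * real k \<and>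
     real k \<le> max (3 * s / 2 + 1) (2 / s) * (real n * (s * (real k / real n) + l) + 1)"
      unfolding y_def by blast
  qed
qed

text \<open>In the tail every factor is a power of k up to constants, and the exponents add up to
  \<open>Re (gam D)\<close>.\<close>

lemma weight_tail:
  assumes inf: "r1 D = \<infinity>"
  shows "\<exists>K>0. eventually (\<lambda>R. \<forall>n\<ge>1. \<forall>k. R \<le> real k / real n \<longrightarrow> weight n (real k / real n) \<le> K * real k powr Re (gam D)) at_top"
proof -
  let ?p = "\<lambda>i. Re (alp D i) - 1 / 2" and ?q = "\<lambda>j. Re (bet D j) - 1 / 2"
  define C where "C = (\<lambda>s::real. max (3 * s / 2 + 1) (2 / s))"
  define K where "K = (\<Prod>i\<in>Iset D. C (sig D i) powr \<bar>?p i\<bar>) * (\<Prod>j\<in>Jset D. C (tau D j) powr \<bar>- ?q j\<bar>)"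
  have Cpos: "C s > 0" if "s > 0" for s using that by (simp add: C_def less_max_iff_disj)
  have "K > 0" unfolding K_def
    by (intro mult_pos_pos prod_pos) (use Cpos[OF sig_pos[OF inf]] Cpos[OF tau_pos[OF inf]] in force)+
  moreover have "eventually (\<lambda>R. \<forall>n\<ge>1. \<forall>k. R \<le> real k / real n \<longrightarrow> weight n (real k / real n) \<le> K * real k powr Re (gam D)) at_top"
  proof -
    have I: "eventually (\<lambda>R. \<forall>i\<in>Iset D. \<forall>n\<ge>1. \<forall>k. R \<le> real k / real n \<longrightarrow> 0 < real k \<and> 0 < real n * lform D i (real k / real n) + 1 \<and>
      real n * lform D i (real k / real n) + 1 \<le> C (sig D i) * real k \<and>
      real k \<le> C (sig D i) * (real n * lform D i (real k / real n) + 1)) at_top"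
      unfolding C_def lform_def by (intro eventually_ball_finite finite_I ballI affine_comparable sig_pos[OF inf])
    have J: "eventually (\<lambda>R. \<forall>j\<in>Jset D. \<forall>n\<ge>1. \<forall>k. R \<le> real k / real n \<longrightarrow> 0 < real k \<and> 0 < real n * mform D j (real k / real n) + 1 \<and>
      real n * mform D j (real k / real n) + 1 \<le> C (tau D j) * real k \<and>
      real k \<le> C (tau D j) * (real n * mform D j (real k / real n) + 1)) at_top"
      unfolding C_def mform_def by (intro eventually_ball_finite finite_J ballI affine_comparable tau_pos[OF inf])
    show ?thesis using I J eventually_gt_at_top[of 0]
    proof eventually_elim
      case (elim R)
      show ?case
      proof (intro allI impI)
        fix n k :: nat assume n: "n \<ge> 1" and R: "R \<le> real k / real n"
        have kpos: "real k > 0" using R elim(3) by (cases "k = 0") auto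
        let ?x = "real k / real n"
        have fI: "(real n * lform D i ?x + 1) powr ?p i \<le> C (sig D i) powr \<bar>?p i\<bar> * real k powr ?p i" if "i \<in> Iset D" for i
          by (rule powr_compare) (use elim(1) that n R in blast)+
        have fJ: "(real n * mform D j ?x + 1) powr (- ?q j) \<le> C (tau D j) powr \<bar>- ?q j\<bar> * real k powr (- ?q j)" if "j \<in> Jset D" for j
          by (rule powr_compare) (use elim(2) that n R in blast)+
        have "weight n ?x = (\<Prod>i\<in>Iset D. (real n * lform D i ?x + 1) powr ?p i) * (\<Prod>j\<in>Jset D. (real n * mform D j ?x + 1) powr (- ?q j))"
          by (rule weight_eq)
        also have "\<dots> \<le> (\<Prod>i\<in>Iset D. C (sig D i) powr \<bar>?p i\<bar> * real k powr ?p i) * (\<Prod>j\<in>Jset D. C (tau D j) powr \<bar>- ?q j\<bar> * real k powr (- ?q j))"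
        proof (rule mult_mono)
          show "(\<Prod>i\<in>Iset D. (real n * lform D i ?x + 1) powr ?p i) \<le> (\<Prod>i\<in>Iset D. C (sig D i) powr \<bar>?p i\<bar> * real k powr ?p i)"
            by (rule prod_mono, rule conjI[OF powr_ge_zero], rule fI)
          show "(\<Prod>j\<in>Jset D. (real n * mform D j ?x + 1) powr (- ?q j)) \<le> (\<Prod>j\<in>Jset D. C (tau D j) powr \<bar>- ?q j\<bar> * real k powr (- ?q j))"
            by (rule prod_mono, rule conjI[OF powr_ge_zero], rule fJ)
        qed (auto intro: prod_nonneg)
        also have "\<dots> = K * ((\<Prod>i\<in>Iset D. real k powr ?p i) * (\<Prod>j\<in>Jset D. real k powr (- ?q j)))"
          unfolding K_def prod.distrib by (simp only: mult_ac)
        also have "(\<Prod>i\<in>Iset D. real k powr ?p i) * (\<Prod>j\<in>Jset D. real k powr (- ?q j)) = real k powr (sum ?p (Iset D) + (\<Sum>j\<in>Jset D. - ?q j))"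
          using kpos by (simp only: powr_add powr_sum)
        also have "sum ?p (Iset D) + (\<Sum>j\<in>Jset D. - ?q j) = Re (gam D)"
          by (simp add: gam_def sum_subtractf sum_negf diff_divide_distrib)
        finally show "weight n ?x \<le> K * real k powr Re (gam D)" .
      qed
    qed
  qed
  ultimately show ?thesis by blast
qed

end

section \<open>Near and far contributions\<close>

lemma norm_of_nat_powr: "n \<ge> 1 \<Longrightarrow> norm (of_nat n powr w :: complex) = real n powr Re w"
  by (simp add: powr_def Ln_of_nat)

context gamma_sum
begin

lemma U_krange:
  assumes "n \<ge> 1" "real k / real n \<in> U"
  shows "k \<in> krange D n"
proof -
  have n: "real n > 0" using assms by simp
  have "r0 D * real n < real k" using assms(2) n by (simp add: U_def pos_less_divide_eq)
  hence 1: "\<lceil>r0 D * real n\<rceil> \<le> int k" by (simp add: ceiling_le_iff)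
  have 2: "int k \<le> \<lceil>real_of_ereal (r1 D) * real n\<rceil> - 1" if ninf: "r1 D \<noteq> \<infinity>"
  proof -
    obtain r where r: "r1 D = ereal r" using ninf r0_less_r1 by (cases "r1 D") auto
    have "real k < r * real n" using assms(2) n r by (simp add: U_def pos_divide_less_eq)
    hence "int k < \<lceil>r * real n\<rceil>" by (simp add: less_ceiling_iff)
    thus ?thesis by (simp add: r)
  qed
  from 1 2 show ?thesis by (simp add: krange_def)
qed

lemma affine_lower_bound:
  fixes a b x0 e x :: real
  assumes "\<bar>x - x0\<bar> \<le> e"
  shows "min (a * (x0 - e) + b) (a * (x0 + e) + b) \<le> a * x + b"
proof -
  have x: "x0 - e \<le> x" "x \<le> x0 + e" using assms by linarith+
  have "a * (x0 - e) \<le> a * x \<or> a * (x0 + e) \<le> a * x"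
  proof (cases "a \<ge> 0")
    case True
    with x(1) show ?thesis by (intro disjI1 mult_left_mono)
  next
    case False
    with x(2) show ?thesis by (intro disjI2 mult_left_mono_neg) auto
  qed
  thus ?thesis by auto
qed

text \<open>The arguments are at least c n, so the relative error C/t of Stirling's formula is
  O(1/n) uniformly in k.\<close>

lemma Gamma_ratio_near_one:
  fixes l :: "real \<Rightarrow> real" and A :: "nat \<Rightarrow> nat set"
  assumes c: "c > 0" and l: "\<And>n k. n \<ge> 1 \<Longrightarrow> k \<in> A n \<Longrightarrow> c \<le> l (real k / real n)"
  shows "\<exists>C N. \<forall>n\<ge>N. \<forall>k\<in>A n. norm (Gamma_ratio \<alpha> (real n * l (real k / real n)) - 1) \<le> C / real n"
proof -
  obtain C T where CT: "C > 0" "T > 0" "\<And>t. t \<ge> T \<Longrightarrow> norm (Gamma_ratio \<alpha> t - 1) \<le> C / t"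
    using Gamma_ratio_asymp[of \<alpha>] by blast
  obtain M :: nat where M: "real M \<ge> T / c" using real_arch_simple by blast
  have "norm (Gamma_ratio \<alpha> (real n * l (real k / real n)) - 1) \<le> (C / c) / real n"
    if n: "n \<ge> max M 1" and k: "k \<in> A n" for n k
  proof -
    have n1: "n \<ge> 1" "real n \<ge> T / c" using n M by auto
    have "real n * c \<le> real n * l (real k / real n)" using l[OF n1(1) k] by (intro mult_left_mono) auto
    moreover have "T \<le> real n * c" using n1(2) c by (simp add: pos_divide_le_eq)
    ultimately have t: "T \<le> real n * l (real k / real n)" "real n * c \<le> real n * l (real k / real n)" by auto
    have "norm (Gamma_ratio \<alpha> (real n * l (real k / real n)) - 1) \<le> C / (real n * l (real k / real n))"
      by (rule CT(3)[OF t(1)])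
    also have "\<dots> \<le> C / (real n * c)" using t(2) CT(1) c n1(1) by (intro divide_left_mono mult_pos_pos) auto
    finally show ?thesis by (simp add: mult.commute)
  qed
  thus ?thesis by blast
qed

lemma Gamma_ratios_near_one:
  assumes "x0 - e \<in> U" "x0 + e \<in> U"
  shows "\<exists>C N. \<forall>n\<ge>N. \<forall>k\<in>{k. \<bar>real k / real n - x0\<bar> \<le> e}.
    norm ((\<Prod>i\<in>Iset D. Gamma_ratio (alp D i) (real n * lform D i (real k / real n))) *
      (\<Prod>j\<in>Jset D. inverse (Gamma_ratio (bet D j) (real n * mform D j (real k / real n)))) - 1) \<le> C / real n"
proof -
  let ?A = "\<lambda>n. {k. \<bar>real k / real n - x0\<bar> \<le> e}"
  let ?I = "\<lambda>n k. \<Prod>i\<in>Iset D. Gamma_ratio (alp D i) (real n * lform D i (real k / real n))"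
  let ?J = "\<lambda>n k. \<Prod>j\<in>Jset D. inverse (Gamma_ratio (bet D j) (real n * mform D j (real k / real n)))"
  have I: "\<exists>C N. \<forall>n\<ge>N. \<forall>k\<in>?A n. norm (?I n k - 1) \<le> C / real n"
  proof (rule prod_near_one[OF finite_I])
    fix i assume i: "i \<in> Iset D"
    show "\<exists>C N. \<forall>n\<ge>N. \<forall>k\<in>?A n. norm (Gamma_ratio (alp D i) (real n * lform D i (real k / real n)) - 1) \<le> C / real n"
      by (rule Gamma_ratio_near_one[where c = "min (lform D i (x0 - e)) (lform D i (x0 + e))"])
         (use lform_pos_U[OF _ i] assms in \<open>auto simp only: lform_def min_less_iff_conj mem_Collect_eq intro!: affine_lower_bound\<close>)
  qed
  have J: "\<exists>C N. \<forall>n\<ge>N. \<forall>k\<in>?A n. norm (?J n k - 1) \<le> C / real n"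
  proof (rule prod_near_one[OF finite_J], rule inverse_near_one)
    fix j assume j: "j \<in> Jset D"
    show "\<exists>C N. \<forall>n\<ge>N. \<forall>k\<in>?A n. norm (Gamma_ratio (bet D j) (real n * mform D j (real k / real n)) - 1) \<le> C / real n"
      by (rule Gamma_ratio_near_one[where c = "min (mform D j (x0 - e)) (mform D j (x0 + e))"])
         (use mform_pos_U[OF _ j] assms in \<open>auto simp only: mform_def min_less_iff_conj mem_Collect_eq intro!: affine_lower_bound\<close>)
  qed
  \<comment> \<open>the product of the two factors, as a product over \<open>bool\<close>\<close>
  have "\<exists>C N. \<forall>n\<ge>N. \<forall>k\<in>?A n. norm ((\<Prod>b\<in>(UNIV :: bool set). if b then ?I n k else ?J n k) - 1) \<le> C / real n"
  proof (rule prod_near_one[OF finite, where f = "\<lambda>b n k. if b then ?I n k else ?J n k"])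
    fix b :: bool
    show "\<exists>C N. \<forall>n\<ge>N. \<forall>k\<in>?A n. norm ((if b then ?I n k else ?J n k) - 1) \<le> C / real n"
      by (cases b) (simp_all only: if_True if_False I J)
  qed
  moreover have "(\<Prod>b\<in>(UNIV :: bool set). if b then p else q) = p * q" for p q :: complex
    by (simp add: UNIV_bool mult.commute)
  ultimately show ?thesis by (simp only:)
qed

end

section \<open>Summands near the peaks and far from them\<close>

context gamma_sum_peak
begin

text \<open>The size of a single summand at a peak, up to \<open>ufun\<close>. The missing factor
  n^(1/2) of the expansion comes from the roughly sqrt n indices under one Gaussian.\<close>

definition prefactor :: "nat \<Rightarrow> complex" where
  "prefactor n = of_nat n powr gam D * of_real ((real n / exp 1) powr (nu D * real n)) * of_real (Phi_max D ^ n)"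

lemma norm_prefactor:
  "n \<ge> 1 \<Longrightarrow> norm (prefactor n) = real n powr Re (gam D) * (real n / exp 1) powr (nu D * real n) * Phi_max D ^ n"
  using Phi_max_pos by (simp add: prefactor_def norm_mult norm_of_nat_powr norm_power)

lemma prefactor_nonzero: "n \<ge> 1 \<Longrightarrow> prefactor n \<noteq> 0"
  using Phi_max_pos by (auto simp: prefactor_def)

text \<open>Divided by \<open>prefactor n\<close>, a summand is u(x) exp (- n (phi x - phi x0))
  times a product of Gamma ratios that is 1 + O(1/n), so \<open>laplace_sum\<close> applies. The
  claim is made for all small \<epsilon> so that one radius can serve every peak.\<close>

lemma near_peak_sum:
  assumes x0: "x0 \<in> peaks"
  shows "\<exists>e0>0. \<forall>\<epsilon>. 0 < \<epsilon> \<longrightarrow> \<epsilon> < e0 \<longrightarrow> cball x0 \<epsilon> \<subseteq> U \<and>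
     (\<exists>C N. \<forall>n\<ge>N. finite {k::nat. \<bar>real k / real n - x0\<bar> \<le> \<epsilon>} \<and>
      norm ((\<Sum>k | \<bar>real k / real n - x0\<bar> \<le> \<epsilon>. summand n k / prefactor n) - of_real (sqrt (2 * pi * real n / phi_d2 x0)) * ufun D x0) \<le> C)"
proof -
  have x0U: "x0 \<in> U" using x0 peaks_subset_U by blast
  have a: "phi_d2 x0 > 0" by (rule peak_curvature[OF x0])
  obtain C1 e1 where e1: "C1 \<ge> 0" "e1 > 0" "\<And>x. \<bar>x - x0\<bar> \<le> e1 \<Longrightarrow> x \<in> U \<and>
     \<bar>phi D x - phi D x0 - phi_d2 x0 / 2 * (x - x0)\<^sup>2\<bar> \<le> C1 * \<bar>x - x0\<bar> ^ 3 \<and>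
     phi D x - phi D x0 \<ge> phi_d2 x0 / 4 * (x - x0)\<^sup>2"
    using phi_taylor[OF x0U peak_critical[OF x0] a] by blast
  obtain C2 e2 where e2: "C2 \<ge> 0" "e2 > 0" "\<And>x. \<bar>x - x0\<bar> \<le> e2 \<Longrightarrow> norm (ufun D x - ufun D x0) \<le> C2 * \<bar>x - x0\<bar>"
    using ufun_lipschitz[OF x0U] by blast
  have main: "cball x0 \<epsilon> \<subseteq> U \<and>
     (\<exists>C N. \<forall>n\<ge>N. finite {k::nat. \<bar>real k / real n - x0\<bar> \<le> \<epsilon>} \<and>
      norm ((\<Sum>k | \<bar>real k / real n - x0\<bar> \<le> \<epsilon>. summand n k / prefactor n) - of_real (sqrt (2 * pi * real n / phi_d2 x0)) * ufun D x0) \<le> C)"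
    if \<epsilon>: "0 < \<epsilon>" "\<epsilon> < min e1 e2" for \<epsilon>
  proof -
    have inU: "x \<in> U" if "\<bar>x - x0\<bar> \<le> \<epsilon>" for x using e1(3)[of x] that \<epsilon> by simp
    have cb: "cball x0 \<epsilon> \<subseteq> U" using inU by (auto simp: dist_real_def abs_minus_commute)
    have endp: "x0 - \<epsilon> \<in> U" "x0 + \<epsilon> \<in> U" using \<epsilon> by (auto intro!: inU)
    \<comment> \<open>The window stays within the nonnegative numbers because r_0 \<ge> 0.\<close>
    have \<epsilon>x: "\<epsilon> \<le> x0" using endp(1) r0_nonneg by (simp add: U_def)
    obtain C3 N3 where C3: "\<And>n k. n \<ge> N3 \<Longrightarrow> \<bar>real k / real n - x0\<bar> \<le> \<epsilon> \<Longrightarrow>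
      norm ((\<Prod>i\<in>Iset D. Gamma_ratio (alp D i) (real n * lform D i (real k / real n))) *
      (\<Prod>j\<in>Jset D. inverse (Gamma_ratio (bet D j) (real n * mform D j (real k / real n)))) - 1) \<le> C3 / real n"
      using Gamma_ratios_near_one[OF endp] by blast
    \<comment> \<open>An upper bound for |\<open>ufun D\<close>| on the window.\<close>
    define B where "B = norm (ufun D x0) + C2 * \<epsilon>"
    have B0: "B \<ge> 0" using e2 \<epsilon> by (simp add: B_def)
    define C where "C = max (max C1 C2) (\<bar>C3\<bar> * B)"
    have C: "C \<ge> 0" "C1 \<le> C" "C2 \<le> C" "\<bar>C3\<bar> * B \<le> C" using e1(1) by (auto simp: C_def)
    have "\<exists>C'. \<forall>n\<ge>max N3 1. norm ((\<Sum>k | \<bar>real k / real n - x0\<bar> \<le> \<epsilon>. summand n k / prefactor n) -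
       of_real (sqrt (2 * pi * real n / phi_d2 x0)) * ufun D x0) \<le> C'"
    proof (rule laplace_sum[OF a \<epsilon>(1) \<epsilon>x C(1), where \<phi> = "\<lambda>x. phi D x - phi D x0"])
      fix x assume x: "\<bar>x - x0\<bar> \<le> \<epsilon>"
      have x1: "\<bar>x - x0\<bar> \<le> e1" "\<bar>x - x0\<bar> \<le> e2" using x \<epsilon> by auto
      show "norm (ufun D x - ufun D x0) \<le> C * \<bar>x - x0\<bar>"
        by (rule order.trans[OF e2(3)[OF x1(2)]]) (use C in \<open>intro mult_right_mono; simp\<close>)
      show "\<bar>phi D x - phi D x0 - phi_d2 x0 / 2 * (x - x0)\<^sup>2\<bar> \<le> C * \<bar>x - x0\<bar> ^ 3"
        by (rule order.trans[OF conjunct1[OF conjunct2[OF e1(3)[OF x1(1)]]]]) (use C in \<open>intro mult_right_mono; simp\<close>)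
      show "phi_d2 x0 / 4 * (x - x0)\<^sup>2 \<le> phi D x - phi D x0" using e1(3)[OF x1(1)] by blast
    next
      fix n k :: nat assume n: "n \<ge> max N3 1" and k: "\<bar>real k / real n - x0\<bar> \<le> \<epsilon>"
      define x where "x = real k / real n"
      define R where "R = (\<Prod>i\<in>Iset D. Gamma_ratio (alp D i) (real n * lform D i x)) *
        (\<Prod>j\<in>Jset D. inverse (Gamma_ratio (bet D j) (real n * mform D j x)))"
      define E where "E = exp (- real n * (phi D x - phi D x0))"
      have n1: "n \<ge> 1" using n by simp
      have xU: "x \<in> U" using inU k by (simp add: x_def)
      have Phipos: "Phi_real D x > 0" using Phi_real_pos xU U_subset_X by blast
      have "exp (- (phi D x - phi D x0)) = Phi_real D x / Phi_max D"
        using Phipos Phi_max_pos x0 by (simp add: phi_def peaks_def exp_diff)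
      hence E: "E = (Phi_real D x / Phi_max D) ^ n"
        unfolding E_def by (metis exp_of_nat_mult mult_minus_left mult_minus_right)
      have "summand n k = R * (of_nat n powr gam D * of_real ((real n / exp 1) powr (nu D * real n)) * ufun D x * of_real (Phi_real D x ^ n))"
        unfolding R_def by (rule summand_eq[OF n1 x_def]) (use lform_pos_U mform_pos_U xU in auto)
      also have "Phi_real D x ^ n = Phi_max D ^ n * E" using Phi_max_pos by (simp add: E power_divide)
      finally have "summand n k = R * ufun D x * of_real E * prefactor n" by (simp add: prefactor_def mult_ac)
      hence s: "summand n k / prefactor n = R * ufun D x * of_real E" using prefactor_nonzero[OF n1] by simp
      have "summand n k / prefactor n - ufun D x * of_real E = (R - 1) * ufun D x * of_real E" unfolding s by (simp add: algebra_simps)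
      hence "norm (summand n k / prefactor n - ufun D x * of_real E) = norm (R - 1) * norm (ufun D x) * E"
        by (simp add: norm_mult E_def)
      also have "\<dots> \<le> (\<bar>C3\<bar> / real n) * B * E"
      proof (intro mult_right_mono mult_mono)
        have "norm (R - 1) \<le> C3 / real n" unfolding R_def x_def by (rule C3) (use n k in auto)
        also have "\<dots> \<le> \<bar>C3\<bar> / real n" by (intro divide_right_mono) auto
        finally show "norm (R - 1) \<le> \<bar>C3\<bar> / real n" .
        have "norm (ufun D x) \<le> norm (ufun D x0) + norm (ufun D x - ufun D x0)" by (rule norm_triangle_sub)
        also have "norm (ufun D x - ufun D x0) \<le> C2 * \<bar>x - x0\<bar>" by (rule e2(3)) (use k \<epsilon> in \<open>simp add: x_def\<close>)
        also have "\<dots> \<le> C2 * \<epsilon>" using k e2(1) by (intro mult_left_mono) (auto simp: x_def)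
        finally show "norm (ufun D x) \<le> B" by (simp add: B_def)
      qed (auto simp: E_def)
      also have "\<dots> = (\<bar>C3\<bar> * B) / real n * E" by simp
      also have "\<dots> \<le> C / real n * E" using C(4) by (intro mult_right_mono divide_right_mono) (auto simp: E_def)
      finally show "norm (summand n k / prefactor n - ufun D (real k / real n) * of_real (exp (- real n * (phi D (real k / real n) - phi D x0))))
        \<le> C / real n * exp (- real n * (phi D (real k / real n) - phi D x0))"
        by (simp only: E_def x_def)
    qed simp
    then obtain C' where C': "\<And>n. n \<ge> max N3 1 \<Longrightarrow> norm ((\<Sum>k | \<bar>real k / real n - x0\<bar> \<le> \<epsilon>. summand n k / prefactor n) -
       of_real (sqrt (2 * pi * real n / phi_d2 x0)) * ufun D x0) \<le> C'" by blast
    have fin: "finite {k::nat. \<bar>real k / real n - x0\<bar> \<le> \<epsilon>}" if n: "n \<ge> 1" for n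
    proof (rule finite_subset)
      show "{k::nat. \<bar>real k / real n - x0\<bar> \<le> \<epsilon>} \<subseteq> {..nat \<lceil>real n * (x0 + \<epsilon>)\<rceil>}"
      proof
        fix k assume "k \<in> {k::nat. \<bar>real k / real n - x0\<bar> \<le> \<epsilon>}"
        hence "real k / real n \<le> x0 + \<epsilon>" by (simp add: abs_le_iff)
        hence "real k \<le> real n * (x0 + \<epsilon>)" using n by (simp add: pos_divide_le_eq mult.commute)
        thus "k \<in> {..nat \<lceil>real n * (x0 + \<epsilon>)\<rceil>}" by simp linarith
      qed
    qed simp
    from cb C' fin show ?thesis by (intro conjI exI[of _ C'] exI[of _ "max N3 1"]) auto
  qed
  show ?thesis using main e1(2) e2(2) by (intro exI[of _ "min e1 e2"]) auto
qed

text \<open>In the tail n_0 of the n factors Phi are bounded by C x^(-c) with x = k/n and the others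
  by q * \<open>Phi_max D\<close>. This turns k^(Re gam) into k^(-s) with s > 1 at the price of n^(c
  n_0). Below R the bound on the weight already carries (1 + k)^(-s). Q stands for being far from
  all peaks.\<close>

lemma weight_Phi_far:
  assumes q: "0 < q" and Q: "\<And>x. x \<in> X \<Longrightarrow> Q x \<Longrightarrow> Phi_real D x \<le> q * Phi_max D"
  shows "\<exists>K>0. \<exists>A. \<exists>s>1. \<exists>N. \<forall>n\<ge>N. \<forall>k. real k / real n \<in> X \<longrightarrow> Q (real k / real n) \<longrightarrow>
     weight n (real k / real n) * Phi_real D (real k / real n) ^ n \<le> K * real n powr A * (q * Phi_max D) ^ n * (1 + real k) powr (- s)"
proof -
  define p where "p = q * Phi_max D"
  have p: "p > 0" using q Phi_max_pos by (simp add: p_def)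
  have "\<exists>R K A s. \<exists>N. K > 0 \<and> s > 1 \<and> (\<forall>n\<ge>N. \<forall>k. real k / real n \<in> X \<longrightarrow> Q (real k / real n) \<longrightarrow> R < real k / real n \<longrightarrow>
     weight n (real k / real n) * Phi_real D (real k / real n) ^ n \<le> K * real n powr A * p ^ n * (1 + real k) powr (- s))"
  proof (cases "r1 D")
    case (real r)
    \<comment> \<open>For finite r_1 nothing lies beyond R = r_1.\<close>
    show ?thesis
      by (rule exI[of _ r], rule exI[of _ 1], rule exI[of _ 0], rule exI[of _ 2]) (auto simp: X_def real)
  next
    case PInf
    obtain C R1 c n0 where d: "C > 0" "R1 \<ge> 1" "c \<ge> 0" "Re (gam D) - c * real n0 < -1"
      "\<And>x. x \<ge> R1 \<Longrightarrow> Phi_real D x \<le> C * x powr (- c)"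
      using Phi_real_decay[OF PInf] by blast
    obtain K where K: "K > 0" "eventually (\<lambda>R. \<forall>n\<ge>1. \<forall>k. R \<le> real k / real n \<longrightarrow> weight n (real k / real n) \<le> K * real k powr Re (gam D)) at_top"
      using weight_tail[OF PInf] by blast
    then obtain R2 where R2: "\<And>n k. n \<ge> 1 \<Longrightarrow> R2 \<le> real k / real n \<Longrightarrow> weight n (real k / real n) \<le> K * real k powr Re (gam D)"
      unfolding eventually_at_top_linorder by blast
    define s where "s = c * real n0 - Re (gam D)"
    define K' where "K' = K * C ^ n0 * inverse p ^ n0 * 2 powr s"
    have s: "s > 1" using d(4) by (simp add: s_def)
    have K': "K' > 0" using K(1) d(1) p by (simp add: K'_def)
    have tail: "weight n x * Phi_real D x ^ n \<le> K' * real n powr (c * real n0) * p ^ n * (1 + real k) powr (- s)"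
      if n: "n \<ge> max n0 1" and x: "x = real k / real n" "x \<in> X" "Q x" "max R1 R2 < x" for n k x
    proof -
      have n1: "n \<ge> 1" "n \<ge> n0" "real n > 0" using n by auto
      have x1: "x \<ge> 1" "R1 \<le> x" "R2 \<le> x" using x(4) d(2) by auto
      have kn: "real k = x * real n" using x(1) n1 by simp
      have "1 * 1 \<le> x * real n" using x1 n1 by (intro mult_mono) auto
      hence k1: "real k \<ge> 1" by (simp add: kn)
      have \<Phi>: "Phi_real D x \<ge> 0" using Phi_real_pos[OF x(2)] by simp
      have w: "weight n x \<le> K * real k powr Re (gam D)" using R2[OF n1(1)] x1 x(1) by simp
      have "x powr (- c) = real k powr (- c) * real n powr c"
        using k1 n1 by (simp add: x(1) powr_divide powr_minus divide_simps)
      hence "(x powr (- c)) ^ n0 = real k powr (- (c * real n0)) * real n powr (c * real n0)"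
        using k1 n1 by (simp add: power_mult_distrib powr_power mult.commute)
      hence e: "(C * x powr (- c)) ^ n0 = C ^ n0 * (real k powr (- (c * real n0)) * real n powr (c * real n0))"
        by (simp add: power_mult_distrib)
      \<comment> \<open>The first n_0 factors are traded for decay in k, the rest keeps the
        exponential gain.\<close>
      have "Phi_real D x ^ n = Phi_real D x ^ n0 * Phi_real D x ^ (n - n0)"
        using n1(2) by (simp flip: power_add)
      also have "\<dots> \<le> (C * x powr (- c)) ^ n0 * p ^ (n - n0)"
        using \<Phi> d(5)[OF x1(2)] Q[OF x(2,3)] d(1) p by (intro mult_mono power_mono) (auto simp: p_def)
      also have "p ^ (n - n0) = p ^ n * inverse p ^ n0"
        using p n1(2) by (simp add: power_diff power_inverse divide_inverse)
      finally have ph: "Phi_real D x ^ n \<le> C ^ n0 * (real k powr (- (c * real n0)) * real n powr (c * real n0)) * (p ^ n * inverse p ^ n0)"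
        by (simp only: e)
      have "weight n x * Phi_real D x ^ n \<le> (K * real k powr Re (gam D)) *
         (C ^ n0 * (real k powr (- (c * real n0)) * real n powr (c * real n0)) * (p ^ n * inverse p ^ n0))"
        using K(1) \<Phi> by (intro mult_mono w ph) auto
      also have "\<dots> = K * C ^ n0 * inverse p ^ n0 * real n powr (c * real n0) * p ^ n * (real k powr Re (gam D) * real k powr (- (c * real n0)))"
        by (simp only: mult_ac)
      also have "real k powr Re (gam D) * real k powr (- (c * real n0)) = real k powr (- s)"
        by (simp add: s_def flip: powr_add)
      also have "K * C ^ n0 * inverse p ^ n0 * real n powr (c * real n0) * p ^ n * real k powr (- s) \<le>
        K * C ^ n0 * inverse p ^ n0 * real n powr (c * real n0) * p ^ n * (2 powr \<bar>- s\<bar> * (real k + 1) powr (- s))"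
        using K(1) d(1) p by (intro mult_left_mono powr_shift_compare k1) auto
      also have "\<dots> = K' * real n powr (c * real n0) * p ^ n * (1 + real k) powr (- s)"
        using s by (simp add: K'_def add.commute mult_ac)
      finally show ?thesis .
    qed
    have F: "\<forall>n\<ge>max n0 1. \<forall>k. real k / real n \<in> X \<longrightarrow> Q (real k / real n) \<longrightarrow> max R1 R2 < real k / real n \<longrightarrow>
       weight n (real k / real n) * Phi_real D (real k / real n) ^ n \<le> K' * real n powr (c * real n0) * p ^ n * (1 + real k) powr (- s)"
      by (intro allI impI tail refl)
    show ?thesis
      by (rule exI[of _ "max R1 R2"], rule exI[of _ K'], rule exI[of _ "c * real n0"],
          rule exI[of _ s], rule exI[of _ "max n0 1"]) (intro conjI K' s F)
  qed (use r0_less_r1 in simp)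
  then obtain R K2 A2 s N where T: "K2 > 0" "s > 1" "\<And>n k. n \<ge> N \<Longrightarrow> real k / real n \<in> X \<Longrightarrow> Q (real k / real n) \<Longrightarrow> R < real k / real n \<Longrightarrow>
     weight n (real k / real n) * Phi_real D (real k / real n) ^ n \<le> K2 * real n powr A2 * p ^ n * (1 + real k) powr (- s)" by blast
  obtain K1 A1 where W: "K1 > 0" "\<And>n k. n \<ge> 1 \<Longrightarrow> real k / real n \<in> X \<Longrightarrow> real k / real n \<le> R \<Longrightarrow>
     weight n (real k / real n) \<le> K1 * real n powr A1 * (1 + real k) powr (- s)"
    using weight_bounded_region[of s R] T(2) by force
  have "weight n x * Phi_real D x ^ n \<le> max K1 K2 * real n powr max A1 A2 * p ^ n * (1 + real k) powr (- s)"
    if n: "n \<ge> max N 1" and x: "x = real k / real n" "x \<in> X" "Q x" for n k x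
  proof -
    have n1: "real n \<ge> 1" using n by simp
    have up: "a * real n powr A * p ^ n * (1 + real k) powr (- s) \<le> max K1 K2 * real n powr max A1 A2 * p ^ n * (1 + real k) powr (- s)"
      if "0 < a" "a \<le> max K1 K2" "A \<le> max A1 A2" for a A
      using that n1 p by (intro mult_right_mono mult_mono powr_mono) auto
    show ?thesis
    proof (cases "x \<le> R")
      case True
      have "weight n x * Phi_real D x ^ n \<le> (K1 * real n powr A1 * (1 + real k) powr (- s)) * p ^ n"
        using W n x True Q[OF x(2,3)] Phi_real_pos[OF x(2)] by (intro mult_mono power_mono) (auto simp: p_def)
      also have "\<dots> = K1 * real n powr A1 * p ^ n * (1 + real k) powr (- s)" by simp
      also note up[OF W(1)]
      finally show ?thesis by simp
    next
      case False
      have "weight n x * Phi_real D x ^ n \<le> K2 * real n powr A2 * p ^ n * (1 + real k) powr (- s)"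
        unfolding x(1) by (rule T(3)) (use n x False in auto)
      also note up[OF T(1)]
      finally show ?thesis by simp
    qed
  qed
  hence "\<forall>n\<ge>max N 1. \<forall>k. real k / real n \<in> X \<longrightarrow> Q (real k / real n) \<longrightarrow>
     weight n (real k / real n) * Phi_real D (real k / real n) ^ n \<le> max K1 K2 * real n powr max A1 A2 * p ^ n * (1 + real k) powr (- s)"
    by blast
  moreover have "max K1 K2 > 0" using W(1) by (simp add: less_max_iff_disj)
  ultimately show ?thesis using T(2) unfolding p_def by blast
qed

definition far :: "real \<Rightarrow> nat \<Rightarrow> nat set" where
  "far \<epsilon> n = {k \<in> krange D n. \<forall>x0\<in>peaks. \<epsilon> < \<bar>real k / real n - x0\<bar>}"

text \<open>The bound on a summand is divided by its pole weight, and this is how the two deltas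
  come in. Everything is uniform in k except for (1 + k)^(-s), whose sum is finite; the same
  majorant gives summability.\<close>

lemma far_sum:
  assumes \<epsilon>: "\<epsilon> > 0"
  shows "\<exists>K>0. \<exists>A q N. 0 < q \<and> q < 1 \<and> (\<forall>n\<ge>N. summand n summable_on far \<epsilon> n \<and>
    norm (infsum (summand n) (far \<epsilon> n)) \<le> K * (inverse (delta0 D n) + inverse (delta1 D n)) *
      ((real n / exp 1) powr (nu D * real n) * real n powr A * (q * Phi_max D) ^ n))"
proof -
  let ?\<delta> = "\<lambda>n. inverse (delta0 D n) + inverse (delta1 D n)"
  obtain q where q: "0 < q" "q < 1" "\<And>x. x \<in> X \<Longrightarrow> \<forall>x0\<in>peaks. \<epsilon> < \<bar>x - x0\<bar> \<Longrightarrow> Phi_real D x \<le> q * Phi_max D"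
    using far_below_max[OF \<epsilon>] by blast
  obtain K1 A s N1 where W: "K1 > 0" "s > 1" "\<And>n k. n \<ge> N1 \<Longrightarrow> real k / real n \<in> X \<Longrightarrow> \<forall>x0\<in>peaks. \<epsilon> < \<bar>real k / real n - x0\<bar> \<Longrightarrow>
     weight n (real k / real n) * Phi_real D (real k / real n) ^ n \<le> K1 * real n powr A * (q * Phi_max D) ^ n * (1 + real k) powr (- s)"
    using weight_Phi_far[OF q(1), of "\<lambda>x. \<forall>x0\<in>peaks. \<epsilon> < \<bar>x - x0\<bar>"] q(3) by force
  obtain K2 where K2: "K2 > 0" "\<And>n k. n \<ge> 1 \<Longrightarrow> real k / real n \<in> X \<Longrightarrow> norm (summand n k) * pole_prod n (real k / real n) \<le>
       K2 * weight n (real k / real n) * ((real n / exp 1) powr (nu D * real n) * Phi_real D (real k / real n) ^ n)"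
    using norm_summand_le by blast
  obtain B N2 where B: "B > 0" "\<And>n k. n \<ge> N2 \<Longrightarrow> k \<in> krange D n \<Longrightarrow> pole_prod n (real k / real n) > 0 \<and>
     inverse (pole_prod n (real k / real n)) \<le> B * ?\<delta> n"
    using inverse_pole_prod_le[OF generic] by blast
  define M where "M = (\<lambda>n. K1 * K2 * B * ?\<delta> n * ((real n / exp 1) powr (nu D * real n) * real n powr A * (q * Phi_max D) ^ n))"
  have bd: "norm (summand n k) \<le> M n * (1 + real k) powr (- s)" if n: "n \<ge> max (max N1 N2) 1" and k: "k \<in> far \<epsilon> n" for n k
  proof -
    define x where "x = real k / real n"
    have k': "k \<in> krange D n" "\<forall>x0\<in>peaks. \<epsilon> < \<bar>x - x0\<bar>" using k by (auto simp: far_def x_def)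
    have n': "n \<ge> N1" "n \<ge> N2" "n \<ge> 1" using n by auto
    have x: "x \<in> X" using krange_X[OF n'(3) k'(1)] by (simp add: x_def)
    have pp: "pole_prod n x > 0" "inverse (pole_prod n x) \<le> B * ?\<delta> n" using B(2)[OF n'(2) k'(1)] by (auto simp: x_def)
    have d: "?\<delta> n > 0" using generic[OF n'(3)] by (simp add: add_pos_pos)
    \<comment> \<open>The pole weight is positive by genericness.\<close>
    have "norm (summand n k) = norm (summand n k) * pole_prod n x * inverse (pole_prod n x)" using pp(1) by simp
    also have "\<dots> \<le> (K2 * weight n x * ((real n / exp 1) powr (nu D * real n) * Phi_real D x ^ n)) * (B * ?\<delta> n)"
    proof (rule mult_mono[OF _ pp(2)])
      show le: "norm (summand n k) * pole_prod n x \<le> K2 * weight n x * ((real n / exp 1) powr (nu D * real n) * Phi_real D x ^ n)"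
        using K2(2)[OF n'(3), of k] x by (simp add: x_def)
      show "0 \<le> K2 * weight n x * ((real n / exp 1) powr (nu D * real n) * Phi_real D x ^ n)"
        by (rule order.trans[OF _ le]) (use pp(1) in simp)
    qed (use pp(1) in simp)
    also have "\<dots> = K2 * B * ?\<delta> n * (real n / exp 1) powr (nu D * real n) * (weight n x * Phi_real D x ^ n)"
      by (simp only: mult_ac)
    also have "\<dots> \<le> K2 * B * ?\<delta> n * (real n / exp 1) powr (nu D * real n) * (K1 * real n powr A * (q * Phi_max D) ^ n * (1 + real k) powr (- s))"
      using W(3)[OF n'(1), of k] x k'(2) K2(1) B(1) d by (intro mult_left_mono) (auto simp: x_def[symmetric])
    also have "\<dots> = M n * (1 + real k) powr (- s)" by (simp only: M_def mult_ac)
    finally show ?thesis .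
  qed
  define g where "g = (\<lambda>k::nat. (1 + real k) powr (- s))"
  \<comment> \<open>The convergent p-series, shifted by one index so that k = 0 contributes
    1.\<close>
  have "summable (\<lambda>k. real (Suc k) powr (- s))"
    using W(2) by (subst summable_Suc_iff[of "\<lambda>k. real k powr (- s)"]) (simp add: summable_real_powr_iff)
  hence "summable g" by (simp add: g_def add.commute)
  hence g: "g summable_on UNIV" by (subst summable_on_UNIV_nonneg_real_iff) (auto simp: g_def)
  hence gF: "g summable_on F" for F by (rule summable_on_subset_banach) simp
  define Z where "Z = infsum g UNIV"
  have Z: "Z \<ge> 0" unfolding Z_def by (rule infsum_nonneg) (simp add: g_def)
  have "summand n summable_on far \<epsilon> n \<and> norm (infsum (summand n) (far \<epsilon> n)) \<le> (K1 * K2 * B * (Z + 1)) * ?\<delta> n *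
      ((real n / exp 1) powr (nu D * real n) * real n powr A * (q * Phi_max D) ^ n)"
    if n: "n \<ge> max (max N1 N2) 1" for n
  proof -
    have d: "?\<delta> n > 0" using generic[of n] n by (simp add: add_pos_pos)
    have M: "M n \<ge> 0" unfolding M_def using W(1) K2(1) B(1) d q(1) Phi_max_pos
      by (intro mult_nonneg_nonneg) auto
    have Mg: "(\<lambda>k. M n * g k) summable_on far \<epsilon> n" by (rule summable_on_cmult_right[OF gF])
    have abs: "(\<lambda>k. norm (summand n k)) summable_on far \<epsilon> n"
      by (rule summable_on_comparison_test[OF Mg]) (use bd[OF n] in \<open>auto simp: g_def\<close>)
    have "norm (infsum (summand n) (far \<epsilon> n)) \<le> infsum (\<lambda>k. norm (summand n k)) (far \<epsilon> n)"
      by (rule norm_infsum_bound[OF abs])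
    also have "\<dots> \<le> infsum (\<lambda>k. M n * g k) (far \<epsilon> n)"
      by (rule infsum_mono[OF abs Mg]) (use bd[OF n] in \<open>auto simp: g_def\<close>)
    also have "\<dots> = M n * infsum g (far \<epsilon> n)" by (rule infsum_cmult_right) (rule gF)
    also have "\<dots> \<le> M n * (Z + 1)"
    proof (rule mult_left_mono[OF _ M])
      have "infsum g (far \<epsilon> n) \<le> Z" unfolding Z_def
        by (rule infsum_mono_neutral[OF gF g]) (auto simp: g_def)
      thus "infsum g (far \<epsilon> n) \<le> Z + 1" by simp
    qed
    finally show ?thesis using abs_summable_summable[OF abs] by (simp add: M_def mult_ac)
  qed
  moreover have "K1 * K2 * B * (Z + 1) > 0" using W(1) K2(1) B(1) Z by simp
  ultimately show ?thesis using q(1,2) by blast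
qed

end

section \<open>Assembly of the expansion\<close>

context gamma_sum_peak
begin

text \<open>Each requirement holds for all sufficiently small positive \<epsilon>, and there are
  finitely many peaks, so the filter \<open>at_right 0\<close> provides a common choice.\<close>

lemma peaks_isolating_radius:
  obtains \<epsilon> where "\<epsilon> > 0" "\<And>x0. x0 \<in> peaks \<Longrightarrow> cball x0 \<epsilon> \<subseteq> U"
    "\<And>x0 y0. x0 \<in> peaks \<Longrightarrow> y0 \<in> peaks \<Longrightarrow> x0 \<noteq> y0 \<Longrightarrow> 2 * \<epsilon> < \<bar>x0 - y0\<bar>"
    "\<And>x0. x0 \<in> peaks \<Longrightarrow> \<exists>C N. \<forall>n\<ge>N. finite {k::nat. \<bar>real k / real n - x0\<bar> \<le> \<epsilon>} \<and>
      norm ((\<Sum>k | \<bar>real k / real n - x0\<bar> \<le> \<epsilon>. summand n k / prefactor n) - of_real (sqrt (2 * pi * real n / phi_d2 x0)) * ufun D x0) \<le> C"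
proof -
  let ?P = "\<lambda>x0 \<epsilon>. cball x0 \<epsilon> \<subseteq> U \<and> (\<exists>C N. \<forall>n\<ge>N. finite {k::nat. \<bar>real k / real n - x0\<bar> \<le> \<epsilon>} \<and>
      norm ((\<Sum>k | \<bar>real k / real n - x0\<bar> \<le> \<epsilon>. summand n k / prefactor n) - of_real (sqrt (2 * pi * real n / phi_d2 x0)) * ufun D x0) \<le> C)"
  have "eventually (?P x0) (at_right 0)" if "x0 \<in> peaks" for x0
    using near_peak_sum[OF that] unfolding eventually_at_right_field by blast
  hence 1: "eventually (\<lambda>\<epsilon>. \<forall>x0\<in>peaks. ?P x0 \<epsilon>) (at_right 0)"
    by (intro eventually_ball_finite finite_peaks) blast
  have "eventually (\<lambda>\<epsilon>. x0 \<noteq> y0 \<longrightarrow> 2 * \<epsilon> < \<bar>x0 - y0\<bar>) (at_right 0)" for x0 y0 :: real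
    unfolding eventually_at_right_field
    by (cases "x0 = y0") (auto intro: exI[of _ 1] exI[of _ "\<bar>x0 - y0\<bar> / 2"])
  hence 2: "eventually (\<lambda>\<epsilon>. \<forall>x0\<in>peaks. \<forall>y0\<in>peaks. x0 \<noteq> y0 \<longrightarrow> 2 * \<epsilon> < \<bar>x0 - y0\<bar>) (at_right (0::real))"
    by (intro eventually_ball_finite finite_peaks ballI)
  have 3: "eventually (\<lambda>\<epsilon>::real. \<epsilon> > 0) (at_right 0)" by (rule eventually_at_right_less)
  have "eventually (\<lambda>\<epsilon>. (\<forall>x0\<in>peaks. ?P x0 \<epsilon>) \<and> (\<forall>x0\<in>peaks. \<forall>y0\<in>peaks. x0 \<noteq> y0 \<longrightarrow> 2 * \<epsilon> < \<bar>x0 - y0\<bar>) \<and> 0 < \<epsilon>) (at_right 0)"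
    by (intro eventually_conj 1 2 3)
  from eventually_happens'[OF _ this] obtain \<epsilon> where \<epsilon>: "\<forall>x0\<in>peaks. ?P x0 \<epsilon>"
    "\<forall>x0\<in>peaks. \<forall>y0\<in>peaks. x0 \<noteq> y0 \<longrightarrow> 2 * \<epsilon> < \<bar>x0 - y0\<bar>" "0 < \<epsilon>" by auto
  show ?thesis
  proof (rule that[of \<epsilon>])
    fix x0 assume "x0 \<in> peaks"
    with \<epsilon>(1) have "?P x0 \<epsilon>" by (rule bspec)
    thus "cball x0 \<epsilon> \<subseteq> U" and "\<exists>C N. \<forall>n\<ge>N. finite {k::nat. \<bar>real k / real n - x0\<bar> \<le> \<epsilon>} \<and>
      norm ((\<Sum>k | \<bar>real k / real n - x0\<bar> \<le> \<epsilon>. summand n k / prefactor n) - of_real (sqrt (2 * pi * real n / phi_d2 x0)) * ufun D x0) \<le> C"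
      by (rule conjunct1, rule conjunct2)
  qed (use \<epsilon>(2,3) in blast)+
qed

text \<open>The windows lie over the open interval, hence inside the range of summation, and the
  separation by more than 2 \<epsilon> makes them disjoint; the rest of the range is
  \<open>far\<close>.\<close>

lemma gsum_eq_near_plus_far:
  assumes n: "n \<ge> 1" and \<epsilon>: "\<And>x0. x0 \<in> peaks \<Longrightarrow> cball x0 \<epsilon> \<subseteq> U"
    and sep: "\<And>x0 y0. x0 \<in> peaks \<Longrightarrow> y0 \<in> peaks \<Longrightarrow> x0 \<noteq> y0 \<Longrightarrow> 2 * \<epsilon> < \<bar>x0 - y0\<bar>"
    and fin: "\<And>x0. x0 \<in> peaks \<Longrightarrow> finite {k::nat. \<bar>real k / real n - x0\<bar> \<le> \<epsilon>}"
    and far: "summand n summable_on far \<epsilon> n"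
  shows "gsum D n = (\<Sum>x0\<in>peaks. \<Sum>k | \<bar>real k / real n - x0\<bar> \<le> \<epsilon>. summand n k) + infsum (summand n) (far \<epsilon> n)"
proof -
  let ?N = "\<lambda>x0. {k::nat. \<bar>real k / real n - x0\<bar> \<le> \<epsilon>}"
  have sub: "?N x0 \<subseteq> krange D n" if x0: "x0 \<in> peaks" for x0
  proof
    fix k assume "k \<in> ?N x0"
    hence "real k / real n \<in> cball x0 \<epsilon>" by (simp add: dist_real_def abs_minus_commute)
    hence "real k / real n \<in> U" using \<epsilon>[OF x0] by blast
    thus "k \<in> krange D n" by (rule U_krange[OF n])
  qed
  have split: "krange D n = (\<Union>x0\<in>peaks. ?N x0) \<union> far \<epsilon> n"
  proof (intro equalityI subsetI)
    fix k assume "k \<in> krange D n"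
    thus "k \<in> (\<Union>x0\<in>peaks. ?N x0) \<union> far \<epsilon> n"
      by (cases "\<exists>x0\<in>peaks. \<bar>real k / real n - x0\<bar> \<le> \<epsilon>") (auto simp: far_def not_le)
  next
    fix k assume "k \<in> (\<Union>x0\<in>peaks. ?N x0) \<union> far \<epsilon> n"
    thus "k \<in> krange D n"
    proof
      assume "k \<in> (\<Union>x0\<in>peaks. ?N x0)"
      then obtain x0 where "x0 \<in> peaks" "k \<in> ?N x0" by (rule UN_E)
      with sub show ?thesis by blast
    next
      assume "k \<in> far \<epsilon> n"
      thus ?thesis by (simp add: far_def)
    qed
  qed
  have disj: "(\<Union>x0\<in>peaks. ?N x0) \<inter> far \<epsilon> n = {}"
  proof (rule equals0I)
    fix k assume k: "k \<in> (\<Union>x0\<in>peaks. ?N x0) \<inter> far \<epsilon> n"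
    then obtain x0 where x0: "x0 \<in> peaks" "k \<in> ?N x0" by blast
    have "\<epsilon> < \<bar>real k / real n - x0\<bar>" using k x0(1) by (simp add: far_def)
    thus False using x0(2) by simp
  qed
  have finU: "finite (\<Union>x0\<in>peaks. ?N x0)" using finite_peaks fin by blast
  have "gsum D n = infsum (summand n) (krange D n)" by (simp only: gsum_def summand_def[abs_def])
  also have "\<dots> = infsum (summand n) (\<Union>x0\<in>peaks. ?N x0) + infsum (summand n) (far \<epsilon> n)"
    unfolding split by (rule infsum_Un_disjoint[OF summable_on_finite[OF finU] far disj])
  also have "infsum (summand n) (\<Union>x0\<in>peaks. ?N x0) = sum (summand n) (\<Union>x0\<in>peaks. ?N x0)"
    using finU by simp
  also have "\<dots> = (\<Sum>x0\<in>peaks. sum (summand n) (?N x0))"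
  proof (rule sum.UNION_disjoint[OF finite_peaks])
    show "\<forall>x0\<in>peaks. finite (?N x0)" using fin by blast
    show "\<forall>x0\<in>peaks. \<forall>y0\<in>peaks. x0 \<noteq> y0 \<longrightarrow> ?N x0 \<inter> ?N y0 = {}"
    proof (intro ballI impI equals0I)
      fix x0 y0 k assume a: "x0 \<in> peaks" "y0 \<in> peaks" "x0 \<noteq> y0" and k: "k \<in> ?N x0 \<inter> ?N y0"
      have "\<bar>x0 - y0\<bar> \<le> 2 * \<epsilon>" using k by (simp add: abs_le_iff)
      with sep[OF a] show False by simp
    qed
  qed
  finally show ?thesis .
qed

lemma Cconst_eq: "Cconst D = (\<Sum>x0\<in>peaks. of_real (sqrt (2 * pi)) * (ufun D x0 / of_real (sqrt (phi_d2 x0))))"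
proof -
  have "Cconst D = of_real (sqrt (2 * pi)) * (\<Sum>x\<in>peaks. ufun D x / of_real (sqrt (phi'' D x)))"
    unfolding Cconst_def Maxset_eq by (subst sum.reindex) (auto simp: inj_on_def)
  also have "(\<Sum>x\<in>peaks. ufun D x / of_real (sqrt (phi'' D x))) = (\<Sum>x\<in>peaks. ufun D x / of_real (sqrt (phi_d2 x)))"
    by (rule sum.cong) (use peaks_subset_U phi''_eq in auto)
  finally show ?thesis by (simp add: sum_distrib_left)
qed

text \<open>q^n is split into two factors sqrt q ^ n: one beats the power of n, the other is the
  exponential gain with base 1 / sqrt q.\<close>

lemma powr_times_power_bound:
  fixes q B :: real
  assumes "0 < q" "q < 1"
  shows "eventually (\<lambda>n::nat. real n powr B * q ^ n \<le> (1 / sqrt q) powr (- real n)) sequentially"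
proof -
  have s: "0 < sqrt q" "sqrt q < 1" using assms by auto
  have "eventually (\<lambda>n::nat. real n powr B * sqrt q ^ n \<le> 1) sequentially" using s by real_asymp
  thus ?thesis
  proof eventually_elim
    case (elim n)
    have "q ^ n = sqrt q ^ n * sqrt q ^ n" using assms by (simp flip: power_mult_distrib)
    hence "real n powr B * q ^ n = (real n powr B * sqrt q ^ n) * sqrt q ^ n" by simp
    also have "\<dots> \<le> 1 * sqrt q ^ n" using elim s by (intro mult_right_mono) auto
    also have "\<dots> = (1 / sqrt q) powr (- real n)"
      using s by (simp add: powr_minus powr_realpow power_one_over divide_inverse power_inverse)
    finally show ?case .
  qed
qed

lemma gsum_asymptotics:
  "\<exists>\<Omega> :: nat \<Rightarrow> complex.
    (\<forall>n\<ge>1. gsum D n =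
       of_nat n powr (gam D + 1 / 2) *
       of_real ((real n / exp 1) powr (nu D * real n)) *
       of_real (Phi_max D ^ n) * (Cconst D + \<Omega> n)) \<and>
    (\<exists>K>0. \<exists>L>1. \<exists>N. \<forall>n\<ge>N.
       norm (\<Omega> n) \<le> K * (real n powr (- 1 / 2) +
         L powr (- real n) * (inverse (delta0 D n) + inverse (delta1 D n))))"
proof -
  let ?\<delta> = "\<lambda>n. inverse (delta0 D n) + inverse (delta1 D n)"
  define P where "P = (\<lambda>n. of_nat n powr (gam D + 1 / 2) * of_real ((real n / exp 1) powr (nu D * real n)) * of_real (Phi_max D ^ n))"
  \<comment> \<open>With the error defined by the identity, the identity holds for every n \<ge> 1,
    even for small n where \<open>infsum\<close> may take its default value 0. What remains is the
    bound for large n.\<close>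
  define \<Omega> where "\<Omega> = (\<lambda>n. gsum D n / P n - Cconst D)"
  have P: "P n = prefactor n * of_real (sqrt (real n))" if "n \<ge> 1" for n
  proof -
    have "of_nat n powr (1 / 2 :: complex) = of_real (real n) powr of_real (1 / 2)" by simp
    also have "\<dots> = of_real (sqrt (real n))" by (subst powr_of_real) (simp_all add: powr_half_sqrt)
    finally show ?thesis by (simp add: P_def prefactor_def powr_add mult_ac)
  qed
  have P0: "P n \<noteq> 0" if "n \<ge> 1" for n using P[OF that] prefactor_nonzero[OF that] that by simp
  obtain \<epsilon> where \<epsilon>: "\<epsilon> > 0" "\<And>x0. x0 \<in> peaks \<Longrightarrow> cball x0 \<epsilon> \<subseteq> U"
    "\<And>x0 y0. x0 \<in> peaks \<Longrightarrow> y0 \<in> peaks \<Longrightarrow> x0 \<noteq> y0 \<Longrightarrow> 2 * \<epsilon> < \<bar>x0 - y0\<bar>"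
    "\<And>x0. x0 \<in> peaks \<Longrightarrow> \<exists>C N. \<forall>n\<ge>N. finite {k::nat. \<bar>real k / real n - x0\<bar> \<le> \<epsilon>} \<and>
      norm ((\<Sum>k | \<bar>real k / real n - x0\<bar> \<le> \<epsilon>. summand n k / prefactor n) - of_real (sqrt (2 * pi * real n / phi_d2 x0)) * ufun D x0) \<le> C"
    using peaks_isolating_radius by blast
  let ?T = "\<lambda>n x0. \<Sum>k | \<bar>real k / real n - x0\<bar> \<le> \<epsilon>. summand n k / prefactor n"
  let ?G = "\<lambda>n x0. of_real (sqrt (2 * pi * real n / phi_d2 x0)) * ufun D x0"
  have "\<forall>x0\<in>peaks. \<exists>C N. \<forall>n\<ge>N. finite {k::nat. \<bar>real k / real n - x0\<bar> \<le> \<epsilon>} \<and> norm (?T n x0 - ?G n x0) \<le> C"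
    using \<epsilon>(4) by blast
  from bchoice[OF this] obtain Cf where Cf: "\<And>x0. x0 \<in> peaks \<Longrightarrow> \<exists>N. \<forall>n\<ge>N. finite {k::nat. \<bar>real k / real n - x0\<bar> \<le> \<epsilon>} \<and> norm (?T n x0 - ?G n x0) \<le> Cf x0"
    by blast
  have "eventually (\<lambda>n. \<forall>x0\<in>peaks. finite {k::nat. \<bar>real k / real n - x0\<bar> \<le> \<epsilon>} \<and> norm (?T n x0 - ?G n x0) \<le> Cf x0) sequentially"
    by (intro eventually_ball_finite finite_peaks ballI) (use Cf in \<open>simp only: eventually_sequentially\<close>)
  moreover obtain K A q N1 where far: "K > 0" "0 < q" "q < 1" "\<And>n. n \<ge> N1 \<Longrightarrow> summand n summable_on far \<epsilon> n"
    "\<And>n. n \<ge> N1 \<Longrightarrow> norm (infsum (summand n) (far \<epsilon> n)) \<le> K * ?\<delta> n *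
      ((real n / exp 1) powr (nu D * real n) * real n powr A * (q * Phi_max D) ^ n)"
    using far_sum[OF \<epsilon>(1)] by blast
  define C where "C = sum Cf peaks"
  have "eventually (\<lambda>n. norm (\<Omega> n) \<le> (\<bar>C\<bar> + K) * (real n powr (- 1 / 2) + (1 / sqrt q) powr (- real n) * ?\<delta> n)) sequentially"
    using calculation eventually_ge_at_top[of "max N1 1"] powr_times_power_bound[OF far(2,3), of "A - Re (gam D) - 1 / 2"]
  proof eventually_elim
    case (elim n)
    have n: "n \<ge> 1" "n \<ge> N1" "real n > 0" using elim(2) by auto
    have d: "?\<delta> n > 0" using generic[OF n(1)] by (simp add: add_pos_pos)
    have sn: "real n powr (- 1 / 2) = 1 / sqrt (real n)"
      using powr_minus_divide[of "real n" "1 / 2"] by (simp add: powr_half_sqrt)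
    define F where "F = infsum (summand n) (far \<epsilon> n)"
    have g: "gsum D n = (\<Sum>x0\<in>peaks. \<Sum>k | \<bar>real k / real n - x0\<bar> \<le> \<epsilon>. summand n k) + F"
      unfolding F_def by (rule gsum_eq_near_plus_far[OF n(1) \<epsilon>(2,3) _ far(4)[OF n(2)]]) (use elim(1) in auto)
    have "gsum D n / P n = (\<Sum>x0\<in>peaks. ?T n x0 / of_real (sqrt (real n))) + F / P n"
      unfolding g add_divide_distrib sum_divide_distrib P[OF n(1)] by (simp add: divide_divide_eq_left)
    \<comment> \<open>The Gaussian main terms of the windows, divided by sqrt n, are exactly the
      terms of the constant.\<close>
    moreover have "Cconst D = (\<Sum>x0\<in>peaks. ?G n x0 / of_real (sqrt (real n)))"
      unfolding Cconst_eq
    proof (rule sum.cong[OF refl])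
      fix x0 assume "x0 \<in> peaks"
      have "sqrt (2 * pi * real n / phi_d2 x0) = sqrt (2 * pi) * sqrt (real n) / sqrt (phi_d2 x0)"
        by (simp only: real_sqrt_mult real_sqrt_divide)
      thus "of_real (sqrt (2 * pi)) * (ufun D x0 / of_real (sqrt (phi_d2 x0))) = ?G n x0 / of_real (sqrt (real n))"
        using n by (simp add: mult_ac)
    qed
    ultimately have "\<Omega> n = (\<Sum>x0\<in>peaks. (?T n x0 - ?G n x0) / of_real (sqrt (real n))) + F / P n"
      by (simp add: \<Omega>_def sum_subtractf diff_divide_distrib)
    hence "norm (\<Omega> n) \<le> norm (\<Sum>x0\<in>peaks. (?T n x0 - ?G n x0) / of_real (sqrt (real n))) + norm (F / P n)"
      by (simp only: norm_triangle_ineq)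
    \<comment> \<open>An O(1) error per peak becomes n^(-1/2) after division by sqrt n.\<close>
    also have "norm (\<Sum>x0\<in>peaks. (?T n x0 - ?G n x0) / of_real (sqrt (real n))) \<le> (\<Sum>x0\<in>peaks. Cf x0 / sqrt (real n))"
    proof (rule sum_norm_le)
      fix x0 assume x0: "x0 \<in> peaks"
      have "norm ((?T n x0 - ?G n x0) / of_real (sqrt (real n))) = norm (?T n x0 - ?G n x0) / sqrt (real n)"
        using n by (simp only: norm_divide norm_of_real) simp
      also have "\<dots> \<le> Cf x0 / sqrt (real n)" using elim(1) x0 by (intro divide_right_mono) auto
      finally show "norm ((?T n x0 - ?G n x0) / of_real (sqrt (real n))) \<le> Cf x0 / sqrt (real n)" .
    qed
    also have "(\<Sum>x0\<in>peaks. Cf x0 / sqrt (real n)) = C * real n powr (- 1 / 2)"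
      by (simp only: C_def sum_divide_distrib sn times_divide_eq_right mult_1_right)
    also have "\<dots> \<le> \<bar>C\<bar> * real n powr (- 1 / 2)" by (intro mult_right_mono) auto
    also have "norm (F / P n) \<le> K * ?\<delta> n * (1 / sqrt q) powr (- real n)"
    proof -
      define E where "E = (real n / exp 1) powr (nu D * real n) * Phi_max D ^ n"
      have E: "E > 0" using n Phi_max_pos by (simp add: E_def)
      have nP: "norm (P n) = real n powr (Re (gam D) + 1 / 2) * E"
        using n by (simp add: P norm_mult norm_prefactor E_def powr_add powr_half_sqrt)
      have "norm F \<le> K * ?\<delta> n * ((real n / exp 1) powr (nu D * real n) * real n powr A * (q * Phi_max D) ^ n)"
        unfolding F_def by (rule far(5)[OF n(2)])
      also have "\<dots> = K * ?\<delta> n * (real n powr A * q ^ n) * E" by (simp add: E_def power_mult_distrib mult_ac)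
      finally have "norm F / norm (P n) \<le> (K * ?\<delta> n * (real n powr A * q ^ n) * E) / norm (P n)" by (rule divide_right_mono) simp
      also have "\<dots> = K * ?\<delta> n * (real n powr (A - Re (gam D) - 1 / 2) * q ^ n)"
      proof -
        have "real n powr (A - Re (gam D) - 1 / 2) = real n powr A / real n powr (Re (gam D) + 1 / 2)"
          by (simp only: powr_diff[symmetric] diff_diff_eq)
        thus ?thesis using E unfolding nP by simp
      qed
      also have "\<dots> \<le> K * ?\<delta> n * (1 / sqrt q) powr (- real n)"
        using elim(3) far(1) d by (intro mult_left_mono) auto
      finally show ?thesis by (simp only: norm_divide)
    qed
    finally have "norm (\<Omega> n) \<le> \<bar>C\<bar> * real n powr (- 1 / 2) + K * ((1 / sqrt q) powr (- real n) * ?\<delta> n)" by (simp add: mult_ac)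
    also have "\<dots> \<le> (\<bar>C\<bar> + K) * real n powr (- 1 / 2) + (\<bar>C\<bar> + K) * ((1 / sqrt q) powr (- real n) * ?\<delta> n)"
      using far(1) d by (intro add_mono mult_right_mono) auto
    finally show ?case by (simp only: distrib_left)
  qed
  then obtain N where N: "\<forall>n\<ge>N. norm (\<Omega> n) \<le> (\<bar>C\<bar> + K) * (real n powr (- 1 / 2) + (1 / sqrt q) powr (- real n) * ?\<delta> n)"
    unfolding eventually_sequentially by blast
  have K: "\<bar>C\<bar> + K > 0" using far(1) by simp
  have L: "1 / sqrt q > 1" using far(2,3) by simp
  have eq: "\<forall>n\<ge>1. gsum D n = of_nat n powr (gam D + 1 / 2) * of_real ((real n / exp 1) powr (nu D * real n)) *
       of_real (Phi_max D ^ n) * (Cconst D + \<Omega> n)"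
    unfolding P_def[symmetric, THEN fun_cong] \<Omega>_def using P0 by simp
  from eq K L N show ?thesis by blast
qed

end

text \<open>The criterion for convergence is itself a claim and forms the first conjunct; the
  expansion then takes convergence in its analytic form as a hypothesis, and the criterion
  translates it into the conditions on rho, nu and gamma that the estimates work with.\<close>

theorem theorem5p3:
  fixes D :: "('i, 'j) gamma_sum_data"
  assumes "0 \<le> r0 D" and "ereal (r0 D) < r1 D"
    and "finite (Iset D)" and "finite (Jset D)"
    and "\<forall>i\<in>Iset D. sig D i \<noteq> 0" and "\<forall>j\<in>Jset D. tau D j \<noteq> 0"
    and "zval D > 0"
    and balancedness: "(\<Sum>i\<in>Iset D. sig D i) = (\<Sum>j\<in>Jset D. tau D j)"
    and positivity: "\<forall>x::real. r0 D < x \<and> ereal x < r1 D \<longrightarrow>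
          (\<forall>i\<in>Iset D. lform D i x > 0) \<and> (\<forall>j\<in>Jset D. mform D j x > 0)"
    and genericness: "\<forall>n\<ge>1. delta0 D n > 0 \<and> delta1 D n > 0"
  shows
    "(r1 D = \<infinity> \<longrightarrow>
        ((\<forall>\<^sub>F n in sequentially. gsum_abs_convergent D n) \<longleftrightarrow>
          (0 < rho D \<and> rho D < 1) \<or>
          (rho D = 1 \<and> nu D < 0) \<or>
          (rho D = 1 \<and> nu D = 0 \<and> Re (gam D) < - 1)))
     \<and>
     ((r1 D = \<infinity> \<longrightarrow> (\<forall>\<^sub>F n in sequentially. gsum_abs_convergent D n)) \<longrightarrow>
      Phi D (ereal (r0 D)) < Phi_max D \<longrightarrow>
      Phi D (r1 D) < Phi_max D \<longrightarrow>
      (\<forall>x\<in>Maxset D. phi'' D (real_of_ereal x) > 0) \<longrightarrow>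
      (\<exists>\<Omega> :: nat \<Rightarrow> complex.
        (\<forall>n\<ge>1. gsum D n =
           of_nat n powr (gam D + 1 / 2) *
           of_real ((real n / exp 1) powr (nu D * real n)) *
           of_real (Phi_max D ^ n) * (Cconst D + \<Omega> n)) \<and>
        (\<exists>K>0. \<exists>L>1. \<exists>N. \<forall>n\<ge>N.
           norm (\<Omega> n) \<le> K * (real n powr (- 1 / 2) +
             L powr (- real n) * (inverse (delta0 D n) + inverse (delta1 D n))))))"
proof -
  interpret gamma_sum D
    by unfold_locales (use assms in blast)+
  show ?thesis
  proof (intro conjI impI)
    assume "r1 D = \<infinity>"
    thus "(\<forall>\<^sub>F n in sequentially. gsum_abs_convergent D n) \<longleftrightarrow>
          (0 < rho D \<and> rho D < 1) \<or>
          (rho D = 1 \<and> nu D < 0) \<or>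
          (rho D = 1 \<and> nu D = 0 \<and> Re (gam D) < - 1)"
      by (rule eventually_gsum_abs_convergent_iff)
  next
    assume "r1 D = \<infinity> \<longrightarrow> (\<forall>\<^sub>F n in sequentially. gsum_abs_convergent D n)"
    hence conv: "r1 D = \<infinity> \<Longrightarrow> rho D < 1 \<or> rho D = 1 \<and> nu D < 0 \<or> rho D = 1 \<and> nu D = 0 \<and> Re (gam D) < - 1"
      using eventually_gsum_abs_convergent_iff by blast
    assume "Phi D (ereal (r0 D)) < Phi_max D" "Phi D (r1 D) < Phi_max D"
      and "\<forall>x\<in>Maxset D. phi'' D (real_of_ereal x) > 0"
    with conv interpret gamma_sum_peak D
      by unfold_locales (use genericness in blast)+
    show "\<exists>\<Omega> :: nat \<Rightarrow> complex.
        (\<forall>n\<ge>1. gsum D n =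
           of_nat n powr (gam D + 1 / 2) *
           of_real ((real n / exp 1) powr (nu D * real n)) *
           of_real (Phi_max D ^ n) * (Cconst D + \<Omega> n)) \<and>
        (\<exists>K>0. \<exists>L>1. \<exists>N. \<forall>n\<ge>N.
           norm (\<Omega> n) \<le> K * (real n powr (- 1 / 2) +
             L powr (- real n) * (inverse (delta0 D n) + inverse (delta1 D n))))"
      by (rule gsum_asymptotics)
  qed
qed

end
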